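(* Let $\mathbf e=(e_1,e_2)$ be a distinguished nilpotent pair in a classical simple Lie algebra $\mathfrak g\subset\mathfrak{gl}(V)$ (i.e. $\mathfrak{sl}(V)$, $\mathfrak{so}(V)$ or $\mathfrak{sp}(V)$), and let $\Gamma$ be the corresponding skew-graph. Then $\mathbf e$ is rectangular if and only if each connected component of $\Gamma$ is rectangular.
   Context: $K$ is an algebraically closed field of characteristic $0$; $\mathfrak z_{\mathfrak g}(M)$ denotes the centralizer of $M$ in $\mathfrak g$; $G$ is the adjoint group of $\mathfrak g$; $V$ is the space of the tautological representation. **Pairs.** A pair $\mathbf e=(e_1,e_2)\in\mathfrak g\times\mathfrak g$ is *nilpotent* if $[e_1,e_2]=0$ and for all $t_1,t_2\in K^*$ there is $g\in G$ with $(t_1e_1,t_2e_2)=(g\cdot e_1,g\cdot e_2)$. An *associated semisimple pair* for $\mathbf e$ is a pair $\mathbf h=(h_1,h_2)$ of semisimple elements with rational eigenvalues in $\mathfrak g$ such that $[h_1,h_2]=0$ and $[h_i,e_j]=\delta_{ij}e_j$. A nilpotent pair is *pre-distinguished* if $\mathfrak z_{\mathfrak g}(\mathbf e)$ contains no nonzero semisimple elements; *distinguished* if it is pre-distinguished and has an associated semisimple pair $\mathbf h$ such that $\mathfrak z_{\mathfrak g}(\mathbf h)$ is a Cartan subalgebra. (It is known that associated semisimple pairs of a pre-distinguished pair are conjugate.) A nilpotent pair $\mathbf e$ is *rectangular* if $e_1,e_2$ can be included in commuting $\mathfrak{sl}_2$-triples, i.e. there are $\tilde h_i,f_i\in\mathfrak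 g$ with $[\tilde h_i,e_i]=2e_i$, $[\tilde h_i,f_i]=-2f_i$, $[e_i,f_i]=\tilde h_i$ ($i=1,2$) such that every element of $\{e_1,\tilde h_1,f_1\}$ commutes with every element of $\{e_2,\tilde h_2,f_2\}$. **Skew-graphs.** A *skew-graph* is a finite oriented graph with node set $n(\Gamma)\subset\mathbb Q\times\mathbb Q$ whose barycentre is the origin, whose arrows all have the form $(i,j)\to(i+1,j)$ or $(i,j)\to(i,j+1)$, and such that if $(i,j),(i+1,j+1)$ lie in the same connected component $\Gamma_1$, then $(i,j+1),(i+1,j)\in n(\Gamma_1)$ and all four arrows of this unit square are arrows of $\Gamma_1$. Different connected components are allowed to have common nodes. A connected skew-graph is drawn as a collection of unit squares centred at its nodes (its skew-diagram), and it is *rectangular* if this diagram is a rectangle. A connected skew-graph is *centrally-symmetric* (c.-s.) if invariant under $(i,j)\mapsto(-i,-j)$ (ignoring orientation), and c.-s. *integral* if moreover all nodes lie in $\mathbb Z^2$. **The skew-graph of a distinguished pair.** Choose an associated semisimple pair $\mathbf h$ and put $V_{p,q}=\{v\in V: h_1v=pv,\ h_2v=qv\}$. If all $\dim V_{p,q}\le1$, then $\Gamma$ has nodes $\{(p,q): V_{p,q}\ne0\}$, with arrow $(p,q)\to(p+1,q)$ iff $e_1(V_{p,q})\ne0$ and arrow $(p,q)\to(p,q+1)$ iff $e_2(V_{p,q})\neq0$. The only other possibility is $\mathfrak g=\mathfrak{so}_{2n}$, $\dim V_{0,0}=2$, all other $\dim V_{p,q}\le1$. For a subspace $W\subset V$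 stable under $e_1,e_2,h_1,h_2$ with all $\dim (W\cap V_{p,q})\le1$, let the graph attached to $W$ be the graph with nodes $\{(p,q): W\cap V_{p,q}\ne0\}$, with arrow $(p,q)\to(p+1,q)$ iff $e_1(W\cap V_{p,q})\ne0$ and arrow $(p,q)\to(p,q+1)$ iff $e_2(W\cap V_{p,q})\ne0$. Then let $V_{fr}$ be the sum of the $V_{p,q}$ with $(p,q)\notin\mathbb Z^2$ and $V_{int}$ the sum of those with $(p,q)\in\mathbb Z^2$; there is an orthogonal decomposition $V_{int}=V_1\oplus V_2$, stable under $e_1,e_2,h_1,h_2$, such that each $V_i$ has $\mathbf h$-eigenspaces of dimension at most $1$ and the graphs $\Gamma_1,\Gamma_2$ attached to $V_1,V_2$ are connected c.-s. integral and satisfy either $n(\Gamma_2)=\{(0,0)\}$, $\#n(\Gamma_1)>1$, or $\#n(\Gamma_1),\#n(\Gamma_2)>1$, $n(\Gamma_1)\cap n(\Gamma_2)=\{(0,0)\}$. The skew-graph $\Gamma$ then has components $\Gamma_1,\Gamma_2$ and, if $V_{fr}\ne0$, also the (connected) graph $\Gamma_0$ attached to $V_{fr}$. *)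

theory Defs
  imports
    "HOL-Analysis.Analysis"
    "HOL-Computational_Algebra.Polynomial"
    "Graph_Theory.Digraph_Component"
begin

text \<open>
  The space of the tautological representation is \<open>'k^'n\<close>, and Lie algebras are sets of
  matrices \<open>'k^'n^'n\<close>.  HOL-Analysis has no scaling of a matrix by a field element.
\<close>

definition mscale :: "'k::field \<Rightarrow> 'k^'n^'n \<Rightarrow> 'k^'n^'n" where
  "mscale c X = (\<chi> i. c *s X $ i)"

interpretation mat_space: vector_space "mscale :: 'k::field \<Rightarrow> 'k^'n^'n \<Rightarrow> 'k^'n^'n"
  by unfold_locales (simp_all add: mscale_def vec_eq_iff algebra_simps)


section \<open>Lie algebras of matrices\<close>

definition bracket :: "'k::field^'n^'n \<Rightarrow> 'k^'n^'n \<Rightarrow> 'k^'n^'n" where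
  "bracket X Y = X ** Y - Y ** X"

definition lie_subalgebra :: "('k::field^'n^'n) set \<Rightarrow> ('k^'n^'n) set \<Rightarrow> bool" where
  "lie_subalgebra \<aa> \<gg> \<longleftrightarrow>
     \<aa> \<subseteq> \<gg> \<and> mat_space.subspace \<aa> \<and> (\<forall>x\<in>\<aa>. \<forall>y\<in>\<aa>. bracket x y \<in> \<aa>)"

definition lie_ideal :: "('k::field^'n^'n) set \<Rightarrow> ('k^'n^'n) set \<Rightarrow> bool" where
  "lie_ideal \<ii> \<gg> \<longleftrightarrow>
     \<ii> \<subseteq> \<gg> \<and> mat_space.subspace \<ii> \<and> (\<forall>x\<in>\<gg>. \<forall>y\<in>\<ii>. bracket x y \<in> \<ii>)"

definition lie_simple :: "('k::field^'n^'n) set \<Rightarrow> bool" where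
  "lie_simple \<gg> \<longleftrightarrow>
     lie_subalgebra \<gg> UNIV \<and> (\<exists>x\<in>\<gg>. \<exists>y\<in>\<gg>. bracket x y \<noteq> 0) \<and>
     (\<forall>\<ii>. lie_ideal \<ii> \<gg> \<longrightarrow> \<ii> = {0} \<or> \<ii> = \<gg>)"

primrec lower_central :: "('k::field^'n^'n) set \<Rightarrow> nat \<Rightarrow> ('k^'n^'n) set" where
  "lower_central \<aa> 0 = \<aa>"
| "lower_central \<aa> (Suc m) =
     mat_space.span {bracket x y | x y. x \<in> \<aa> \<and> y \<in> lower_central \<aa> m}"

definition lie_nilpotent :: "('k::field^'n^'n) set \<Rightarrow> bool" where
  "lie_nilpotent \<aa> \<longleftrightarrow> (\<exists>m. lower_central \<aa> m = {0})"

definition centralizer ::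
  "('k::field^'n^'n) set \<Rightarrow> ('k^'n^'n) set \<Rightarrow> ('k^'n^'n) set" where
  "centralizer \<gg> M = {x \<in> \<gg>. \<forall>m\<in>M. bracket x m = 0}"

definition normalizer ::
  "('k::field^'n^'n) set \<Rightarrow> ('k^'n^'n) set \<Rightarrow> ('k^'n^'n) set" where
  "normalizer \<gg> \<aa> = {x \<in> \<gg>. \<forall>a\<in>\<aa>. bracket x a \<in> \<aa>}"

definition cartan_subalgebra :: "('k::field^'n^'n) set \<Rightarrow> ('k^'n^'n) set \<Rightarrow> bool" where
  "cartan_subalgebra \<cc> \<gg> \<longleftrightarrow>
     lie_subalgebra \<cc> \<gg> \<and> lie_nilpotent \<cc> \<and> normalizer \<gg> \<cc> = \<cc>"

text \<open>
  The sum below ranges over a finite set whenever \<open>ad x\<close> is nilpotent.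
\<close>

definition exp_ad :: "'k::field_char_0^'n^'n \<Rightarrow> 'k^'n^'n \<Rightarrow> 'k^'n^'n" where
  "exp_ad x y =
     (\<Sum>k | (bracket x ^^ k) y \<noteq> 0. mscale (1 / fact k) ((bracket x ^^ k) y))"

text \<open>
  The adjoint group of a semisimple \<open>\<gg>\<close>: the group of inner automorphisms, generated by the
  \<open>exp (ad x)\<close> with \<open>ad x\<close> nilpotent on \<open>\<gg>\<close>.  Since \<open>exp (ad (- x))\<close> is the inverse of
  \<open>exp (ad x)\<close>, closure under composition suffices.  Only the restriction to \<open>\<gg>\<close> of an
  element is meaningful.
\<close>

inductive_set adjoint_group ::
  "('k::field_char_0^'n^'n) set \<Rightarrow> ('k^'n^'n \<Rightarrow> 'k^'n^'n) set" for \<gg> where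
  one: "id \<in> adjoint_group \<gg>"
| exp: "\<lbrakk>\<phi> \<in> adjoint_group \<gg>; x \<in> \<gg>; \<exists>m. \<forall>y\<in>\<gg>. (bracket x ^^ m) y = 0\<rbrakk>
        \<Longrightarrow> exp_ad x \<circ> \<phi> \<in> adjoint_group \<gg>"

definition semisimple_elt :: "'k::field^'n^'n \<Rightarrow> bool" where
  "semisimple_elt x \<longleftrightarrow> vec.span {v. \<exists>c. x *v v = c *s v} = UNIV"

definition rational_eigenvalues :: "'k::field_char_0^'n^'n \<Rightarrow> bool" where
  "rational_eigenvalues x \<longleftrightarrow> (\<forall>c v. v \<noteq> 0 \<and> x *v v = c *s v \<longrightarrow> c \<in> \<rat>)"


section \<open>Classical simple Lie algebras\<close>

type_synonym ('k, 'n) form = "'k^'n \<Rightarrow> 'k^'n \<Rightarrow> 'k"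

definition nondegenerate_form :: "('k::field, 'n::finite) form \<Rightarrow> bool" where
  "nondegenerate_form B \<longleftrightarrow>
     (\<forall>w. Vector_Spaces.linear (*s) (*) (\<lambda>v. B v w)) \<and>
     (\<forall>v. Vector_Spaces.linear (*s) (*) (B v)) \<and>
     (\<forall>v. (\<forall>w. B v w = 0) \<longrightarrow> v = 0)"

definition symmetric_form :: "('k::field, 'n) form \<Rightarrow> bool" where
  "symmetric_form B \<longleftrightarrow> (\<forall>v w. B v w = B w v)"

definition alternating_form :: "('k::field, 'n) form \<Rightarrow> bool" where
  "alternating_form B \<longleftrightarrow> (\<forall>v. B v v = 0)"

text \<open>
  This is \<open>so\<close> of the form if it is symmetric, and \<open>sp\<close> if it is alternating.
\<close>

definition skew_adjoint :: "('k::field, 'n::finite) form \<Rightarrow> ('k^'n^'n) set" where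
  "skew_adjoint B = {X. \<forall>v w. B (X *v v) w + B v (X *v w) = 0}"

definition is_sl :: "('k::field^'n^'n) set \<Rightarrow> bool" where
  "is_sl \<gg> \<longleftrightarrow> \<gg> = {X. trace X = 0}"

definition is_so :: "('k::field, 'n::finite) form \<Rightarrow> ('k^'n^'n) set \<Rightarrow> bool" where
  "is_so B \<gg> \<longleftrightarrow> nondegenerate_form B \<and> symmetric_form B \<and> \<gg> = skew_adjoint B"

definition is_sp :: "('k::field, 'n::finite) form \<Rightarrow> ('k^'n^'n) set \<Rightarrow> bool" where
  "is_sp B \<gg> \<longleftrightarrow> nondegenerate_form B \<and> alternating_form B \<and> \<gg> = skew_adjoint B"

definition classical_simple :: "('k::field^'n^'n) set \<Rightarrow> bool" where
  "classical_simple \<gg> \<longleftrightarrow>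
     lie_simple \<gg> \<and> (is_sl \<gg> \<or> (\<exists>B. is_so B \<gg>) \<or> (\<exists>B. is_sp B \<gg>))"


section \<open>Nilpotent pairs\<close>

definition nilpotent_pair ::
  "('k::field_char_0^'n^'n) set \<Rightarrow> 'k^'n^'n \<Rightarrow> 'k^'n^'n \<Rightarrow> bool" where
  "nilpotent_pair \<gg> e1 e2 \<longleftrightarrow>
     e1 \<in> \<gg> \<and> e2 \<in> \<gg> \<and> bracket e1 e2 = 0 \<and>
     (\<forall>t1 t2. t1 \<noteq> 0 \<and> t2 \<noteq> 0 \<longrightarrow>
        (\<exists>\<phi>\<in>adjoint_group \<gg>. mscale t1 e1 = \<phi> e1 \<and> mscale t2 e2 = \<phi> e2))"

definition associated_semisimple_pair ::
  "('k::field_char_0^'n^'n) set \<Rightarrow> 'k^'n^'n \<Rightarrow> 'k^'n^'n \<Rightarrow> 'k^'n^'n \<Rightarrow> 'k^'n^'n \<Rightarrow> bool"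
  where
  "associated_semisimple_pair \<gg> e1 e2 h1 h2 \<longleftrightarrow>
     h1 \<in> \<gg> \<and> semisimple_elt h1 \<and> rational_eigenvalues h1 \<and>
     h2 \<in> \<gg> \<and> semisimple_elt h2 \<and> rational_eigenvalues h2 \<and>
     bracket h1 h2 = 0 \<and>
     bracket h1 e1 = e1 \<and> bracket h1 e2 = 0 \<and> bracket h2 e1 = 0 \<and> bracket h2 e2 = e2"

definition pre_distinguished ::
  "('k::field_char_0^'n^'n) set \<Rightarrow> 'k^'n^'n \<Rightarrow> 'k^'n^'n \<Rightarrow> bool" where
  "pre_distinguished \<gg> e1 e2 \<longleftrightarrow>
     nilpotent_pair \<gg> e1 e2 \<and>
     (\<forall>x \<in> centralizer \<gg> {e1, e2}. semisimple_elt x \<longrightarrow> x = 0)"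

definition distinguished ::
  "('k::field_char_0^'n^'n) set \<Rightarrow> 'k^'n^'n \<Rightarrow> 'k^'n^'n \<Rightarrow> bool" where
  "distinguished \<gg> e1 e2 \<longleftrightarrow>
     pre_distinguished \<gg> e1 e2 \<and>
     (\<exists>h1 h2. associated_semisimple_pair \<gg> e1 e2 h1 h2 \<and>
        cartan_subalgebra (centralizer \<gg> {h1, h2}) \<gg>)"

definition sl2_triple :: "'k::field^'n^'n \<Rightarrow> 'k^'n^'n \<Rightarrow> 'k^'n^'n \<Rightarrow> bool" where
  "sl2_triple e h f \<longleftrightarrow>
     bracket h e = mscale 2 e \<and> bracket h f = mscale (- 2) f \<and> bracket e f = h"

definition rectangular_pair ::
  "('k::field_char_0^'n^'n) set \<Rightarrow> 'k^'n^'n \<Rightarrow> 'k^'n^'n \<Rightarrow> bool" where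
  "rectangular_pair \<gg> e1 e2 \<longleftrightarrow>
     nilpotent_pair \<gg> e1 e2 \<and>
     (\<exists>h1\<in>\<gg>. \<exists>f1\<in>\<gg>. \<exists>h2\<in>\<gg>. \<exists>f2\<in>\<gg>.
        sl2_triple e1 h1 f1 \<and> sl2_triple e2 h2 f2 \<and>
        (\<forall>x \<in> {e1, h1, f1}. \<forall>y \<in> {e2, h2, f2}. bracket x y = 0))"


section \<open>Skew-graphs\<close>

text \<open>
  The connected components of a skew-graph may share nodes, so a skew-graph is represented by
  the set of its connected components, each of which is an ordinary digraph on \<open>\<rat> \<times> \<rat>\<close>.
\<close>

type_synonym plane_digraph = "(rat \<times> rat) pair_pre_digraph"

type_synonym skew_graph = "plane_digraph set"

definition digraph_connected :: "plane_digraph \<Rightarrow> bool" where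
  "digraph_connected C \<longleftrightarrow> Digraph_Component.connected (with_proj C)"

definition components_of :: "plane_digraph \<Rightarrow> plane_digraph set" where
  "components_of G =
     {C. pre_digraph.max_subgraph (with_proj G) Digraph_Component.connected (with_proj C)}"

text \<open>
  The barycentre condition is stated for the sum of the nodes instead of their mean.
\<close>

definition connected_skew_graph :: "plane_digraph \<Rightarrow> bool" where
  "connected_skew_graph C \<longleftrightarrow>
     pair_fin_digraph C \<and> digraph_connected C \<and>
     (\<Sum>v\<in>pverts C. v) = 0 \<and>
     (\<forall>(u, v) \<in> parcs C. v = u + (1, 0) \<or> v = u + (0, 1)) \<and>
     (\<forall>i j. (i, j) \<in> pverts C \<and> (i + 1, j + 1) \<in> pverts C \<longrightarrow>
        {(i, j + 1), (i + 1, j)} \<subseteq> pverts C \<and>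
        {((i, j), (i + 1, j)), ((i, j), (i, j + 1)),
         ((i + 1, j), (i + 1, j + 1)), ((i, j + 1), (i + 1, j + 1))} \<subseteq> parcs C)"

definition skew_diagram :: "plane_digraph \<Rightarrow> (real \<times> real) set" where
  "skew_diagram C =
     (\<Union>(p, q) \<in> pverts C.
        {of_rat p - 1/2 .. of_rat p + 1/2} \<times> {of_rat q - 1/2 .. of_rat q + 1/2})"

definition rectangular :: "plane_digraph \<Rightarrow> bool" where
  "rectangular C \<longleftrightarrow>
     connected_skew_graph C \<and>
     (\<exists>a b c d. a < b \<and> c < d \<and> skew_diagram C = {a..b} \<times> {c..d})"

text \<open>
  \<open>mk_symmetric\<close> forgets the orientation of the arrows.
\<close>

definition centrally_symmetric :: "plane_digraph \<Rightarrow> bool" where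
  "centrally_symmetric C \<longleftrightarrow>
     connected_skew_graph C \<and>
     (\<forall>v \<in> pverts C. - v \<in> pverts C) \<and>
     (\<forall>(u, v) \<in> parcs C. (- u, - v) \<in> parcs (mk_symmetric (with_proj C)))"

definition cs_integral :: "plane_digraph \<Rightarrow> bool" where
  "cs_integral C \<longleftrightarrow> centrally_symmetric C \<and> pverts C \<subseteq> \<int> \<times> \<int>"


section \<open>The skew-graph of a distinguished pair\<close>

definition eigenspace ::
  "'k::field_char_0^'n^'n \<Rightarrow> 'k^'n^'n \<Rightarrow> rat \<times> rat \<Rightarrow> ('k^'n) set" where
  "eigenspace h1 h2 = (\<lambda>(p, q). {v. h1 *v v = of_rat p *s v \<and> h2 *v v = of_rat q *s v})"

definition attached_graph ::
  "'k::field_char_0^'n^'n \<Rightarrow> 'k^'n^'n \<Rightarrow> 'k^'n^'n \<Rightarrow> 'k^'n^'n \<Rightarrow> ('k^'n) set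
   \<Rightarrow> plane_digraph" where
  "attached_graph e1 e2 h1 h2 W =
     \<lparr>pverts = {u. W \<inter> eigenspace h1 h2 u \<noteq> {0}},
      parcs =
        {(u, u + (1, 0)) | u. \<exists>v \<in> W \<inter> eigenspace h1 h2 u. e1 *v v \<noteq> 0} \<union>
        {(u, u + (0, 1)) | u. \<exists>v \<in> W \<inter> eigenspace h1 h2 u. e2 *v v \<noteq> 0}\<rparr>"

definition integral_part ::
  "'k::field_char_0^'n^'n \<Rightarrow> 'k^'n^'n \<Rightarrow> ('k^'n) set" where
  "integral_part h1 h2 = vec.span (\<Union>u \<in> \<int> \<times> \<int>. eigenspace h1 h2 u)"

definition fractional_part ::
  "'k::field_char_0^'n^'n \<Rightarrow> 'k^'n^'n \<Rightarrow> ('k^'n) set" where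
  "fractional_part h1 h2 = vec.span (\<Union>u \<in> - (\<int> \<times> \<int>). eigenspace h1 h2 u)"

definition orthogonal_decomposition ::
  "('k::field, 'n::finite) form \<Rightarrow> ('k^'n) set \<Rightarrow> ('k^'n) set \<Rightarrow> ('k^'n) set \<Rightarrow> bool" where
  "orthogonal_decomposition B U U1 U2 \<longleftrightarrow>
     vec.subspace U1 \<and> vec.subspace U2 \<and>
     U1 \<inter> U2 = {0} \<and> U = {v + w | v w. v \<in> U1 \<and> w \<in> U2} \<and>
     (\<forall>v\<in>U1. \<forall>w\<in>U2. B v w = 0)"

definition stable :: "('k::field^'n^'n) set \<Rightarrow> ('k^'n) set \<Rightarrow> bool" where
  "stable M W \<longleftrightarrow> (\<forall>x\<in>M. \<forall>v\<in>W. x *v v \<in> W)"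

definition multiplicity_free_graph ::
  "'k::field_char_0^'n^'n \<Rightarrow> 'k^'n^'n \<Rightarrow> 'k^'n^'n \<Rightarrow> 'k^'n^'n \<Rightarrow> skew_graph \<Rightarrow> bool" where
  "multiplicity_free_graph e1 e2 h1 h2 \<Gamma> \<longleftrightarrow>
     (\<forall>u. vec.dim (eigenspace h1 h2 u) \<le> 1) \<and>
     \<Gamma> = components_of (attached_graph e1 e2 h1 h2 UNIV)"

definition so_even_graph ::
  "('k::field_char_0^'n^'n) set \<Rightarrow> 'k^'n^'n \<Rightarrow> 'k^'n^'n \<Rightarrow> 'k^'n^'n \<Rightarrow> 'k^'n^'n
   \<Rightarrow> skew_graph \<Rightarrow> bool" where
  "so_even_graph \<gg> e1 e2 h1 h2 \<Gamma> \<longleftrightarrow>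
     even CARD('n) \<and>
     vec.dim (eigenspace h1 h2 (0, 0)) = 2 \<and>
     (\<forall>u. u \<noteq> (0, 0) \<longrightarrow> vec.dim (eigenspace h1 h2 u) \<le> 1) \<and>
     (\<exists>B U1 U2 \<Gamma>1 \<Gamma>2.
        is_so B \<gg> \<and>
        orthogonal_decomposition B (integral_part h1 h2) U1 U2 \<and>
        stable {e1, e2, h1, h2} U1 \<and> stable {e1, e2, h1, h2} U2 \<and>
        (\<forall>u. vec.dim (U1 \<inter> eigenspace h1 h2 u) \<le> 1) \<and>
        (\<forall>u. vec.dim (U2 \<inter> eigenspace h1 h2 u) \<le> 1) \<and>
        \<Gamma>1 = attached_graph e1 e2 h1 h2 U1 \<and> cs_integral \<Gamma>1 \<and>
        \<Gamma>2 = attached_graph e1 e2 h1 h2 U2 \<and> cs_integral \<Gamma>2 \<and>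
        (pverts \<Gamma>2 = {(0, 0)} \<and> card (pverts \<Gamma>1) > 1 \<or>
         card (pverts \<Gamma>1) > 1 \<and> card (pverts \<Gamma>2) > 1 \<and>
         pverts \<Gamma>1 \<inter> pverts \<Gamma>2 = {(0, 0)}) \<and>
        \<Gamma> = {\<Gamma>1, \<Gamma>2} \<union>
            (if fractional_part h1 h2 = {0} then {}
             else {attached_graph e1 e2 h1 h2 (fractional_part h1 h2)}))"

text \<open>
  A relation, because the construction involves the choice of an associated semisimple pair
  and, in the second case, of an orthogonal decomposition.
\<close>

definition skew_graph_of_pair ::
  "('k::field_char_0^'n^'n) set \<Rightarrow> 'k^'n^'n \<Rightarrow> 'k^'n^'n \<Rightarrow> skew_graph \<Rightarrow> bool" where
  "skew_graph_of_pair \<gg> e1 e2 \<Gamma> \<longleftrightarrow>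
     (\<exists>h1 h2. associated_semisimple_pair \<gg> e1 e2 h1 h2 \<and>
        (multiplicity_free_graph e1 e2 h1 h2 \<Gamma> \<or> so_even_graph \<gg> e1 e2 h1 h2 \<Gamma>))"

end

theory Submission
  imports Defs
begin

text \<open>
  Let \<open>h1, h2\<close> bigrade \<open>V\<close>.  If \<open>e1, e2\<close> lie in commuting \<open>sl\<^sub>2\<close>-triples, replace the lowering
  operators by their components of bidegree \<open>(-1, 0)\<close> and \<open>(0, -1)\<close>.  The neutral elements are then
  replaced by their components of bidegree \<open>(0, 0)\<close>, which differ from \<open>2 h1, 2 h2\<close> by semisimple
  elements of the centralizer of the pair, hence not at all.  Conversely, lowering operators \<open>f1, f2\<close>
  of these bidegrees with \<open>[e1, f1] = 2 h1\<close> and \<open>[e2, f2] = 2 h2\<close> are unique, so they lie in the Lie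
  algebra and satisfy all other relations.  Thus the pair is rectangular iff such \<open>f1, f2\<close> exist, for
  the given \<open>h1, h2\<close>; no conjugacy of associated semisimple pairs is needed.

  If they exist, a highest weight vector generates a rectangle of weight lines, and no arrow of the
  graph enters or leaves it, by the representation theory of \<open>sl\<^sub>2\<close>.  If all components are
  rectangles, the eigenvalues of \<open>e1 f1\<close> and \<open>e2 f2\<close> are prescribed by the irreducible
  \<open>sl\<^sub>2\<close>-modules, and lowering operators with these eigenvalues exist.
\<close>

section \<open>Skew-graphs with rectangular diagram\<close>

text \<open>Uniqueness of lowering operators rests on one fact, applied to matrices under the
  adjoint action: a nonzero vector killed by \<open>e\<close> cannot have negative weight. It makes
  every homogeneous matrix that commutes with \<open>e_i\<close> and \<open>h_i\<close> commute with
  \<open>f_i\<close>, and it forces \<open>f_i\<close> to be skew for an invariant form, so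
  existence may be sought among arbitrary matrices. The obstacle is the two-dimensional zero weight
  space in the even orthogonal case. Elements of degree (0, 0) are still semisimple there, because a
  skew operator on a nondegenerate quadratic plane is diagonalizable over an algebraically closed
  field. The space is cut into three multiplicity-free pieces by idempotents of degree (0, 0) that
  commute with \<open>e1\<close> and \<open>e2\<close>. The graph of the fractional piece must be
  shown connected before it can be rectangular: the symmetric form forces m + n to be even for a
  fractional box with m by n steps, so both are odd, every such box contains (1/2, 1/2), and there
  is only one.\<close>

lemma digraph_connected_iff_no_cut:
  assumes "pair_wf_digraph G"
  shows "digraph_connected G \<longleftrightarrow> pverts G \<noteq> {} \<and>
    (\<forall>X. (\<forall>u v. (u, v) \<in> parcs G \<longrightarrow> (u \<in> X \<longleftrightarrow> v \<in> X)) \<and> X \<inter> pverts G \<noteq> {} \<longrightarrow> pverts G \<subseteq> X)"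
    (is "_ \<longleftrightarrow> _ \<and> (\<forall>X. ?closed X \<and> _ X \<longrightarrow> _ X)")
proof -
  interpret pair_wf_digraph G by fact
  define S where "S = mk_symmetric (with_proj G)"
  have S: "pverts S = pverts G" "\<And>u v. (u, v) \<in> parcs S \<longleftrightarrow> (u, v) \<in> parcs G \<or> (v, u) \<in> parcs G"
    by (auto simp: S_def parcs_mk_symmetric intro: bexI[rotated])
  interpret S: pair_wf_digraph S unfolding S_def ..
  have conn: "digraph_connected G \<longleftrightarrow> pverts G \<noteq> {} \<and> (\<forall>u\<in>pverts G. \<forall>v\<in>pverts G. u \<rightarrow>\<^sup>*\<^bsub>with_proj S\<^esub> v)"
    by (simp add: digraph_connected_def connected_def strongly_connected_def S_def)
  have closed_reach: "v \<in> X" if "u \<rightarrow>\<^sup>*\<^bsub>with_proj S\<^esub> v" "u \<in> X" "?closed X" for u v X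
    using that(1)
  proof (induct rule: S.reachable_induct)
    case (step x y)
    then show ?case using S(2)[of x y] that(3) by blast
  qed (use that(2) in simp)
  show ?thesis
  proof (intro iffI conjI allI impI)
    assume *: "digraph_connected G"
    then show "pverts G \<noteq> {}" using conn by blast
    fix X assume X: "?closed X \<and> X \<inter> pverts G \<noteq> {}"
    then obtain u where u: "u \<in> X" "u \<in> pverts G" by blast
    show "pverts G \<subseteq> X"
    proof
      fix v assume "v \<in> pverts G"
      then have "u \<rightarrow>\<^sup>*\<^bsub>with_proj S\<^esub> v" using * conn u by blast
      then show "v \<in> X" using closed_reach X u by blast
    qed
  next
    assume *: "pverts G \<noteq> {} \<and> (\<forall>X. ?closed X \<and> X \<inter> pverts G \<noteq> {} \<longrightarrow> pverts G \<subseteq> X)"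
    have "u \<rightarrow>\<^sup>*\<^bsub>with_proj S\<^esub> v" if u: "u \<in> pverts G" and v: "v \<in> pverts G" for u v
    proof -
      \<comment> \<open>The reachability class of \<open>u\<close> is itself closed under arcs in
        both directions, so the no-cut condition applies to it.\<close>
      define X where "X = {w. u \<rightarrow>\<^sup>*\<^bsub>with_proj S\<^esub> w}"
      have "u \<in> X" using u S(1) by (simp add: X_def)
      moreover have "?closed X"
      proof (intro allI impI)
        fix a b assume "(a, b) \<in> parcs G"
        then have "(a, b) \<in> parcs S" "(b, a) \<in> parcs S" using S(2) by auto
        then show "a \<in> X \<longleftrightarrow> b \<in> X"
          unfolding X_def by (auto intro: S.reachable_adj_trans)
      qed
      ultimately have "pverts G \<subseteq> X" using * u by blast
      then show ?thesis using v by (auto simp: X_def)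
    qed
    then show "digraph_connected G" using * conn by blast
  qed
qed

lemma digraph_connectedD:
  assumes "pair_wf_digraph G" "digraph_connected G"
    and "\<And>u v. (u, v) \<in> parcs G \<Longrightarrow> u \<in> X \<longleftrightarrow> v \<in> X" and "w \<in> X" "w \<in> pverts G" "v \<in> pverts G"
  shows "v \<in> X"
  using assms digraph_connected_iff_no_cut[OF assms(1)] by blast

text \<open>The class of \<open>u\<close> under undirected reachability; it makes the maximal
  connected subgraphs explicit, one for each node. The closure is reflexive, so \<open>u\<close>
  belongs to its class even when it is not a node of \<open>G\<close>.\<close>

definition component_at :: "plane_digraph \<Rightarrow> rat \<times> rat \<Rightarrow> plane_digraph" where
  "component_at G u = (let X = (parcs G \<union> (parcs G)\<inverse>)\<^sup>* `` {u} in
     \<lparr>pverts = X, parcs = parcs G \<inter> X \<times> X\<rparr>)"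

lemma
  assumes "pair_wf_digraph G" and u: "u \<in> pverts G"
  shows wf_component_at: "pair_wf_digraph (component_at G u)"
    and subgraph_component_at: "subgraph (with_proj (component_at G u)) (with_proj G)"
    and connected_component_at: "digraph_connected (component_at G u)"
    and closed_component_at:
      "(a, b) \<in> parcs G \<Longrightarrow> a \<in> pverts (component_at G u) \<longleftrightarrow> b \<in> pverts (component_at G u)"
proof -
  interpret pair_wf_digraph G by fact
  define R where "R = parcs G \<union> (parcs G)\<inverse>"
  define C where "C = component_at G u"
  have C: "pverts C = R\<^sup>* `` {u}" "parcs C = parcs G \<inter> pverts C \<times> pverts C"
    by (simp_all add: C_def component_at_def R_def Let_def)
  have closed: "a \<in> pverts C \<longleftrightarrow> b \<in> pverts C" if "(a, b) \<in> parcs G" for a b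
  proof -
    have "(a, b) \<in> R" "(b, a) \<in> R" using that by (auto simp: R_def)
    then show ?thesis unfolding C(1) by (auto intro: rtrancl_into_rtrancl)
  qed
  show "(a, b) \<in> parcs G \<Longrightarrow> a \<in> pverts (component_at G u) \<longleftrightarrow> b \<in> pverts (component_at G u)"
    using closed by (simp add: C_def)
  show wf: "pair_wf_digraph (component_at G u)"
    unfolding C_def[symmetric] by unfold_locales (auto simp: C(2))
  have "(u, v) \<in> R\<^sup>* \<Longrightarrow> v \<in> pverts G" for v
    by (induct rule: rtrancl_induct) (use u in \<open>auto simp: R_def dest: wellformed'\<close>)
  then have sub: "pverts C \<subseteq> pverts G" by (auto simp: C(1))
  show "subgraph (with_proj (component_at G u)) (with_proj G)"
    using wf assms(1) sub C(2) by (intro subgraphI) (auto simp: C_def wf_digraph_wp_iff)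
  have inC: "u \<in> pverts C" by (simp add: C(1))
  show "digraph_connected (component_at G u)"
    unfolding digraph_connected_iff_no_cut[OF wf]
  proof (intro conjI allI impI, goal_cases)
    case 1
    then show ?case using inC by (auto simp: C_def)
  next
    case (2 X)
    have X: "a \<in> X \<longleftrightarrow> b \<in> X" if "(a, b) \<in> R" "a \<in> pverts C" "b \<in> pverts C" for a b
      using 2 that unfolding C_def[symmetric] C(2) R_def by blast
    have "(u, v) \<in> R\<^sup>* \<Longrightarrow> v \<in> X \<longleftrightarrow> u \<in> X" for v
    proof (induct rule: rtrancl_induct)
      case (step y z)
      then have "y \<in> pverts C" "z \<in> pverts C" by (auto simp: C(1) intro: rtrancl_into_rtrancl)
      then show ?case using X step by blast
    qed simp
    moreover have "X \<inter> pverts C \<noteq> {}" using 2 by (simp add: C_def)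
    ultimately show ?case by (fold C_def) (auto simp: C(1))
  qed
qed

text \<open>The class of \<open>u\<close> is closed under arcs, so a connected subgraph through
  \<open>u\<close> stays inside it. Hence each class is maximal, and a maximal connected subgraph is
  the class of any of its nodes.\<close>

lemma components_of_conv_component_at:
  assumes wf: "pair_wf_digraph G"
  shows "components_of G = component_at G ` pverts G"
proof -
  interpret G: pair_wf_digraph G by fact
  have sub_component: "subgraph H (with_proj (component_at G u))"
    if H: "subgraph H (with_proj G)" "Digraph_Component.connected H" "u \<in> verts H" for H u
  proof -
    \<comment> \<open>Compatibility forces tail and head of \<open>H\<close> to be the two
      projections, so \<open>H\<close> comes from a pair digraph and the cut criterion applies to
      it.\<close>
    define H' where "H' = \<lparr>pverts = verts H, parcs = arcs H\<rparr>"
    have comp: "compatible (with_proj G) H" and wfH: "wf_digraph H" using H(1) by auto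
    have HH: "H = with_proj H'"
      using comp by (simp add: H'_def with_proj_def compatible_def)
    have wfH': "pair_wf_digraph H'" using wfH by (simp add: HH wf_digraph_wp_iff)
    interpret H': pair_wf_digraph H' by fact
    have con: "digraph_connected H'" using H(2) by (simp add: HH digraph_connected_def)
    have pv: "pverts H' \<subseteq> pverts G" "parcs H' \<subseteq> parcs G" using H(1) by (simp_all add: HH subgraph_def)
    have u: "u \<in> pverts G" "u \<in> pverts H'" using H(3) pv by (auto simp: H'_def)
    have uC: "u \<in> pverts (component_at G u)" by (simp add: component_at_def Let_def)
    have "v \<in> pverts (component_at G u)" if "v \<in> pverts H'" for v
      using digraph_connectedD[OF wfH' con _ uC u(2) that] closed_component_at[OF wf u(1)] pv(2)
      by blast
    moreover have "parcs (component_at G u) = parcs G \<inter> pverts (component_at G u) \<times> pverts (component_at G u)"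
      by (simp add: component_at_def Let_def)
    ultimately show ?thesis
      using wf_component_at[OF wf u(1)] wfH' pv H'.wellformed' unfolding HH
      by (intro subgraphI) (auto simp: wf_digraph_wp_iff)
  qed
  have anti: "H = K" if "subgraph H K" "subgraph K H" for H K :: "(rat \<times> rat, (rat \<times> rat) \<times> (rat \<times> rat)) pre_digraph"
    using that by (auto simp: subgraph_def compatible_def intro!: pre_digraph.equality)
  have inj: "C = D" if "with_proj C = with_proj D" for C D :: plane_digraph
    using that by (auto simp: with_proj_def intro!: pair_pre_digraph.equality)
  show ?thesis
  proof (intro equalityI subsetI)
    fix C assume "C \<in> components_of G"
    then have C: "subgraph (with_proj C) (with_proj G)" "Digraph_Component.connected (with_proj C)"
      and max: "\<And>H'. H' \<noteq> with_proj C \<Longrightarrow> subgraph (with_proj C) H' \<Longrightarrow>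
        subgraph H' (with_proj G) \<Longrightarrow> \<not> Digraph_Component.connected H'"
      by (auto simp: components_of_def pre_digraph.max_subgraph_def)
    obtain u where u: "u \<in> pverts C"
      using C(2) by (auto simp: connected_def strongly_connected_def)
    then have uG: "u \<in> pverts G" using C(1) by (auto simp: subgraph_def)
    have "with_proj (component_at G u) = with_proj C"
      using max[of "with_proj (component_at G u)"] sub_component[OF C] u
        subgraph_component_at[OF wf uG] connected_component_at[OF wf uG]
      by (auto simp: digraph_connected_def)
    then show "C \<in> component_at G ` pverts G" using inj uG by blast
  next
    fix C assume "C \<in> component_at G ` pverts G"
    then obtain u where u: "u \<in> pverts G" "C = component_at G u" by blast
    have "H' = with_proj C" if "subgraph (with_proj C) H'" "subgraph H' (with_proj G)"
      "Digraph_Component.connected H'" for H'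
    proof -
      have "u \<in> verts H'" using that(1) u
        by (auto simp: subgraph_def component_at_def Let_def)
      then show ?thesis using sub_component[OF that(2,3)] that(1) u anti by blast
    qed
    then show "C \<in> components_of G"
      using subgraph_component_at[OF wf u(1)] connected_component_at[OF wf u(1)]
      unfolding components_of_def pre_digraph.max_subgraph_def u(2) digraph_connected_def by blast
  qed
qed

text \<open>Two connected subgraphs that share \<open>u\<close> and are both closed under the arcs
  of \<open>G\<close> absorb each other; both are induced, so their arcs agree as well.\<close>

lemma component_at_eqI:
  assumes wf: "pair_wf_digraph G" and C: "pverts C \<subseteq> pverts G" "pair_wf_digraph C" "digraph_connected C"
    and arcs: "parcs C = parcs G \<inter> pverts C \<times> pverts C"
    and closed: "\<And>a b. (a, b) \<in> parcs G \<Longrightarrow> a \<in> pverts C \<longleftrightarrow> b \<in> pverts C"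
    and u: "u \<in> pverts C"
  shows "component_at G u = C"
proof -
  have u': "u \<in> pverts G" using u C(1) by blast
  have uC: "u \<in> pverts (component_at G u)" by (simp add: component_at_def Let_def)
  have sub: "parcs (component_at G u) = parcs G \<inter> pverts (component_at G u) \<times> pverts (component_at G u)"
    by (simp add: component_at_def Let_def)
  have "pverts (component_at G u) \<subseteq> pverts C"
    using digraph_connectedD[OF wf_component_at[OF wf u'] connected_component_at[OF wf u'] _ u uC]
      closed sub by blast
  moreover have "pverts C \<subseteq> pverts (component_at G u)"
    using digraph_connectedD[OF C(2,3) _ uC u] closed_component_at[OF wf u'] arcs by blast
  ultimately have "pverts (component_at G u) = pverts C" by blast
  then show ?thesis using sub arcs by (simp add: pair_pre_digraph.equality)
qed

text \<open>\<open>m\<close> and \<open>n\<close> count steps, so there are (m + 1)(n + 1) nodes.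
  They are the weights of the irreducible module of highest weight (m, n) over two commuting copies
  of sl2, measured by half of the neutral elements.\<close>

definition box_graph :: "nat \<Rightarrow> nat \<Rightarrow> plane_digraph" where
  "box_graph m n = (let X = (\<lambda>(i, j). (of_nat i - of_nat m / 2, of_nat j - of_nat n / 2)) ` ({..m} \<times> {..n}) in
     \<lparr>pverts = X, parcs = {(u, v) \<in> X \<times> X. v = u + (1, 0) \<or> v = u + (0, 1)}\<rparr>)"

lemma in_pverts_box_iff:
  "(p, q) \<in> pverts (box_graph m n) \<longleftrightarrow>
     (\<exists>i\<le>m. p = of_nat i - of_nat m / 2) \<and> (\<exists>j\<le>n. q = of_nat j - of_nat n / 2)"
  by (auto simp: box_graph_def Let_def image_iff)

lemma parcs_box:
  "parcs (box_graph m n) =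
     {(u, v). u \<in> pverts (box_graph m n) \<and> v \<in> pverts (box_graph m n) \<and> (v = u + (1, 0) \<or> v = u + (0, 1))}"
  by (auto simp: box_graph_def Let_def)

lemma finite_pverts_box: "finite (pverts (box_graph m n))"
  by (simp add: box_graph_def Let_def)

lemma pair_fin_digraph_box: "pair_fin_digraph (box_graph m n)"
proof
  show "finite (parcs (box_graph m n))"
    by (rule finite_subset[of _ "pverts (box_graph m n) \<times> pverts (box_graph m n)"])
      (auto simp: parcs_box finite_pverts_box)
qed (auto simp: parcs_box finite_pverts_box)

lemma box_corner_in: "(- of_nat m / 2, - of_nat n / 2) \<in> pverts (box_graph m n)"
  by (auto simp: in_pverts_box_iff intro!: exI[of _ 0])

lemma digraph_connected_box: "digraph_connected (box_graph m n)"
proof -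
  interpret pair_fin_digraph "box_graph m n" by (rule pair_fin_digraph_box)
  let ?v = "\<lambda>i j. (of_nat i - of_nat m / 2 :: rat, of_nat j - of_nat n / 2 :: rat)"
  have "pverts (box_graph m n) \<subseteq> X"
    if X: "\<And>u v. (u, v) \<in> parcs (box_graph m n) \<Longrightarrow> u \<in> X \<longleftrightarrow> v \<in> X" "X \<inter> pverts (box_graph m n) \<noteq> {}" for X
  proof -
    have h: "?v i j \<in> X \<longleftrightarrow> ?v 0 j \<in> X" if "i \<le> m" "j \<le> n" for i j
      using that
    proof (induct i)
      case (Suc i)
      have "(?v i j, ?v (Suc i) j) \<in> parcs (box_graph m n)"
        using Suc.prems by (auto simp: parcs_box in_pverts_box_iff intro: Suc_leD)
      then show ?case using Suc X(1) by simp
    qed simp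
    have v: "?v 0 j \<in> X \<longleftrightarrow> ?v 0 0 \<in> X" if "j \<le> n" for j
      using that
    proof (induct j)
      case (Suc j)
      have "(?v 0 j, ?v 0 (Suc j)) \<in> parcs (box_graph m n)"
        using Suc.prems by (auto simp: parcs_box in_pverts_box_iff intro: Suc_leD exI[of _ 0])
      then show ?case using Suc X(1) by (metis Suc_leD)
    qed simp
    obtain p q where "(p, q) \<in> X" "(p, q) \<in> pverts (box_graph m n)" using X(2) by auto
    then have "?v 0 0 \<in> X" using h v by (auto simp: in_pverts_box_iff)
    then show ?thesis using h v by (auto simp: in_pverts_box_iff)
  qed
  then show ?thesis
    unfolding digraph_connected_iff_no_cut[OF pair_wf_digraph_axioms]
    using box_corner_in by blast
qed

lemma uminus_in_pverts_box: "v \<in> pverts (box_graph m n) \<Longrightarrow> - v \<in> pverts (box_graph m n)"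
proof (cases v)
  case (Pair p q)
  assume "v \<in> pverts (box_graph m n)"
  then obtain i j where "i \<le> m" "p = of_nat i - of_nat m / 2" "j \<le> n" "q = of_nat j - of_nat n / 2"
    using Pair by (auto simp: in_pverts_box_iff)
  then show ?thesis unfolding Pair
    by (auto simp: in_pverts_box_iff intro: exI[of _ "m - i"] exI[of _ "n - j"])
qed

lemma connected_skew_graph_box: "connected_skew_graph (box_graph m n)"
proof -
  let ?V = "pverts (box_graph m n)"
  \<comment> \<open>The central symmetry of the box makes the sum of its nodes equal to its own
    negative.\<close>
  have "(\<Sum>v\<in>?V. v) = (\<Sum>v\<in>?V. - v)"
    by (rule sum.reindex_bij_witness[of _ uminus uminus]) (auto intro: uminus_in_pverts_box)
  then have "(\<Sum>v\<in>?V. v) = - (\<Sum>v\<in>?V. v)" by (simp add: sum_negf)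
  then have "(\<Sum>v\<in>?V. v) = 0" by (auto simp: prod_eq_iff)
  moreover have "(p, q + 1) \<in> ?V \<and> (p + 1, q) \<in> ?V" if "(p, q) \<in> ?V" "(p + 1, q + 1) \<in> ?V" for p q
    using that by (auto simp: in_pverts_box_iff)
  ultimately show ?thesis
    unfolding connected_skew_graph_def
    by (auto simp: pair_fin_digraph_box digraph_connected_box parcs_box)
qed

lemma unit_intervals_cover:
  fixes x :: real
  assumes "- (of_nat m + 1) / 2 \<le> x" "x \<le> (of_nat m + 1) / 2"
  shows "\<exists>i\<le>m. \<bar>x - (of_nat i - of_nat m / 2)\<bar> \<le> 1 / 2"
proof -
  define y where "y = x + (of_nat m + 1) / 2"
  have y: "0 \<le> y" "y \<le> of_nat m + 1" using assms by (auto simp: y_def field_simps)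
  show ?thesis
  proof (cases "nat \<lfloor>y\<rfloor> \<le> m")
    case True
    have "real (nat \<lfloor>y\<rfloor>) \<le> y" "y \<le> real (nat \<lfloor>y\<rfloor>) + 1" using y(1) by linarith+
    then show ?thesis using True
      by (intro exI[of _ "nat \<lfloor>y\<rfloor>"]) (auto simp: y_def abs_le_iff field_simps)
  next
    \<comment> \<open>This is the right end point, where the floor exceeds the last index; it
      belongs to the last interval.\<close>
    case False
    then have "y = of_nat m + 1" using y by linarith
    then show ?thesis by (intro exI[of _ m]) (simp add: y_def abs_le_iff field_simps)
  qed
qed

lemma in_skew_diagram_iff:
  "(x, y) \<in> skew_diagram C \<longleftrightarrow> (\<exists>(p, q) \<in> pverts C. \<bar>x - of_rat p\<bar> \<le> 1/2 \<and> \<bar>y - of_rat q\<bar> \<le> 1/2)"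
proof -
  have *: "x \<in> {c - 1/2..c + 1/2} \<longleftrightarrow> \<bar>x - c\<bar> \<le> 1/2" for x c :: real
    unfolding atLeastAtMost_iff by arith
  show ?thesis unfolding skew_diagram_def by (simp only: UN_iff mem_Times_iff * case_prod_unfold fst_conv snd_conv)
qed

lemma rectangular_box: "rectangular (box_graph m n)"
proof -
  have r: "of_rat (of_nat i - of_nat k / 2) = (of_nat i - of_nat k / 2 :: real)" for i k
    by (simp add: of_rat_diff of_rat_divide)
  have bd: "\<bar>x - (of_nat i - of_nat k / 2)\<bar> \<le> 1/2 \<Longrightarrow> i \<le> k \<Longrightarrow>
    - (of_nat k + 1) / 2 \<le> x \<and> x \<le> (of_nat k + 1) / 2" for x :: real and i k :: nat
    by (auto simp: abs_le_iff field_simps)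
  have "(x, y) \<in> skew_diagram (box_graph m n) \<longleftrightarrow>
     (\<exists>i\<le>m. \<bar>x - (of_nat i - of_nat m / 2)\<bar> \<le> 1/2) \<and> (\<exists>j\<le>n. \<bar>y - (of_nat j - of_nat n / 2)\<bar> \<le> 1/2)"
    for x y
    unfolding in_skew_diagram_iff by (force simp: in_pverts_box_iff r[symmetric])
  then have "skew_diagram (box_graph m n) =
      {- (of_nat m + 1) / 2..(of_nat m + 1) / 2} \<times> {- (of_nat n + 1) / 2..(of_nat n + 1) / 2}"
    using unit_intervals_cover bd by (auto simp del: of_nat_add)
  moreover have "- (of_nat k + 1) / 2 < ((of_nat k + 1) / 2 :: real)" for k by simp
  ultimately show ?thesis
    unfolding rectangular_def using connected_skew_graph_box by blast
qed


section \<open>From rectangular diagrams to centred boxes\<close>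

lemma finite_integer_interval_cases:
  fixes A :: "rat set"
  assumes "finite A" "A \<noteq> {}" and int: "\<And>p q. p \<in> A \<Longrightarrow> q \<in> A \<Longrightarrow> q - p \<in> \<int>"
    and conv: "\<And>p q r. p \<in> A \<Longrightarrow> q \<in> A \<Longrightarrow> r - p \<in> \<int> \<Longrightarrow> p \<le> r \<Longrightarrow> r \<le> q \<Longrightarrow> r \<in> A"
  obtains p m where "A = (\<lambda>i. p + of_nat i) ` {..m}"
proof -
  let ?p = "Min A" let ?q = "Max A"
  have pq: "?p \<in> A" "?q \<in> A" using assms(1,2) by simp_all
  have nat: "\<exists>i::nat. r = ?p + of_nat i" if "?p \<le> r" "r - ?p \<in> \<int>" for r
  proof -
    from that(2) obtain z where z: "r - ?p = of_int z" by (auto elim: Ints_cases)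
    then have "0 \<le> z" using that(1) by (metis diff_ge_0_iff_ge of_int_0_le_iff)
    then show ?thesis using z by (intro exI[of _ "nat z"]) (simp add: algebra_simps)
  qed
  obtain m :: nat where m: "?q = ?p + of_nat m" using nat[of ?q] pq int assms(1) by auto
  have "A = (\<lambda>i. ?p + of_nat i) ` {..m}"
  proof (intro equalityI subsetI)
    fix r assume r: "r \<in> A"
    then obtain i :: nat where i: "r = ?p + of_nat i" using nat[of r] pq int assms(1) by auto
    moreover have "r \<le> ?q" using r assms(1) by simp
    ultimately have "i \<le> m" using m by simp
    then show "r \<in> (\<lambda>i. ?p + of_nat i) ` {..m}" using i by blast
  next
    fix r assume "r \<in> (\<lambda>i. ?p + of_nat i) ` {..m}"
    then obtain i where "i \<le> m" "r = ?p + of_nat i" by blast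
    then show "r \<in> A" using conv[OF pq, of r] m by simp
  qed
  then show thesis by (rule that)
qed

text \<open>The sum is m + 1 times the mean p + m/2, so the barycentre condition fixes the first
  term.\<close>

lemma sum_arith_progression_eq_0:
  fixes p :: rat
  assumes "(\<Sum>i\<le>m. p + of_nat i) = 0"
  shows "p = - of_nat m / 2"
proof -
  have "2 * (\<Sum>i\<le>m. p + of_nat i) = of_nat (m + 1) * (2 * p + of_nat m)"
    by (induct m) (simp_all add: algebra_simps)
  then have "2 * p + of_nat m = 0" using assms of_nat_neq_0[of m, where 'a = rat] by auto
  then show ?thesis by simp
qed

text \<open>Connectivity puts all nodes into one coset of the integer lattice. Within a coset a unit
  square contains the centre of another one only if the two coincide, so the nodes are exactly the
  coset points inside the rectangle, and these form a product of two sets.\<close>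

lemma rectangular_imp_product:
  assumes "rectangular C"
  obtains A B where "pverts C = A \<times> B" "finite A" "finite B" "A \<noteq> {}" "B \<noteq> {}"
    "\<And>p q. p \<in> A \<Longrightarrow> q \<in> A \<Longrightarrow> q - p \<in> \<int>"
    "\<And>p q. p \<in> B \<Longrightarrow> q \<in> B \<Longrightarrow> q - p \<in> \<int>"
    "\<And>p q r. p \<in> A \<Longrightarrow> q \<in> A \<Longrightarrow> r - p \<in> \<int> \<Longrightarrow> p \<le> r \<Longrightarrow> r \<le> q \<Longrightarrow> r \<in> A"
    "\<And>p q r. p \<in> B \<Longrightarrow> q \<in> B \<Longrightarrow> r - p \<in> \<int> \<Longrightarrow> p \<le> r \<Longrightarrow> r \<le> q \<Longrightarrow> r \<in> B"
proof -
  from assms have C: "connected_skew_graph C" by (simp add: rectangular_def)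
  interpret pair_fin_digraph C using C by (simp add: connected_skew_graph_def)
  have con: "digraph_connected C" using C by (simp add: connected_skew_graph_def)
  from assms obtain a b c d where diag: "skew_diagram C = {a..b} \<times> {c..d}"
    by (auto simp: rectangular_def)
  have "pverts C \<noteq> {}" using con digraph_connected_iff_no_cut[OF pair_wf_digraph_axioms] by blast
  then obtain p0 q0 where u0: "(p0, q0) \<in> pverts C" by auto
  have lattice: "p - p0 \<in> \<int> \<and> q - q0 \<in> \<int>" if "(p, q) \<in> pverts C" for p q
  proof -
    have "u \<in> {(p, q). p - p0 \<in> \<int> \<and> q - q0 \<in> \<int>} \<longleftrightarrow> v \<in> {(p, q). p - p0 \<in> \<int> \<and> q - q0 \<in> \<int>}"
      if "(u, v) \<in> parcs C" for u v
    proof -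
      have *: "x + 1 - y \<in> \<int> \<longleftrightarrow> x - y \<in> \<int>" for x y :: rat
        by (metis Ints_1 Ints_add Ints_diff add_diff_cancel_right' diff_add_eq)
      have "v = u + (1, 0) \<or> v = u + (0, 1)"
        using that C by (auto simp: connected_skew_graph_def)
      then show ?thesis by (cases u) (auto simp: *)
    qed
    from digraph_connectedD[OF pair_wf_digraph_axioms con this _ u0 that] show ?thesis by simp
  qed
  have near: "x = y" if "x - z \<in> \<int>" "y - z \<in> \<int>" "\<bar>of_rat x - of_rat y :: real\<bar> \<le> 1/2" for x y z :: rat
  proof -
    have "x - y \<in> \<int>" using Ints_diff[OF that(1,2)] by simp
    then obtain k where k: "x - y = of_int k" by (auto elim: Ints_cases)
    then have "of_rat x - of_rat y = (of_int k :: real)" by (simp flip: of_rat_diff)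
    then have "k = 0" using that(3) by linarith
    then show ?thesis using k by simp
  qed
  have char: "(p, q) \<in> pverts C \<longleftrightarrow> p - p0 \<in> \<int> \<and> q - q0 \<in> \<int> \<and>
      a \<le> of_rat p \<and> of_rat p \<le> b \<and> c \<le> of_rat q \<and> of_rat q \<le> d" for p q
  proof
    assume *: "(p, q) \<in> pverts C"
    then have "(of_rat p, of_rat q) \<in> skew_diagram C" unfolding in_skew_diagram_iff by force
    then show "p - p0 \<in> \<int> \<and> q - q0 \<in> \<int> \<and> a \<le> of_rat p \<and> of_rat p \<le> b \<and> c \<le> of_rat q \<and> of_rat q \<le> d"
      using lattice[OF *] unfolding diag by simp
  next
    assume *: "p - p0 \<in> \<int> \<and> q - q0 \<in> \<int> \<and> a \<le> of_rat p \<and> of_rat p \<le> b \<and> c \<le> of_rat q \<and> of_rat q \<le> d"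
    then have "(of_rat p, of_rat q) \<in> skew_diagram C" unfolding diag by simp
    then obtain p' q' where pq: "(p', q') \<in> pverts C"
      "\<bar>of_rat p - of_rat p' :: real\<bar> \<le> 1/2" "\<bar>of_rat q - of_rat q' :: real\<bar> \<le> 1/2"
      unfolding in_skew_diagram_iff by blast
    then have "p = p'" "q = q'" using near lattice[OF pq(1)] * by blast+
    then show "(p, q) \<in> pverts C" using pq by simp
  qed
  define A where "A = {p. p - p0 \<in> \<int> \<and> a \<le> of_rat p \<and> of_rat p \<le> b}"
  define B where "B = {q. q - q0 \<in> \<int> \<and> c \<le> of_rat q \<and> of_rat q \<le> d}"
  have AB: "pverts C = A \<times> B" using char by (auto simp: A_def B_def)
  have ne: "A \<noteq> {}" "B \<noteq> {}" using u0 AB by auto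
  have fin: "finite A" "finite B"
    using pair_finite_verts ne unfolding AB by (auto simp: finite_cartesian_product_iff)
  have int: "q - p \<in> \<int>" if "p - z \<in> \<int>" "q - z \<in> \<int>" for p q z :: rat
    using Ints_diff[OF that(2,1)] by simp
  have int': "q - z \<in> \<int>" if "p - z \<in> \<int>" "q - p \<in> \<int>" for p q z :: rat
    using Ints_add[OF that] by simp
  have mono: "x \<le> of_rat r \<and> of_rat r \<le> y" if "p \<le> r" "r \<le> q" "x \<le> of_rat p" "of_rat q \<le> y"
    for p q r :: rat and x y :: real
    using that by (meson of_rat_less_eq order_trans)
  show thesis
  proof (rule that[OF AB fin ne], goal_cases)
    case 3
    then show ?case using mono int' unfolding A_def by blast
  next
    case 4
    then show ?case using mono int' unfolding B_def by blast
  qed (use int in \<open>auto simp: A_def B_def\<close>)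
qed

lemma rectangular_imp_box:
  assumes "rectangular C"
  shows "\<exists>m n. C = box_graph m n"
proof -
  from assms have C: "connected_skew_graph C" by (simp add: rectangular_def)
  interpret pair_fin_digraph C using C by (simp add: connected_skew_graph_def)
  have con: "digraph_connected C" using C by (simp add: connected_skew_graph_def)
  obtain A B where AB: "pverts C = A \<times> B"
    and fin: "finite A" "finite B" "A \<noteq> {}" "B \<noteq> {}"
    and ints: "\<And>p q. p \<in> A \<Longrightarrow> q \<in> A \<Longrightarrow> q - p \<in> \<int>" "\<And>p q. p \<in> B \<Longrightarrow> q \<in> B \<Longrightarrow> q - p \<in> \<int>"
    and conv: "\<And>p q r. p \<in> A \<Longrightarrow> q \<in> A \<Longrightarrow> r - p \<in> \<int> \<Longrightarrow> p \<le> r \<Longrightarrow> r \<le> q \<Longrightarrow> r \<in> A"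
    "\<And>p q r. p \<in> B \<Longrightarrow> q \<in> B \<Longrightarrow> r - p \<in> \<int> \<Longrightarrow> p \<le> r \<Longrightarrow> r \<le> q \<Longrightarrow> r \<in> B"
    by (rule rectangular_imp_product[OF assms]) (rule that)
  obtain p m where A: "A = (\<lambda>i. p + of_nat i) ` {..m}"
    by (rule finite_integer_interval_cases[OF fin(1,3)]) (use ints(1) conv(1) in blast)+
  obtain q n where B: "B = (\<lambda>i. q + of_nat i) ` {..n}"
    by (rule finite_integer_interval_cases[OF fin(2,4)]) (use ints(2) conv(2) in blast)+
  have "(\<Sum>v\<in>A \<times> B. v) = 0" using C by (simp add: connected_skew_graph_def AB)
  then have "(\<Sum>x\<in>A. \<Sum>y\<in>B. (x, y)) = (0, 0)" by (simp add: sum.cartesian_product zero_prod_def)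
  \<comment> \<open>Each coordinate of the vanishing node sum is a multiple of the sum over one
    factor.\<close>
  then have "of_nat (card B) * (\<Sum>x\<in>A. x) = 0" "of_nat (card A) * (\<Sum>y\<in>B. y) = 0"
    by (simp_all add: sum_prod sum_distrib_left)
  then have "(\<Sum>x\<in>A. x) = 0" "(\<Sum>y\<in>B. y) = 0" using fin by auto
  then have sums: "(\<Sum>i\<le>m. p + of_nat i) = 0" "(\<Sum>i\<le>n. q + of_nat i) = 0"
    unfolding A B by (auto simp: sum.reindex inj_on_def)
  have pq: "p = - of_nat m / 2" "q = - of_nat n / 2"
    using sums[THEN sum_arith_progression_eq_0] .
  have A': "A = (\<lambda>i. of_nat i - of_nat m / 2) ` {..m}" and B': "B = (\<lambda>i. of_nat i - of_nat n / 2) ` {..n}"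
    unfolding A B pq by (auto intro!: image_cong)
  have verts: "pverts C = pverts (box_graph m n)"
  proof (rule set_eqI)
    fix v
    show "v \<in> pverts C \<longleftrightarrow> v \<in> pverts (box_graph m n)"
      unfolding AB A' B' by (cases v) (auto simp only: mem_Times_iff fst_conv snd_conv in_pverts_box_iff image_iff)
  qed
  have square: "((i, j), (i + 1, j)) \<in> parcs C \<and> ((i, j), (i, j + 1)) \<in> parcs C \<and>
      ((i + 1, j), (i + 1, j + 1)) \<in> parcs C \<and> ((i, j + 1), (i + 1, j + 1)) \<in> parcs C"
    if "(i, j) \<in> pverts C" "(i + 1, j + 1) \<in> pverts C" for i j
  proof -
    have "\<forall>i j. (i, j) \<in> pverts C \<and> (i + 1, j + 1) \<in> pverts C \<longrightarrow>
      {(i, j + 1), (i + 1, j)} \<subseteq> pverts C \<and>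
      {((i, j), (i + 1, j)), ((i, j), (i, j + 1)),
       ((i + 1, j), (i + 1, j + 1)), ((i, j + 1), (i + 1, j + 1))} \<subseteq> parcs C"
      using C unfolding connected_skew_graph_def by blast
    then show ?thesis using that by blast
  qed
  have step: "v = u + (1, 0) \<or> v = u + (0, 1)" if "(u, v) \<in> parcs C" for u v
    using C that unfolding connected_skew_graph_def by blast
  \<comment> \<open>The square condition supplies the arrow as soon as there is a neighbouring row.
    In a single row a missing arrow would make the half-plane up to \<open>i\<close> closed under
    all arrows, against connectivity.\<close>
  have arc1: "((i, j), (i + 1, j)) \<in> parcs C" if ij: "i \<in> A" "i + 1 \<in> A" "j \<in> B" for i j
  proof (rule ccontr)
    assume no: "((i, j), (i + 1, j)) \<notin> parcs C"
    have nb: "j + 1 \<notin> B" "j - 1 \<notin> B"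
      using square[of i j] square[of i "j - 1"] no ij AB by auto
    have B1: "k = j" if k: "k \<in> B" for k
    proof -
      obtain z where z: "k - j = of_int z" using ints(2)[OF ij(3) k] by (auto elim: Ints_cases)
      have "j - k - 1 \<in> \<int>" using ints(2)[OF k ij(3)] by (rule Ints_diff) simp
      then have "j - 1 - k \<in> \<int>" by (simp add: diff_diff_eq add.commute)
      then have "\<not> k \<le> j - 1" using conv(2)[OF k ij(3), of "j - 1"] nb(2) by linarith
      moreover have "\<not> k \<ge> j + 1" using conv(2)[OF ij(3) k, of "j + 1"] nb(1) by fastforce
      ultimately have "z < 1" "-1 < z" using z by linarith+
      then show ?thesis using z by simp
    qed
    have "u \<in> {(a, b). a \<le> i} \<longleftrightarrow> v \<in> {(a, b). a \<le> i}" if uv: "(u, v) \<in> parcs C" for u v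
    proof (cases u)
      case (Pair a b)
      then have ab: "a \<in> A" "b \<in> B" using in_arcsD1[OF uv] AB by auto
      obtain z where z: "a - i = of_int z" using ints(1)[OF ij(1) ab(1)] by (auto elim: Ints_cases)
      have "\<not> (a \<le> i \<and> i < a + 1)" if "v = u + (1, 0)"
      proof
        assume "a \<le> i \<and> i < a + 1"
        then have "z \<le> 0" "-1 < z" using z by linarith+
        then have "a = i" "b = j" using z B1 ab by auto
        then show False using no uv Pair that by auto
      qed
      then show ?thesis using step[OF uv] Pair by auto
    qed
    from digraph_connectedD[OF pair_wf_digraph_axioms con this, where w = "(i, j)" and v = "(i + 1, j)"]
    show False using ij AB by auto
  qed
  have arc2: "((i, j), (i, j + 1)) \<in> parcs C" if ij: "j \<in> B" "j + 1 \<in> B" "i \<in> A" for i j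
  proof (rule ccontr)
    assume no: "((i, j), (i, j + 1)) \<notin> parcs C"
    have nb: "i + 1 \<notin> A" "i - 1 \<notin> A"
      using square[of i j] square[of "i - 1" j] no ij AB by auto
    have A1: "k = i" if k: "k \<in> A" for k
    proof -
      obtain z where z: "k - i = of_int z" using ints(1)[OF ij(3) k] by (auto elim: Ints_cases)
      have "i - k - 1 \<in> \<int>" using ints(1)[OF k ij(3)] by (rule Ints_diff) simp
      then have "i - 1 - k \<in> \<int>" by (simp add: diff_diff_eq add.commute)
      then have "\<not> k \<le> i - 1" using conv(1)[OF k ij(3), of "i - 1"] nb(2) by linarith
      moreover have "\<not> k \<ge> i + 1" using conv(1)[OF ij(3) k, of "i + 1"] nb(1) by fastforce
      ultimately have "z < 1" "-1 < z" using z by linarith+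
      then show ?thesis using z by simp
    qed
    have "u \<in> {(a, b). b \<le> j} \<longleftrightarrow> v \<in> {(a, b). b \<le> j}" if uv: "(u, v) \<in> parcs C" for u v
    proof (cases u)
      case (Pair a b)
      then have ab: "a \<in> A" "b \<in> B" using in_arcsD1[OF uv] AB by auto
      obtain z where z: "b - j = of_int z" using ints(2)[OF ij(1) ab(2)] by (auto elim: Ints_cases)
      have "\<not> (b \<le> j \<and> j < b + 1)" if "v = u + (0, 1)"
      proof
        assume "b \<le> j \<and> j < b + 1"
        then have "z \<le> 0" "-1 < z" using z by linarith+
        then have "a = i" "b = j" using z A1 ab by auto
        then show False using no uv Pair that by auto
      qed
      then show ?thesis using step[OF uv] Pair by auto
    qed
    from digraph_connectedD[OF pair_wf_digraph_axioms con this, where w = "(i, j)" and v = "(i, j + 1)"]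
    show False using ij AB by auto
  qed
  have "parcs C = parcs (box_graph m n)"
  proof (intro equalityI subsetI)
    fix a assume "a \<in> parcs C"
    then show "a \<in> parcs (box_graph m n)"
      using step wellformed' unfolding parcs_box verts[symmetric] by (cases a) blast
  next
    fix a assume "a \<in> parcs (box_graph m n)"
    then show "a \<in> parcs C"
      unfolding parcs_box verts[symmetric] AB using arc1 arc2 by auto
  qed
  then have "C = box_graph m n" using verts by simp
  then show ?thesis by blast
qed

lemma rectangular_iff_box: "rectangular C \<longleftrightarrow> (\<exists>m n. C = box_graph m n)"
  using rectangular_imp_box rectangular_box by blast

section \<open>Matrices acting on vectors\<close>

lemma mscale_mult_vec: "mscale c X *v v = c *s (X *v v)"
  by (simp add: mscale_def matrix_vector_mult_def vec_eq_iff sum_distrib_left mult.assoc)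

lemma bracket_mult_vec: "bracket X Y *v v = X *v (Y *v v) - Y *v (X *v v)"
  by (simp add: bracket_def matrix_vector_mult_diff_rdistrib matrix_vector_mul_assoc)

lemma sum_mult_vec: "(\<Sum>i\<in>I. X i) *v v = (\<Sum>i\<in>I. X i *v (v :: 'k::field^'n))"
  by (induct I rule: infinite_finite_induct) (simp_all add: matrix_vector_mult_add_rdistrib)

lemma mult_vec_sum: "X *v (\<Sum>i\<in>I. v i) = (\<Sum>i\<in>I. X *v (v i :: 'k::field^'n))"
  by (induct I rule: infinite_finite_induct) (simp_all add: matrix_vector_right_distrib)

lemma mult_vec_minus: "X *v (- v) = - (X *v (v :: 'k::field^'n))"
  by (simp add: vec.neg)

lemma minus_mult_vec: "(- X) *v v = - (X *v v)" for X :: "'k::field^'n^'m"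
  by (simp add: matrix_vector_mult_def vec_eq_iff sum_negf)

lemmas mult_vec_simps = mscale_mult_vec bracket_mult_vec sum_mult_vec mult_vec_sum mult_vec_minus minus_mult_vec
  matrix_vector_mult_add_rdistrib matrix_vector_mult_diff_rdistrib
  matrix_vector_right_distrib matrix_vector_mult_diff_distrib vector_scalar_commute
  matrix_vector_mul_assoc[symmetric] vec.scale_right_distrib vec.scale_right_diff_distrib

lemma subspace_preimage: "vec.subspace W \<Longrightarrow> vec.subspace {v. X *v v \<in> W}" for W :: "('k::field^'n) set"
  by (auto simp: vec.subspace_def mult_vec_simps)

lemma subspace_agree: "vec.subspace {v. X *v v = Y *v (v :: 'k::field^'n)}"
  by (auto simp: vec.subspace_def mult_vec_simps)

lemma matrix_eq_on_spanning:
  fixes X Y :: "'k::field^'n^'m"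
  assumes "vec.span B = UNIV" "\<And>v. v \<in> B \<Longrightarrow> X *v v = Y *v v"
  shows "X = Y"
proof -
  have "vec.span B \<subseteq> {v. X *v v = Y *v v}"
    using assms(2) by (intro vec.span_minimal subspace_agree) auto
  then show ?thesis using assms(1) by (auto simp: matrix_eq)
qed

lemma scaled_eq_imp_zero: "a *s v = b *s v \<Longrightarrow> a \<noteq> b \<Longrightarrow> v = (0 :: 'k::field^'n)"
  using vec.scale_right_imp_eq vec.scale_cancel_right by blast

text \<open>A basis of homogeneous vectors exists because the \<open>V i\<close> span, and the
  projections are defined on it. That \<open>P j\<close> vanishes on all of \<open>V i\<close>, not
  just on basis vectors, follows because it commutes with an operator \<open>T\<close> acting on
  \<open>V i\<close> and \<open>V j\<close> by different scalars.\<close>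

lemma projections_exist:
  fixes V :: "'i \<Rightarrow> ('k::field^'n) set"
  assumes sub: "\<And>i. vec.subspace (V i)" and span: "vec.span (\<Union>i. V i) = UNIV"
    and sep: "\<And>i j. i \<noteq> j \<Longrightarrow> \<exists>(T :: 'k^'n^'n) c. c i \<noteq> c j \<and> (\<forall>k. \<forall>v\<in>V k. T *v v = c k *s v)"
  obtains P :: "'i \<Rightarrow> 'k^'n^'n" and S where "finite S" "\<And>v. (\<Sum>i\<in>S. P i *v v) = v"
    "\<And>i v. P i *v v \<in> V i" "\<And>i v. v \<in> V i \<Longrightarrow> P i *v v = v"
    "\<And>i j v. v \<in> V i \<Longrightarrow> i \<noteq> j \<Longrightarrow> P j *v v = 0"
proof -
  obtain B where B: "B \<subseteq> (\<Union>i. V i)" "vec.independent B" "(\<Union>i. V i) \<subseteq> vec.span B"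
    by (rule vec.maximal_independent_subset)
  have spanB: "vec.span B = UNIV"
    using B(3) span vec.span_minimal[OF B(3) vec.subspace_span] by blast
  have fin: "finite B" using B(2) by (rule vec.finiteI_independent)
  define deg where "deg b = (SOME i. b \<in> V i)" for b
  have deg: "b \<in> V (deg b)" if b: "b \<in> B" for b
  proof -
    obtain i where "b \<in> V i" using b B(1) by blast
    then show ?thesis unfolding deg_def by (rule someI)
  qed
  have "\<exists>g. Vector_Spaces.linear (*s) (*s) g \<and> (\<forall>b\<in>B. g b = (if deg b = i then b else 0))" for i
    by (rule vec.linear_independent_extend[OF B(2)])
  then obtain g where g: "\<And>i. Vector_Spaces.linear (*s) (*s) (g i)"
    "\<And>i b. b \<in> B \<Longrightarrow> g i b = (if deg b = i then b else 0)" by metis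
  define P where "P i = matrix (g i)" for i
  have PB: "P i *v b = (if deg b = i then b else 0)" if "b \<in> B" for i b
    using g that by (simp add: P_def matrix_works)
  have ind: "v \<in> W" if W: "vec.subspace W" "B \<subseteq> W" for v W
    using vec.span_minimal[OF W(2,1)] spanB by blast
  have PV: "P i *v v \<in> V i" for i v
  proof -
    have "v \<in> {v. P i *v v \<in> V i}"
    proof (rule ind[OF subspace_preimage[OF sub]])
      show "B \<subseteq> {v. P i *v v \<in> V i}" using PB deg vec.subspace_0[OF sub] by auto
    qed
    then show ?thesis by simp
  qed
  have "(\<Sum>i\<in>deg ` B. P i) = mat 1"
  proof (rule matrix_eq_on_spanning[OF spanB])
    fix b assume "b \<in> B"
    then show "(\<Sum>i\<in>deg ` B. P i) *v b = mat 1 *v b"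
      using fin by (simp add: mult_vec_simps PB)
  qed
  then have sum: "(\<Sum>i\<in>deg ` B. P i *v v) = v" for v
    by (metis matrix_vector_mul_lid sum_mult_vec)
  have other: "P j *v v = 0" if v: "v \<in> V i" and ij: "i \<noteq> j" for i j v
  proof -
    obtain T :: "'k^'n^'n" and c where T: "c i \<noteq> c j" "\<And>k v. v \<in> V k \<Longrightarrow> T *v v = c k *s v"
      using sep[OF ij] by blast
    have "P j ** T = T ** P j"
    proof (rule matrix_eq_on_spanning[OF spanB])
      fix b assume "b \<in> B"
      then show "(P j ** T) *v b = (T ** P j) *v b"
        using T(2)[OF deg] by (simp add: mult_vec_simps PB)
    qed
    then have "P j *v (T *v v) = T *v (P j *v v)" by (metis matrix_vector_mul_assoc)
    then have "c i *s (P j *v v) = c j *s (P j *v v)"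
      using T(2) v PV by (simp add: mult_vec_simps)
    then show ?thesis using T(1) by (rule scaled_eq_imp_zero)
  qed
  have same: "P i *v v = v" if "v \<in> V i" for i v
  proof (cases "i \<in> deg ` B")
    case True
    have "v = (\<Sum>j\<in>deg ` B. P j *v v)" by (simp only: sum)
    also have "\<dots> = (\<Sum>j\<in>deg ` B. if j = i then P j *v v else 0)"
      using other[OF that] by (intro sum.cong) auto
    finally show ?thesis using True fin by simp
  next
    case False
    have "v = (\<Sum>j\<in>deg ` B. P j *v v)" by (simp only: sum)
    also have "\<dots> = 0" using other[OF that] False by (intro sum.neutral) auto
    finally show ?thesis by simp
  qed
  show thesis by (rule that[OF finite_imageI[OF fin] sum PV same other])
qed

section \<open>The bigrading defined by an associated semisimple pair\<close>

lemma eigenspace_iff: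
  "v \<in> eigenspace h1 h2 (p, q) \<longleftrightarrow> h1 *v v = of_rat p *s v \<and> h2 *v v = of_rat q *s v"
  by (simp add: eigenspace_def)

lemma subspace_eigenspace: "vec.subspace (eigenspace h1 h2 u)"
  by (cases u) (auto simp: vec.subspace_def eigenspace_iff mult_vec_simps vec.scale_left_commute)

lemma eigenspace_swap: "eigenspace h2 h1 (q, p) = eigenspace h1 h2 (p, q)"
  by (auto simp: eigenspace_def)

text \<open>Projections are recorded instead of a direct sum because homogeneous components of
  matrices are composed from them. \<open>S\<close> is a finite set containing all weights; it may
  contain further points, where the projection is 0.\<close>

locale bigraded =
  fixes h1 h2 :: "'k::field_char_0^'n^'n" and P :: "rat \<times> rat \<Rightarrow> 'k^'n^'n" and S :: "(rat \<times> rat) set"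
  assumes finite_S: "finite S"
    and sum_P: "(\<Sum>u\<in>S. P u *v v) = v"
    and P_in: "P u *v v \<in> eigenspace h1 h2 u"
    and P_same: "v \<in> eigenspace h1 h2 u \<Longrightarrow> P u *v v = v"
    and P_other: "v \<in> eigenspace h1 h2 u \<Longrightarrow> u \<noteq> u' \<Longrightarrow> P u' *v v = 0"

lemma eigenvectors_span:
  assumes "semisimple_elt h" "rational_eigenvalues h"
  shows "vec.span (\<Union>q. {v. h *v v = of_rat q *s v}) = UNIV"
proof -
  have "{v. \<exists>c. h *v v = c *s v} \<subseteq> (\<Union>q. {v. h *v v = of_rat q *s v})"
  proof
    fix v assume "v \<in> {v. \<exists>c. h *v v = c *s v}"
    then obtain c where c: "h *v v = c *s v" by blast
    show "v \<in> (\<Union>q. {v. h *v v = of_rat q *s v})"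
    proof (cases "v = 0")
      case False
      then have "c \<in> \<rat>" using assms(2) c by (auto simp: rational_eigenvalues_def)
      then show ?thesis using c by (auto elim!: Rats_cases)
    qed (simp add: mult_vec_simps)
  qed
  from vec.span_mono[OF this] show ?thesis using assms(1) by (auto simp: semisimple_elt_def)
qed

text \<open>Since \<open>h1\<close> preserves the eigenspaces of \<open>h2\<close>, it commutes with
  the projections \<open>Q\<close> onto them; applying these to an eigenvector of \<open>h1\<close>
  splits it into joint eigenvectors.\<close>

lemma bigraded_exists:
  fixes h1 h2 :: "'k::field_char_0^'n^'n"
  assumes h1: "semisimple_elt h1" "rational_eigenvalues h1"
    and h2: "semisimple_elt h2" "rational_eigenvalues h2" and comm: "bracket h1 h2 = 0"
  shows "\<exists>P S. bigraded h1 h2 P S"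
proof -
  let ?V = "\<lambda>q. {v. h2 *v v = of_rat q *s v}"
  have sub2: "vec.subspace (?V q)" for q
    by (auto simp: vec.subspace_def mult_vec_simps vec.scale_left_commute)
  have sep2: "\<exists>(T :: 'k^'n^'n) c. c i \<noteq> c j \<and> (\<forall>k. \<forall>v\<in>?V k. T *v v = c k *s v)" if "i \<noteq> j" for i j
    using that by (intro exI[of _ h2] exI[of _ of_rat]) auto
  obtain Q F where "finite F" and sumQ: "\<And>v. (\<Sum>q\<in>F. Q q *v v) = v"
    and Q: "\<And>q v. Q q *v v \<in> ?V q" "\<And>q v. v \<in> ?V q \<Longrightarrow> Q q *v v = v"
      "\<And>q r v. v \<in> ?V q \<Longrightarrow> q \<noteq> r \<Longrightarrow> Q r *v v = 0"
    by (rule projections_exist[OF sub2 eigenvectors_span[OF h2] sep2]) (assumption, rule that)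
  have c: "h1 *v (h2 *v v) = h2 *v (h1 *v v)" for v
    using comm bracket_mult_vec[of h1 h2 v] by simp
  have "Q q ** h1 = h1 ** Q q" for q
  proof (rule matrix_eq_on_spanning[OF eigenvectors_span[OF h2]])
    fix v assume "v \<in> (\<Union>q. ?V q)"
    then obtain r where v: "v \<in> ?V r" by blast
    then have "h1 *v v \<in> ?V r" by (simp add: c[symmetric] mult_vec_simps)
    then show "(Q q ** h1) *v v = (h1 ** Q q) *v v"
      using v Q(2,3)[of _ r] by (cases "r = q") (simp_all add: mult_vec_simps)
  qed
  then have Qh1: "Q q *v (h1 *v v) = h1 *v (Q q *v v)" for q v
    by (metis matrix_vector_mul_assoc)
  let ?E = "eigenspace h1 h2"
  have "(\<Union>p. {v. h1 *v v = of_rat p *s v}) \<subseteq> vec.span (\<Union>u. ?E u)"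
  proof
    fix v assume "v \<in> (\<Union>p. {v. h1 *v v = of_rat p *s v})"
    then obtain p where p: "h1 *v v = of_rat p *s v" by blast
    have "h1 *v (Q q *v v) = of_rat p *s (Q q *v v)" for q
      by (simp add: Qh1[symmetric] p mult_vec_simps)
    then have "Q q *v v \<in> ?E (p, q)" for q using Q(1)[of q v] by (simp add: eigenspace_iff)
    then have "(\<Sum>q\<in>F. Q q *v v) \<in> vec.span (\<Union>u. ?E u)"
      by (intro vec.span_sum vec.span_base) blast
    then show "v \<in> vec.span (\<Union>u. ?E u)" by (simp only: sumQ)
  qed
  then have span: "vec.span (\<Union>u. ?E u) = UNIV"
    using vec.span_minimal[OF _ vec.subspace_span] eigenvectors_span[OF h1] by blast
  have sep: "\<exists>(T :: 'k^'n^'n) c. c u \<noteq> c u' \<and> (\<forall>k. \<forall>v\<in>?E k. T *v v = c k *s v)" if "u \<noteq> u'" for u u'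
  proof (cases "fst u = fst u'")
    case True
    then show ?thesis using that
      by (intro exI[of _ h2] exI[of _ "\<lambda>u. of_rat (snd u)"]) (auto simp: prod_eq_iff eigenspace_iff)
  next
    case False
    then show ?thesis using that
      by (intro exI[of _ h1] exI[of _ "\<lambda>u. of_rat (fst u)"]) (auto simp: prod_eq_iff eigenspace_iff)
  qed
  obtain P S where "finite S" "\<And>v. (\<Sum>u\<in>S. P u *v v) = v" "\<And>u v. P u *v v \<in> ?E u"
    "\<And>u v. v \<in> ?E u \<Longrightarrow> P u *v v = v" "\<And>u u' v. v \<in> ?E u \<Longrightarrow> u \<noteq> u' \<Longrightarrow> P u' *v v = 0"
    by (rule projections_exist[OF subspace_eigenspace span sep]) (assumption, rule that)
  then have "bigraded h1 h2 P S" by unfold_locales auto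
  then show ?thesis by blast
qed

context bigraded
begin

abbreviation E where "E \<equiv> eigenspace h1 h2"

lemma E_decomp: "(\<And>u. u \<in> S \<Longrightarrow> P u *v v \<in> W) \<Longrightarrow> vec.subspace W \<Longrightarrow> v \<in> W"
  by (metis sum_P vec.subspace_sum)

lemma E_zero: "u \<notin> S \<Longrightarrow> v \<in> E u \<Longrightarrow> v = 0"
  using sum_P[of v] P_other[of v u] by (metis (no_types, lifting) sum.neutral)

lemma matrix_eqI: "X = Y" if "\<And>u v. v \<in> E u \<Longrightarrow> X *v v = Y *v (v :: 'k^'n)"
proof -
  have "v \<in> {v. X *v v = Y *v v}" for v
    using that[OF P_in] by (intro E_decomp[of v]) (auto intro: subspace_agree)
  then show ?thesis by (simp add: matrix_eq)
qed

section \<open>Bidegrees of matrices and homogeneous components\<close>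

definition has_degree :: "rat \<times> rat \<Rightarrow> 'k^'n^'n \<Rightarrow> bool" where
  "has_degree d X \<longleftrightarrow> (\<forall>u. \<forall>v\<in>E u. X *v v \<in> E (u + d))"

lemma has_degree_iff:
  "has_degree d X \<longleftrightarrow>
     bracket h1 X = mscale (of_rat (fst d)) X \<and> bracket h2 X = mscale (of_rat (snd d)) X"
proof
  assume *: "has_degree d X"
  show "bracket h1 X = mscale (of_rat (fst d)) X \<and> bracket h2 X = mscale (of_rat (snd d)) X"
  proof (intro conjI matrix_eqI)
    fix u v assume v: "v \<in> E u"
    then have "X *v v \<in> E (u + d)" using * unfolding has_degree_def by blast
    then show "bracket h1 X *v v = mscale (of_rat (fst d)) X *v v"
      "bracket h2 X *v v = mscale (of_rat (snd d)) X *v v"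
      using v by (cases u; cases d; simp add: eigenspace_iff mult_vec_simps of_rat_add vec.scale_left_distrib)+
  qed
next
  assume "bracket h1 X = mscale (of_rat (fst d)) X \<and> bracket h2 X = mscale (of_rat (snd d)) X"
  then have "h1 *v (X *v v) = X *v (h1 *v v) + of_rat (fst d) *s (X *v v)"
    "h2 *v (X *v v) = X *v (h2 *v v) + of_rat (snd d) *s (X *v v)" for v
    by (metis add.commute bracket_mult_vec diff_add_cancel mscale_mult_vec)+
  then show "has_degree d X"
    by (cases d) (auto simp: has_degree_def eigenspace_iff mult_vec_simps of_rat_add vec.scale_left_distrib)
qed

lemma has_degreeD: "has_degree d X \<Longrightarrow> v \<in> E u \<Longrightarrow> X *v v \<in> E (u + d)"
  unfolding has_degree_def by blast

lemma has_degreeI: "(\<And>u v. v \<in> E u \<Longrightarrow> X *v v \<in> E (u + d)) \<Longrightarrow> has_degree d X"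
  unfolding has_degree_def by blast

lemma has_degree_mult: "has_degree d X \<Longrightarrow> has_degree d' Y \<Longrightarrow> has_degree (d' + d) (X ** Y)"
  by (rule has_degreeI) (simp add: mult_vec_simps add.assoc[symmetric] has_degreeD)

lemma has_degree_diff: "has_degree d X \<Longrightarrow> has_degree d Y \<Longrightarrow> has_degree d (X - Y)"
  by (rule has_degreeI) (simp add: mult_vec_simps vec.subspace_diff subspace_eigenspace has_degreeD)

lemma has_degree_bracket: "has_degree d X \<Longrightarrow> has_degree d' Y \<Longrightarrow> has_degree (d + d') (bracket X Y)"
  unfolding bracket_def by (metis has_degree_mult has_degree_diff add.commute)

text \<open>The degree of a nonzero homogeneous matrix is a difference of two weights, and there are
  finitely many weights. This ends every string under the adjoint action of an operator of nonzero
  degree.\<close>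

lemma degree_bounded:
  "\<exists>b. \<forall>d X. has_degree d X \<and> (b < \<bar>fst d\<bar> \<or> b < \<bar>snd d\<bar>) \<longrightarrow> X = 0"
proof -
  have "\<exists>b. \<forall>u\<in>S. \<bar>fst u\<bar> + \<bar>snd u\<bar> \<le> b"
    using finite_S by (intro exI[of _ "\<Sum>u\<in>S. \<bar>fst u\<bar> + \<bar>snd u\<bar>"]) (auto intro: member_le_sum)
  then obtain b where b: "\<And>u. u \<in> S \<Longrightarrow> \<bar>fst u\<bar> + \<bar>snd u\<bar> \<le> b" by blast
  have "X = 0" if X: "has_degree d X" "2 * b < \<bar>fst d\<bar> \<or> 2 * b < \<bar>snd d\<bar>" for d X
  proof (rule matrix_eqI)
    fix u v assume v: "v \<in> E u"
    show "X *v v = 0 *v v"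
    proof (cases "u \<in> S \<and> u + d \<in> S")
      case True
      then have "\<bar>fst u\<bar> + \<bar>snd u\<bar> \<le> b" "\<bar>fst u + fst d\<bar> + \<bar>snd u + snd d\<bar> \<le> b"
        using b[of u] b[of "u + d"] by auto
      then show ?thesis using X(2) by arith
    next
      case False
      then show ?thesis using E_zero[OF _ v] E_zero[OF _ has_degreeD[OF X(1) v]] by auto
    qed
  qed
  then show ?thesis by blast
qed

text \<open>The component of \<open>X\<close> of weight \<open>d\<close> for the adjoint action of
  \<open>h1\<close> and \<open>h2\<close>; the sum runs over the weights of the source.\<close>

definition hom_part :: "rat \<times> rat \<Rightarrow> 'k^'n^'n \<Rightarrow> 'k^'n^'n" where
  "hom_part d X = (\<Sum>u\<in>S. P (u + d) ** X ** P u)"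

lemma hom_part_mult: "v \<in> E u \<Longrightarrow> hom_part d X *v v = P (u + d) *v (X *v v)"
proof -
  assume v: "v \<in> E u"
  have "hom_part d X *v v = (\<Sum>w\<in>S. if w = u then P (u + d) *v (X *v v) else 0)"
    unfolding hom_part_def sum_mult_vec
    using P_same[OF v] P_other[OF v] by (intro sum.cong) (auto simp: mult_vec_simps)
  also have "\<dots> = P (u + d) *v (X *v v)"
    using finite_S E_zero[OF _ v] by (cases "u \<in> S") auto
  finally show ?thesis .
qed

lemma has_degree_hom_part: "has_degree d (hom_part d X)"
  by (rule has_degreeI) (simp add: hom_part_mult P_in)

lemma hom_part_same: "has_degree d X \<Longrightarrow> hom_part d X = X"
  by (rule matrix_eqI) (simp add: hom_part_mult P_same has_degreeD)

text \<open>A homogeneous \<open>X\<close> intertwines the projection at \<open>w\<close> with the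
  one at \<open>w + d\<close>, so it can be pulled out of the component.\<close>

lemma hom_part_mult_left: "has_degree d X \<Longrightarrow> hom_part (d + d') (X ** Y) = X ** hom_part d' Y"
proof (rule matrix_eqI)
  fix u v assume X: "has_degree d X" and v: "v \<in> E u"
  have "P (w + d) ** X = X ** P w" for w
  proof (rule matrix_eqI)
    fix u v assume v: "v \<in> E u"
    then show "(P (w + d) ** X) *v v = (X ** P w) *v v"
      using P_same[OF v] P_other[OF v, of w] P_same[OF has_degreeD[OF X v]]
        P_other[OF has_degreeD[OF X v], of "w + d"]
      by (cases "u = w") (auto simp: mult_vec_simps)
  qed
  then have "P (u + d' + d) *v (X *v y) = X *v (P (u + d') *v y)" for y
    by (metis matrix_vector_mul_assoc)
  then show "hom_part (d + d') (X ** Y) *v v = (X ** hom_part d' Y) *v v"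
    using v by (simp add: hom_part_mult mult_vec_simps add_ac)
qed

lemma hom_part_mult_right: "has_degree d X \<Longrightarrow> hom_part (d + d') (Y ** X) = hom_part d' Y ** X"
  by (rule matrix_eqI) (simp add: hom_part_mult[OF has_degreeD] hom_part_mult mult_vec_simps add.assoc)

text \<open>Lets the relations of a triple be projected to a single degree: the homogeneous entry of
  the bracket stays fixed and only the other is replaced by a component.\<close>

lemma hom_part_bracket: "has_degree d X \<Longrightarrow> hom_part (d + d') (bracket X Y) = bracket X (hom_part d' Y)"
proof -
  assume X: "has_degree d X"
  have "hom_part e (A - B) = hom_part e A - hom_part e B" for e A B
    by (rule matrix_eqI) (simp add: hom_part_mult mult_vec_simps)
  then show ?thesis using X by (simp add: bracket_def hom_part_mult_left hom_part_mult_right)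
qed

end

section \<open>Strings of \<open>sl\<^sub>2\<close>-modules\<close>

text \<open>The scaling is abstract because the string is used both for vectors and for matrices
  under the adjoint action. The start vector satisfies \<open>f (e w) = 0\<close>, which is weaker
  than being killed by \<open>e\<close>; this later excludes arrows that enter a box from
  outside.\<close>

lemma sl2_string:
  fixes s :: "'k::field_char_0 \<Rightarrow> 'v::ab_group_add \<Rightarrow> 'v"
  assumes "vector_space s" and lin: "Vector_Spaces.linear s s f"
    and ef: "\<And>x. e (f x) = f (e x) + h x" and hf: "\<And>x. h (f x) = f (h x) - s 2 (f x)"
    and w: "h w = s \<mu> w" "f (e w) = 0"
  shows "e ((f ^^ Suc k) w) = s (of_nat (Suc k) * (\<mu> - of_nat k)) ((f ^^ k) w)"
proof -
  interpret vector_space s by fact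
  interpret f: Vector_Spaces.linear s s f by fact
  have h: "h ((f ^^ k) w) = s (\<mu> - 2 * of_nat k) ((f ^^ k) w)" for k
  proof (induct k)
    case (Suc k)
    have "h ((f ^^ Suc k) w) = s (\<mu> - 2 * of_nat k - 2) ((f ^^ Suc k) w)"
      by (simp add: hf Suc f.scale f.diff scale_left_diff_distrib)
    also have "\<mu> - 2 * of_nat k - 2 = \<mu> - 2 * of_nat (Suc k)" by (simp add: algebra_simps)
    finally show ?case .
  qed (simp add: w)
  show ?thesis
  proof (induct k)
    case 0
    then show ?case by (simp add: ef w)
  next
    case (Suc k)
    have "e ((f ^^ Suc (Suc k)) w) = f (e ((f ^^ Suc k) w)) + h ((f ^^ Suc k) w)"
      by (simp only: funpow.simps o_def ef)
    also have "\<dots> = s (of_nat (Suc k) * (\<mu> - of_nat k)) ((f ^^ Suc k) w) +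
        s (\<mu> - 2 * of_nat (Suc k)) ((f ^^ Suc k) w)"
      by (simp only: Suc h f.scale) simp
    also have "\<dots> = s (of_nat (Suc (Suc k)) * (\<mu> - of_nat (Suc k))) ((f ^^ Suc k) w)"
      by (simp only: scale_left_distrib[symmetric]) (simp add: algebra_simps)
    finally show ?case .
  qed
qed

text \<open>Let \<open>m\<close> be the last index with a nonzero power. Applying \<open>e\<close>
  to the next, vanishing power shows that (m + 1)(\<mu> - m) annihilates a nonzero vector.
  Nilpotency of \<open>f\<close> on \<open>w\<close> stands in for finite dimension.\<close>

lemma sl2_string_weight:
  fixes s :: "'k::field_char_0 \<Rightarrow> 'v::ab_group_add \<Rightarrow> 'v"
  assumes "vector_space s" and lin: "Vector_Spaces.linear s s f"
    and ef: "\<And>x. e (f x) = f (e x) + h x" and hf: "\<And>x. h (f x) = f (h x) - s 2 (f x)"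
    and w: "h w = s \<mu> w" "f (e w) = 0" and "w \<noteq> 0" "(f ^^ N) w = 0" and e0: "e 0 = 0"
  shows "\<exists>m. \<mu> = of_nat m \<and> (f ^^ Suc m) w = 0 \<and> (\<forall>i\<le>m. (f ^^ i) w \<noteq> 0)"
proof -
  interpret vector_space s by fact
  define k where "k = (LEAST k. (f ^^ k) w = 0)"
  have k: "(f ^^ k) w = 0" unfolding k_def by (rule LeastI) fact
  then have "k \<noteq> 0" using \<open>w \<noteq> 0\<close> by (cases k) auto
  then obtain m where m: "k = Suc m" by (cases k) auto
  have nz: "(f ^^ i) w \<noteq> 0" if "i \<le> m" for i
    using not_less_Least[of i "\<lambda>k. (f ^^ k) w = 0"] that m unfolding k_def by auto
  have "0 = s (of_nat (Suc m) * (\<mu> - of_nat m)) ((f ^^ m) w)"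
    using sl2_string[OF assms(1-6), of m] k e0 unfolding m by simp
  then have "\<mu> = of_nat m" using nz[of m] by (simp del: of_nat_Suc)
  then show ?thesis using nz k m by blast
qed

section \<open>Identities for the bracket of matrices\<close>

lemma bracket_jacobi: "bracket X (bracket Y Z) = bracket Y (bracket X Z) + bracket (bracket X Y) Z"
  by (simp add: matrix_eq mult_vec_simps)

lemma bracket_antisym: "bracket Y X = - bracket X Y"
  by (simp add: bracket_def)

lemma bracket_mscale_left: "bracket (mscale c X) Y = mscale c (bracket X Y)"
  by (simp add: matrix_eq mult_vec_simps)

lemma bracket_mscale_right: "bracket X (mscale c Y) = mscale c (bracket X Y)"
  by (simp add: matrix_eq mult_vec_simps)

lemma bracket_minus_left: "bracket (- X) Y = - bracket X Y"
  by (simp add: matrix_eq mult_vec_simps)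

lemma bracket_minus_right: "bracket X (- Y) = - bracket X Y"
  by (simp add: matrix_eq mult_vec_simps)

lemma bracket_0 [simp]: "bracket X 0 = 0" "bracket 0 X = 0"
  by (simp_all add: bracket_def matrix_eq mult_vec_simps)

lemma linear_bracket: "Vector_Spaces.linear mscale mscale (bracket X)"
  by unfold_locales (simp_all add: matrix_eq mult_vec_simps vec.scale_right_distrib vec.scale_left_distrib)

context bigraded
begin

lemma has_degree_power: "has_degree d X \<Longrightarrow> v \<in> E u \<Longrightarrow>
    ((*v) X ^^ k) v \<in> E (u + (of_nat k * fst d, of_nat k * snd d))"
proof (induct k)
  case (Suc k)
  have "u + (of_nat k * fst d, of_nat k * snd d) + d = u + (of_nat (Suc k) * fst d, of_nat (Suc k) * snd d)"
    by (simp add: prod_eq_iff algebra_simps)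
  then show ?case using has_degreeD[OF Suc(2) Suc(1)[OF Suc(2,3)]] by (simp only: funpow.simps o_def)
qed (simp add: zero_prod_def[symmetric])

lemma unbounded_multiple: "d \<noteq> (0, 0) \<Longrightarrow>
    \<exists>k::nat. b < \<bar>p + of_nat k * fst d\<bar> \<or> b < \<bar>q + of_nat k * snd d\<bar>" for d :: "rat \<times> rat"
proof -
  have "\<exists>k::nat. b < \<bar>p + of_nat k * x\<bar>" if "x \<noteq> 0" for p x :: rat
  proof -
    obtain k :: nat where "(\<bar>p\<bar> + b) / \<bar>x\<bar> < of_nat k" using reals_Archimedean2 by blast
    then have "\<bar>p\<bar> + b < \<bar>of_nat k * x\<bar>" using that by (simp add: abs_mult divide_less_eq)
    then show ?thesis by (intro exI[of _ k]) arith
  qed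
  moreover assume "d \<noteq> (0, 0)"
  ultimately show ?thesis by (metis prod.collapse)
qed

lemma power_eq_0:
  assumes "has_degree d X" "v \<in> E u" "d \<noteq> (0, 0)"
  shows "\<exists>k. ((*v) X ^^ k) v = 0"
proof -
  have "\<exists>b. \<forall>u\<in>S. \<bar>fst u\<bar> + \<bar>snd u\<bar> \<le> b"
    using finite_S by (intro exI[of _ "\<Sum>u\<in>S. \<bar>fst u\<bar> + \<bar>snd u\<bar>"]) (auto intro: member_le_sum)
  then obtain b where b: "\<And>u. u \<in> S \<Longrightarrow> \<bar>fst u\<bar> + \<bar>snd u\<bar> \<le> b" by blast
  obtain k :: nat where "b < \<bar>fst u + of_nat k * fst d\<bar> \<or> b < \<bar>snd u + of_nat k * snd d\<bar>"
    using unbounded_multiple[OF assms(3)] by blast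
  then have "u + (of_nat k * fst d, of_nat k * snd d) \<notin> S"
    using b[of "u + (of_nat k * fst d, of_nat k * snd d)"] by auto
  then show ?thesis using E_zero has_degree_power[OF assms(1,2)] by blast
qed

lemma has_degree_ad_power: "has_degree d X \<Longrightarrow> has_degree d' D \<Longrightarrow>
    has_degree (d' + (of_nat k * fst d, of_nat k * snd d)) ((bracket X ^^ k) D)"
proof (induct k)
  case (Suc k)
  have "d + (d' + (of_nat k * fst d, of_nat k * snd d)) = d' + (of_nat (Suc k) * fst d, of_nat (Suc k) * snd d)"
    by (simp add: prod_eq_iff algebra_simps)
  then show ?case using has_degree_bracket[OF Suc(2) Suc(1)[OF Suc(2,3)]] by (simp only: funpow.simps o_def)
qed (simp add: zero_prod_def[symmetric])

text \<open>In a finite-dimensional \<open>sl\<^sub>2\<close>-module no highest weight is negative; this is applied to the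
  adjoint action on matrices.\<close>

lemma sl2_negative_highest_weight:
  assumes ef: "bracket e f = mscale 2 h" and hf: "bracket h f = mscale (- 1) f"
    and f: "has_degree d f" "d \<noteq> (0, 0)" and D: "has_degree d' D" "bracket e D = 0" "bracket h D = mscale (- 1) D"
  shows "D = 0"
proof (rule ccontr)
  assume "D \<noteq> 0"
  obtain b where b: "\<And>d X. has_degree d X \<Longrightarrow> b < \<bar>fst d\<bar> \<or> b < \<bar>snd d\<bar> \<Longrightarrow> X = 0"
    using degree_bounded by blast
  obtain N :: nat where "b < \<bar>fst d' + of_nat N * fst d\<bar> \<or> b < \<bar>snd d' + of_nat N * snd d\<bar>"
    using unbounded_multiple[OF f(2)] by blast
  then have N: "(bracket f ^^ N) D = 0" using b[OF has_degree_ad_power[OF f(1) D(1)], of N] by simp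
  have 1: "bracket e (bracket f x) = bracket f (bracket e x) + bracket (mscale 2 h) x" for x
    by (subst bracket_jacobi) (simp add: ef)
  have 2: "bracket (mscale 2 h) (bracket f x) = bracket f (bracket (mscale 2 h) x) - mscale 2 (bracket f x)" for x
    by (subst bracket_jacobi) (simp add: bracket_mscale_left bracket_minus_left hf mat_space.scale_minus_left)
  \<comment> \<open>\<open>h\<close> is half of the neutral element, so its eigenvalue - 1 means
    weight - 2.\<close>
  have 3: "bracket (mscale 2 h) D = mscale (- 2) D" by (simp add: bracket_mscale_left D mat_space.scale_minus_left)
  have "\<exists>m. - 2 = (of_nat m :: 'k) \<and> (bracket f ^^ Suc m) D = 0 \<and> (\<forall>i\<le>m. (bracket f ^^ i) D \<noteq> 0)"
    by (rule sl2_string_weight[OF mat_space.vector_space_axioms linear_bracket 1 2 3 _ \<open>D \<noteq> 0\<close> N]) (simp_all add: D)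
  then obtain m where "- 2 = (of_nat m :: 'k)" by blast
  then have "of_nat (m + 2) = (0 :: 'k)" by (metis add.left_inverse of_nat_add of_nat_numeral add.commute)
  then show False by (simp only: of_nat_eq_0_iff)
qed

text \<open>\<open>[Y, f]\<close> is killed by \<open>ad e\<close>, since
  \<open>[e, [Y, f]] = [Y, 2 h] = 0\<close>, and has eigenvalue - 1 under \<open>ad h\<close>; such
  a matrix must vanish.\<close>

lemma sl2_commute:
  assumes ef: "bracket e f = mscale 2 h" and hf: "bracket h f = mscale (- 1) f"
    and f: "has_degree d f" "d \<noteq> (0, 0)" and Y: "has_degree d' Y" "bracket e Y = 0" "bracket h Y = 0"
  shows "bracket Y f = 0"
proof (rule sl2_negative_highest_weight[OF ef hf f])
  have c: "bracket Y e = 0" "bracket Y h = 0" using Y(2,3) by (simp_all add: bracket_antisym[of Y])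
  show "has_degree (d' + d) (bracket Y f)" using Y(1) f(1) by (rule has_degree_bracket)
  show "bracket e (bracket Y f) = 0"
    by (subst bracket_jacobi) (simp add: Y ef bracket_mscale_right c)
  show "bracket h (bracket Y f) = mscale (- 1) (bracket Y f)"
    by (subst bracket_jacobi) (simp add: Y hf bracket_mscale_right bracket_minus_right bracket_minus_left mat_space.scale_minus_left)
qed

end

section \<open>The graph of a module over two commuting copies of \<open>sl\<^sub>2\<close>\<close>

lemma dim_le_1_multiple:
  assumes "vec.dim U \<le> 1" "v \<in> U" "v \<noteq> 0" "w \<in> U"
  shows "\<exists>c. w = c *s v"
proof -
  have ind: "vec.independent {v}" using assms(3) by simp
  have "card {v} \<ge> vec.dim U" using assms(1) by simp
  then have "U \<subseteq> vec.span {v}"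
    using vec.card_ge_dim_independent[of "{v}" U] ind assms(2) by blast
  then show ?thesis using assms(4) by (auto simp: vec.span_singleton)
qed

lemma pverts_attached_graph: "pverts (attached_graph e1 e2 h1 h2 W) = {u. W \<inter> eigenspace h1 h2 u \<noteq> {0}}"
  by (simp add: attached_graph_def)

lemma in_parcs_attached_graph_iff:
  "(u, u') \<in> parcs (attached_graph e1 e2 h1 h2 W) \<longleftrightarrow>
     u' = u + (1, 0) \<and> (\<exists>v\<in>W \<inter> eigenspace h1 h2 u. e1 *v v \<noteq> 0) \<or>
     u' = u + (0, 1) \<and> (\<exists>v\<in>W \<inter> eigenspace h1 h2 u. e2 *v v \<noteq> 0)"
  unfolding attached_graph_def pair_pre_digraph.simps Un_iff mem_Collect_eq prod.inject by blast

locale bigraded_pair = bigraded h1 h2 P S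
  for h1 h2 :: "'k::field_char_0^'n^'n" and P S +
  fixes e1 e2 :: "'k^'n^'n"
  assumes degree_e1: "has_degree (1, 0) e1" and degree_e2: "has_degree (0, 1) e2"
    and e1_e2: "bracket e1 e2 = 0"
begin

abbreviation graph_on where "graph_on W \<equiv> attached_graph e1 e2 h1 h2 W"

lemma in_pverts_iff:
  "vec.subspace W \<Longrightarrow> u \<in> pverts (graph_on W) \<longleftrightarrow> (\<exists>v\<in>W \<inter> E u. v \<noteq> 0)"
  unfolding pverts_attached_graph using vec.subspace_0[of W] vec.subspace_0[OF subspace_eigenspace[of h1 h2 u]] by blast

lemma wf_graph_on:
  assumes W: "vec.subspace W" "stable {e1, e2} W"
  shows "pair_fin_digraph (graph_on W)"
proof -
  have arc: "u \<in> pverts (graph_on W) \<and> u' \<in> pverts (graph_on W) \<and> (u' = u + (1, 0) \<or> u' = u + (0, 1))"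
    if uu: "(u, u') \<in> parcs (graph_on W)" for u u'
  proof -
    from uu obtain e d v where e: "e \<in> {e1, e2}" "has_degree d e" "u' = u + d" "d = (1, 0) \<or> d = (0, 1)"
      and v: "v \<in> W \<inter> E u" "e *v v \<noteq> 0"
      unfolding in_parcs_attached_graph_iff using degree_e1 degree_e2 by blast
    have "e *v v \<in> W \<inter> E u'" using W(2) e v has_degreeD[OF e(2)] by (auto simp: stable_def)
    moreover have "v \<noteq> 0" using v(2) by auto
    ultimately show ?thesis using v e(3,4) unfolding in_pverts_iff[OF W(1)] by blast
  qed
  have "pverts (graph_on W) \<subseteq> S"
    using E_zero unfolding in_pverts_iff[OF W(1)] subset_iff by blast
  then have fin: "finite (pverts (graph_on W))" using finite_S by (rule finite_subset)
  show ?thesis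
  proof
    show "finite (parcs (graph_on W))"
      by (rule finite_subset[of _ "pverts (graph_on W) \<times> pverts (graph_on W)"])
        (use arc fin in \<open>auto simp: split_paired_all\<close>)
  qed (use arc fin in \<open>auto simp: split_paired_all\<close>)
qed

end

text \<open>\<open>h1\<close> and \<open>h2\<close> are half of the neutral elements, whence the
  factor 2. Apart from the bidegrees and \<open>[e1, e2] = 0\<close> no relation between the two
  triples is built in; the mixed brackets vanish by weights.\<close>

locale sl2_pair = bigraded_pair h1 h2 P S e1 e2
  for h1 h2 :: "'k::field_char_0^'n^'n" and P S e1 e2 +
  fixes f1 f2 :: "'k^'n^'n"
  assumes degree_f1: "has_degree (- 1, 0) f1" and degree_f2: "has_degree (0, - 1) f2"
    and e1_f1: "bracket e1 f1 = mscale 2 h1" and e2_f2: "bracket e2 f2 = mscale 2 h2"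
begin

lemma h_brackets:
  "bracket h1 e1 = mscale 1 e1" "bracket h2 e1 = 0" "bracket h1 e2 = 0" "bracket h2 e2 = mscale 1 e2"
  "bracket h1 f1 = mscale (- 1) f1" "bracket h2 f1 = 0" "bracket h1 f2 = 0" "bracket h2 f2 = mscale (- 1) f2"
  using degree_e1 degree_e2 degree_f1 degree_f2 unfolding has_degree_iff by simp_all

lemma bracket_comm: "bracket X Y = 0 \<Longrightarrow> X *v (Y *v v) = Y *v (X *v v)"
  using bracket_mult_vec[of X Y v] by simp

text \<open>Applied to \<open>e2\<close> and \<open>f2\<close> this yields mixed relations; applied
  to an idempotent of degree (0, 0) it shows that the piece it cuts out is stable under
  \<open>f1\<close>.\<close>

lemma commute_f1: "has_degree d Y \<Longrightarrow> bracket e1 Y = 0 \<Longrightarrow> bracket h1 Y = 0 \<Longrightarrow> bracket Y f1 = 0"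
  by (rule sl2_commute[OF e1_f1 h_brackets(5) degree_f1]) simp_all

lemma commute_f2: "has_degree d Y \<Longrightarrow> bracket e2 Y = 0 \<Longrightarrow> bracket h2 Y = 0 \<Longrightarrow> bracket Y f2 = 0"
  by (rule sl2_commute[OF e2_f2 h_brackets(8) degree_f2]) simp_all

lemma e2_f1: "bracket e2 f1 = 0"
  by (rule commute_f1[OF degree_e2 e1_e2 h_brackets(3)])

lemma e1_f2: "bracket e1 f2 = 0"
  by (rule commute_f2[OF degree_e1]) (simp_all add: e1_e2 bracket_antisym[of e2 e1] h_brackets)

lemma f2_f1: "bracket f2 f1 = 0"
  by (rule commute_f1[OF degree_f2 e1_f2 h_brackets(7)])

text \<open>The neutral element \<open>2 h1\<close> has eigenvalue 2p on \<open>v\<close>, so p =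
  m/2; in particular p is not negative. The hypothesis leaves room for \<open>e1 *v v\<close> to be
  nonzero.\<close>

lemma string1:
  assumes v: "v \<in> E (p, q)" "v \<noteq> 0" "f1 *v (e1 *v v) = 0"
  shows "\<exists>m. p = of_nat m / 2 \<and> ((*v) f1 ^^ Suc m) v = 0 \<and> (\<forall>i\<le>m. ((*v) f1 ^^ i) v \<noteq> 0) \<and>
    (\<forall>k. e1 *v (((*v) f1 ^^ Suc k) v) = (of_nat (Suc k) * (of_nat m - of_nat k)) *s (((*v) f1 ^^ k) v))"
proof -
  obtain N where N: "((*v) f1 ^^ N) v = 0" using power_eq_0[OF degree_f1 v(1)] by auto
  have 1: "e1 *v (f1 *v x) = f1 *v (e1 *v x) + mscale 2 h1 *v x" for x
    using bracket_mult_vec[of e1 f1 x] by (simp add: e1_f1)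
  have 2: "mscale 2 h1 *v (f1 *v x) = f1 *v (mscale 2 h1 *v x) - 2 *s (f1 *v x)" for x
  proof -
    have "bracket (mscale 2 h1) f1 = mscale (- 2) f1" by (simp add: bracket_mscale_left h_brackets)
    then have "mscale 2 h1 *v (f1 *v x) - f1 *v (mscale 2 h1 *v x) = - (2 *s (f1 *v x))"
      by (metis bracket_mult_vec mscale_mult_vec vec.scale_minus_left)
    then show ?thesis by (simp only: diff_eq_eq uminus_add_conv_diff diff_add_cancel)
  qed
  have 3: "mscale 2 h1 *v v = of_rat (2 * p) *s v"
    using v(1) by (simp add: eigenspace_iff mult_vec_simps of_rat_mult)
  obtain m where m: "of_rat (2 * p) = (of_nat m :: 'k)" "((*v) f1 ^^ Suc m) v = 0" "\<forall>i\<le>m. ((*v) f1 ^^ i) v \<noteq> 0"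
    using sl2_string_weight[OF vec.vector_space_axioms matrix_vector_mul_linear_gen 1 2 3 v(3,2) N] by auto
  have "of_rat (2 * p) = (of_rat (of_nat m) :: 'k)" using m(1) by simp
  then have "p = of_nat m / 2" by (simp only: of_rat_eq_iff)
  then show ?thesis
    using m(2,3) sl2_string[OF vec.vector_space_axioms matrix_vector_mul_linear_gen 1 2 3 v(3)]
    unfolding m(1) by blast
qed

end

text \<open>Exchanging the two coordinates turns the second triple into the first, so statements
  about one triple transfer to the other.\<close>

lemma (in bigraded) bigraded_swap: "bigraded h2 h1 (P \<circ> prod.swap) (prod.swap ` S)"
proof
  show "finite (prod.swap ` S)" using finite_S by simp
  show "(\<Sum>u\<in>prod.swap ` S. (P \<circ> prod.swap) u *v v) = v" for v
    by (subst sum.reindex) (auto simp: sum_P)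
  have sw: "eigenspace h2 h1 u = E (prod.swap u)" for u by (cases u) (simp add: eigenspace_swap)
  show "(P \<circ> prod.swap) u *v v \<in> eigenspace h2 h1 u" for u v unfolding sw by (simp add: P_in)
  show "v \<in> eigenspace h2 h1 u \<Longrightarrow> (P \<circ> prod.swap) u *v v = v" for u v unfolding sw by (simp add: P_same)
  show "v \<in> eigenspace h2 h1 u \<Longrightarrow> u \<noteq> u' \<Longrightarrow> (P \<circ> prod.swap) u' *v v = 0" for u u' v
    unfolding sw o_apply by (rule P_other) (auto simp: prod_eq_iff)
qed

lemma (in bigraded) has_degree_swap: "bigraded.has_degree h2 h1 d X \<longleftrightarrow> has_degree (prod.swap d) X"
  using bigraded.has_degree_iff[OF bigraded_swap, of d X] unfolding has_degree_iff by auto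

lemma (in sl2_pair) sl2_pair_swap: "sl2_pair h2 h1 (P \<circ> prod.swap) (prod.swap ` S) e2 e1 f2 f1"
proof -
  interpret swap: bigraded h2 h1 "P \<circ> prod.swap" "prod.swap ` S" by (rule bigraded_swap)
  show ?thesis
    by unfold_locales (simp_all add: has_degree_swap degree_e1 degree_e2 degree_f1 degree_f2
        e1_f1 e2_f2 bracket_antisym[of e2 e1] e1_e2)
qed

section \<open>Boxes generated by highest weight vectors\<close>

context sl2_pair
begin

lemma string2:
  assumes "v \<in> E (p, q)" "v \<noteq> 0" "f2 *v (e2 *v v) = 0"
  shows "\<exists>n. q = of_nat n / 2 \<and> ((*v) f2 ^^ Suc n) v = 0 \<and> (\<forall>i\<le>n. ((*v) f2 ^^ i) v \<noteq> 0) \<and>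
    (\<forall>k. e2 *v (((*v) f2 ^^ Suc k) v) = (of_nat (Suc k) * (of_nat n - of_nat k)) *s (((*v) f2 ^^ k) v))"
  by (rule sl2_pair.string1[OF sl2_pair_swap, of v q p]) (use assms in \<open>simp_all add: eigenspace_swap\<close>)

lemma comm_power: "bracket X f = 0 \<Longrightarrow> X *v (((*v) f ^^ j) v) = ((*v) f ^^ j) (X *v v)"
  by (induct j) (simp_all add: bracket_comm[of X f])

lemma power_0: "((*v) f ^^ j) 0 = 0" for f :: "'k^'n^'n"
  by (induct j) simp_all

lemma power_scale: "((*v) f ^^ j) (c *s v) = c *s ((*v) f ^^ j) v" for f :: "'k^'n^'n"
  by (induct j) (simp_all add: mult_vec_simps)

text \<open>Because \<open>f1\<close> and \<open>f2\<close> commute with each other and with the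
  opposite raising operators, the string of \<open>f2\<close> can be started at every member of the
  string of \<open>f1\<close>. This gives an array of m + 1 by n + 1 nonzero vectors.\<close>

lemma highest_weight_vector:
  assumes v: "v \<in> E (p, q)" "v \<noteq> 0" "e1 *v v = 0" "e2 *v v = 0"
  obtains m n where "p = of_nat m / 2" "q = of_nat n / 2"
    "\<And>i j. i \<le> m \<Longrightarrow> j \<le> n \<Longrightarrow> ((*v) f2 ^^ j) (((*v) f1 ^^ i) v) \<noteq> 0"
    "\<And>j. f1 *v ((*v) f2 ^^ j) (((*v) f1 ^^ m) v) = 0"
    "\<And>i. i \<le> m \<Longrightarrow> f2 *v ((*v) f2 ^^ n) (((*v) f1 ^^ i) v) = 0"
    "\<And>j. e1 *v ((*v) f2 ^^ j) v = 0"
    "\<And>i j. i < m \<Longrightarrow> j \<le> n \<Longrightarrow> e1 *v ((*v) f2 ^^ j) (((*v) f1 ^^ Suc i) v) \<noteq> 0"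
    "\<And>i. e2 *v (((*v) f1 ^^ i) v) = 0"
    "\<And>i j. i \<le> m \<Longrightarrow> j < n \<Longrightarrow> e2 *v ((*v) f2 ^^ Suc j) (((*v) f1 ^^ i) v) \<noteq> 0"
proof -
  obtain m where m: "p = of_nat m / 2" "((*v) f1 ^^ Suc m) v = 0" "\<And>i. i \<le> m \<Longrightarrow> ((*v) f1 ^^ i) v \<noteq> 0"
    "\<And>k. e1 *v (((*v) f1 ^^ Suc k) v) = (of_nat (Suc k) * (of_nat m - of_nat k)) *s (((*v) f1 ^^ k) v)"
    using string1[OF v(1,2)] v(3) by (metis vec.zero)
  have Ei: "((*v) f1 ^^ i) v \<in> E (p - of_nat i, q)" for i
    using has_degree_power[OF degree_f1 v(1), of i] by simp
  have e2i: "e2 *v (((*v) f1 ^^ i) v) = 0" for i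
    using comm_power[OF e2_f1, of i v] by (simp add: v(4) power_0)
  have ex_n: "\<exists>n. q = of_nat n / 2 \<and> ((*v) f2 ^^ Suc n) (((*v) f1 ^^ i) v) = 0 \<and>
      (\<forall>j\<le>n. ((*v) f2 ^^ j) (((*v) f1 ^^ i) v) \<noteq> 0) \<and>
      (\<forall>k. e2 *v (((*v) f2 ^^ Suc k) (((*v) f1 ^^ i) v)) =
         (of_nat (Suc k) * (of_nat n - of_nat k)) *s (((*v) f2 ^^ k) (((*v) f1 ^^ i) v)))" if "i \<le> m" for i
    using string2[OF Ei m(3)[OF that]] e2i[of i] by (simp only: vec.zero simp_thms)
  \<comment> \<open>All vectors of the \<open>f1\<close>-string have second weight \<open>q\<close>,
    so their \<open>f2\<close>-strings all end at index 2q; one \<open>n\<close> serves every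
    \<open>i\<close>.\<close>
  define n where "n = nat \<lfloor>2 * q\<rfloor>"
  have n: "q = of_nat n / 2 \<and> ((*v) f2 ^^ Suc n) (((*v) f1 ^^ i) v) = 0 \<and>
      (\<forall>j\<le>n. ((*v) f2 ^^ j) (((*v) f1 ^^ i) v) \<noteq> 0) \<and>
      (\<forall>k. e2 *v (((*v) f2 ^^ Suc k) (((*v) f1 ^^ i) v)) =
         (of_nat (Suc k) * (of_nat n - of_nat k)) *s (((*v) f2 ^^ k) (((*v) f1 ^^ i) v)))" if i: "i \<le> m" for i
  proof -
    obtain n' where n': "q = of_nat n' / 2 \<and> ((*v) f2 ^^ Suc n') (((*v) f1 ^^ i) v) = 0 \<and>
      (\<forall>j\<le>n'. ((*v) f2 ^^ j) (((*v) f1 ^^ i) v) \<noteq> 0) \<and>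
      (\<forall>k. e2 *v (((*v) f2 ^^ Suc k) (((*v) f1 ^^ i) v)) =
         (of_nat (Suc k) * (of_nat n' - of_nat k)) *s (((*v) f2 ^^ k) (((*v) f1 ^^ i) v)))"
      using ex_n[OF i] by blast
    then have "n = n'" unfolding n_def by (metis floor_of_nat nat_int nonzero_mult_div_cancel_left times_divide_eq_right zero_neq_numeral)
    then show ?thesis using n' by simp
  qed
  have f1_pow: "f1 *v ((*v) f2 ^^ j) x = ((*v) f2 ^^ j) (f1 *v x)" for j x
    by (rule comm_power) (simp add: bracket_antisym[of f1 f2] f2_f1)
  have e1_pow: "e1 *v ((*v) f2 ^^ j) x = ((*v) f2 ^^ j) (e1 *v x)" for j x
    by (rule comm_power[OF e1_f2])
  have ne: "of_nat (Suc k) * (of_nat l - of_nat k) \<noteq> (0 :: 'k)" if "k < l" for k l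
    using that by (simp del: of_nat_Suc)
  show thesis
  proof (rule that[of m n])
    show "f1 *v ((*v) f2 ^^ j) (((*v) f1 ^^ m) v) = 0" for j
      using m(2) by (simp add: f1_pow power_0)
    show "e1 *v ((*v) f2 ^^ j) v = 0" for j by (simp add: e1_pow v(3) power_0)
    show "e1 *v ((*v) f2 ^^ j) (((*v) f1 ^^ Suc i) v) \<noteq> 0" if "i < m" "j \<le> n" for i j
    proof -
      have "((*v) f2 ^^ j) (((*v) f1 ^^ i) v) \<noteq> 0" using n[of i] that by auto
      then show ?thesis
        unfolding e1_pow m(4) power_scale using ne[OF that(1)] by simp
    qed
    show "e2 *v ((*v) f2 ^^ Suc j) (((*v) f1 ^^ i) v) \<noteq> 0" if "i \<le> m" "j < n" for i j
    proof -
      have "((*v) f2 ^^ j) (((*v) f1 ^^ i) v) \<noteq> 0"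
        "e2 *v (((*v) f2 ^^ Suc j) (((*v) f1 ^^ i) v)) =
         (of_nat (Suc j) * (of_nat n - of_nat j)) *s (((*v) f2 ^^ j) (((*v) f1 ^^ i) v))"
        using n[OF that(1)] that(2) by auto
      then show ?thesis using ne[OF that(2)] by simp
    qed
  qed (use m n e2i in auto)
qed


text \<open>A sink carries a highest weight vector. Since the weight spaces of \<open>W\<close> are
  lines, the arrows at the weights of its array are decided by the array itself, and these weights
  form a box that no arrow leaves or enters.\<close>

lemma component_at_sink_is_box:
  assumes W: "vec.subspace W" "stable {e1, e2, f1, f2} W"
    and mf: "\<And>u v w. v \<in> W \<inter> E u \<Longrightarrow> v \<noteq> 0 \<Longrightarrow> w \<in> W \<inter> E u \<Longrightarrow> \<exists>c. w = c *s v"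
    and u: "u \<in> pverts (graph_on W)" and sink: "\<And>u'. (u, u') \<notin> parcs (graph_on W)"
  shows "\<exists>m n. component_at (graph_on W) u = box_graph m n"
proof -
  obtain p q where pq: "u = (p, q)" by fastforce
  obtain v where v: "v \<in> W" "v \<in> E (p, q)" "v \<noteq> 0" using u unfolding pq in_pverts_iff[OF W(1)] by blast
  have ev: "e1 *v v = 0" "e2 *v v = 0"
    using sink v unfolding pq in_parcs_attached_graph_iff by blast+
  obtain m n where mn: "p = of_nat m / 2" "q = of_nat n / 2"
    and nz: "\<And>i j. i \<le> m \<Longrightarrow> j \<le> n \<Longrightarrow> ((*v) f2 ^^ j) (((*v) f1 ^^ i) v) \<noteq> 0"
    and f1m: "\<And>j. f1 *v ((*v) f2 ^^ j) (((*v) f1 ^^ m) v) = 0"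
    and f2n: "\<And>i. i \<le> m \<Longrightarrow> f2 *v ((*v) f2 ^^ n) (((*v) f1 ^^ i) v) = 0"
    and e1v: "\<And>j. e1 *v ((*v) f2 ^^ j) v = 0"
      "\<And>i j. i < m \<Longrightarrow> j \<le> n \<Longrightarrow> e1 *v ((*v) f2 ^^ j) (((*v) f1 ^^ Suc i) v) \<noteq> 0"
    and e2v: "\<And>i. e2 *v (((*v) f1 ^^ i) v) = 0"
      "\<And>i j. i \<le> m \<Longrightarrow> j < n \<Longrightarrow> e2 *v ((*v) f2 ^^ Suc j) (((*v) f1 ^^ i) v) \<noteq> 0"
    by (rule highest_weight_vector[OF v(2,3) ev]) (rule that)
  define x where "x i j = ((*v) f2 ^^ j) (((*v) f1 ^^ i) v)" for i j
  define g :: "nat \<Rightarrow> nat \<Rightarrow> rat \<times> rat" where "g i j = (p - of_nat i, q - of_nat j)" for i j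
  let ?G = "graph_on W" let ?B = "box_graph m n"
  have pow_W: "((*v) f ^^ k) y \<in> W" if "f \<in> {f1, f2}" "y \<in> W" for f y k
    using that W(2) by (induct k) (auto simp: stable_def)
  have x_E: "x i j \<in> W \<inter> E (g i j)" for i j
    using has_degree_power[OF degree_f2 has_degree_power[OF degree_f1 v(2), of i], of j]
    unfolding x_def g_def by (simp add: pow_W v(1))
  \<comment> \<open>The array counts down from the highest weight while the box counts up from its
    lowest corner, hence the reflection \<open>k - i\<close>.\<close>
  have node: "a \<in> pverts ?B \<longleftrightarrow> (\<exists>i\<le>m. \<exists>j\<le>n. a = g i j)" for a
  proof -
    have *: "(\<exists>i\<le>k. r = of_nat i - of_nat k / 2) \<longleftrightarrow> (\<exists>i\<le>k. r = of_nat k / 2 - of_nat i)" for r :: rat and k :: nat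
    proof
      assume "\<exists>i\<le>k. r = of_nat i - of_nat k / 2"
      then obtain i where "i \<le> k" "r = of_nat i - of_nat k / 2" by blast
      then show "\<exists>i\<le>k. r = of_nat k / 2 - of_nat i"
        by (intro exI[of _ "k - i"]) (simp add: of_nat_diff field_simps)
    next
      assume "\<exists>i\<le>k. r = of_nat k / 2 - of_nat i"
      then obtain i where "i \<le> k" "r = of_nat k / 2 - of_nat i" by blast
      then show "\<exists>i\<le>k. r = of_nat i - of_nat k / 2"
        by (intro exI[of _ "k - i"]) (simp add: of_nat_diff field_simps)
    qed
    obtain r t where "a = (r, t)" by fastforce
    then show ?thesis unfolding g_def mn by (simp only: in_pverts_box_iff * prod.inject) blast
  qed
  have arc1: "(g i j, g i j + (1, 0)) \<in> parcs ?G \<longleftrightarrow> 0 < i" if ij: "i \<le> m" "j \<le> n" for i j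
  proof -
    have "(g i j, g i j + (1, 0)) \<in> parcs ?G \<longleftrightarrow> (\<exists>w\<in>W \<inter> E (g i j). e1 *v w \<noteq> 0)"
      by (simp add: in_parcs_attached_graph_iff)
    also have "\<dots> \<longleftrightarrow> e1 *v x i j \<noteq> 0"
    proof
      assume "\<exists>w\<in>W \<inter> E (g i j). e1 *v w \<noteq> 0"
      then obtain w where w: "w \<in> W \<inter> E (g i j)" "e1 *v w \<noteq> 0" by blast
      obtain c where "w = c *s x i j" using mf[OF x_E _ w(1)] nz[OF ij] unfolding x_def by blast
      then show "e1 *v x i j \<noteq> 0" using w(2) by (auto simp: mult_vec_simps)
    qed (use x_E in blast)
    also have "\<dots> \<longleftrightarrow> 0 < i"
      using e1v(1)[of j] e1v(2)[of "i - 1" j] ij unfolding x_def by (cases i) auto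
    finally show ?thesis .
  qed
  have arc2: "(g i j, g i j + (0, 1)) \<in> parcs ?G \<longleftrightarrow> 0 < j" if ij: "i \<le> m" "j \<le> n" for i j
  proof -
    have "(g i j, g i j + (0, 1)) \<in> parcs ?G \<longleftrightarrow> (\<exists>w\<in>W \<inter> E (g i j). e2 *v w \<noteq> 0)"
      by (simp add: in_parcs_attached_graph_iff)
    also have "\<dots> \<longleftrightarrow> e2 *v x i j \<noteq> 0"
    proof
      assume "\<exists>w\<in>W \<inter> E (g i j). e2 *v w \<noteq> 0"
      then obtain w where w: "w \<in> W \<inter> E (g i j)" "e2 *v w \<noteq> 0" by blast
      obtain c where "w = c *s x i j" using mf[OF x_E _ w(1)] nz[OF ij] unfolding x_def by blast
      then show "e2 *v x i j \<noteq> 0" using w(2) by (auto simp: mult_vec_simps)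
    qed (use x_E in blast)
    also have "\<dots> \<longleftrightarrow> 0 < j"
      using e2v(1)[of i] e2v(2)[of i "j - 1"] ij unfolding x_def by (cases j) auto
    finally show ?thesis .
  qed
  have g_Suc: "g (Suc i) j + (1, 0) = g i j" "g i (Suc j) + (0, 1) = g i j" for i j
    by (simp_all add: g_def)
  have g_inj: "g i j = g i' j' \<longleftrightarrow> i = i' \<and> j = j'" for i j i' j'
    by (auto simp: g_def)
  have low1: "a \<in> pverts ?B" if a: "(a, a + (1, 0)) \<in> parcs ?G" "a + (1, 0) \<in> pverts ?B" for a
  proof -
    obtain i j where ij: "i \<le> m" "j \<le> n" "a + (1, 0) = g i j" using a(2) node by blast
    have ag: "a = g (Suc i) j" using ij(3) g_Suc(1)[of i j] by (metis add_right_cancel)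
    obtain w where w: "w \<in> W" "w \<in> E a" "e1 *v w \<noteq> 0"
      using a(1) by (auto simp: in_parcs_attached_graph_iff)
    \<comment> \<open>An arrow entering at the lowest first weight would give \<open>w\<close> of
      first weight - m/2 - 1 with \<open>f1\<close> killing \<open>e1 *v w\<close>, but the first
      weight of such a vector is never negative.\<close>
    have "i \<noteq> m"
    proof
      assume i: "i = m"
      have ew: "e1 *v w \<in> W \<inter> E (g m j)"
        using w W(2) has_degreeD[OF degree_e1 w(2)] ij(3) i by (auto simp: stable_def)
      obtain c where "e1 *v w = c *s x m j"
        using mf[OF x_E _ ew] nz[of m j] ij unfolding x_def by blast
      then have "f1 *v (e1 *v w) = 0" using f1m[of j] by (simp add: mult_vec_simps x_def)
      moreover have "w \<noteq> 0" using w(3) by auto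
      ultimately obtain k where "p - of_nat (Suc i) = of_nat k / 2"
        using string1[of w "p - of_nat (Suc i)" "q - of_nat j"] w(2) unfolding ag g_def by blast
      then have "of_nat (k + m + 2) = (0 :: rat)" unfolding mn i by (simp add: field_simps)
      then show False by (simp only: of_nat_eq_0_iff)
    qed
    then show ?thesis using ij ag node by (metis Suc_leI le_neq_implies_less)
  qed
  have low2: "a \<in> pverts ?B" if a: "(a, a + (0, 1)) \<in> parcs ?G" "a + (0, 1) \<in> pverts ?B" for a
  proof -
    obtain i j where ij: "i \<le> m" "j \<le> n" "a + (0, 1) = g i j" using a(2) node by blast
    have ag: "a = g i (Suc j)" using ij(3) g_Suc(2)[of i j] by (metis add_right_cancel)
    obtain w where w: "w \<in> W" "w \<in> E a" "e2 *v w \<noteq> 0"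
      using a(1) by (auto simp: in_parcs_attached_graph_iff)
    have "j \<noteq> n"
    proof
      assume j: "j = n"
      have ew: "e2 *v w \<in> W \<inter> E (g i n)"
        using w W(2) has_degreeD[OF degree_e2 w(2)] ij(3) j by (auto simp: stable_def)
      obtain c where "e2 *v w = c *s x i n"
        using mf[OF x_E _ ew] nz[of i n] ij unfolding x_def by blast
      then have "f2 *v (e2 *v w) = 0" using f2n[of i] ij by (simp add: mult_vec_simps x_def)
      moreover have "w \<noteq> 0" using w(3) by auto
      ultimately obtain k where "q - of_nat (Suc j) = of_nat k / 2"
        using string2[of w "p - of_nat i" "q - of_nat (Suc j)"] w(2) unfolding ag g_def by blast
      then have "of_nat (k + n + 2) = (0 :: rat)" unfolding mn j by (simp add: field_simps)
      then show False by (simp only: of_nat_eq_0_iff)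
    qed
    then show ?thesis using ij ag node by (metis Suc_leI le_neq_implies_less)
  qed
  have wfG: "pair_fin_digraph ?G"
    using wf_graph_on W by (auto simp: stable_def)
  have sub: "a \<in> pverts ?G" if "a \<in> pverts ?B" for a
    using that x_E nz unfolding node in_pverts_iff[OF W(1)] x_def by blast
  have up: "b \<in> pverts ?B" if ab: "(a, b) \<in> parcs ?G" "a \<in> pverts ?B" for a b
  proof -
    obtain i j where ij: "i \<le> m" "j \<le> n" "a = g i j" using ab(2) node by blast
    have "b = a + (1, 0) \<or> b = a + (0, 1)" using ab(1) by (auto simp: in_parcs_attached_graph_iff)
    then show ?thesis
    proof
      assume b: "b = a + (1, 0)"
      then obtain i' where "i = Suc i'" using arc1[OF ij(1,2)] ab(1) ij(3) by (cases i) auto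
      then show ?thesis using b ij g_Suc(1)[of i' j] node by (metis Suc_leD)
    next
      assume b: "b = a + (0, 1)"
      then obtain j' where "j = Suc j'" using arc2[OF ij(1,2)] ab(1) ij(3) by (cases j) auto
      then show ?thesis using b ij g_Suc(2)[of i j'] node by (metis Suc_leD)
    qed
  qed
  have closed: "a \<in> pverts ?B \<longleftrightarrow> b \<in> pverts ?B" if ab: "(a, b) \<in> parcs ?G" for a b
  proof -
    have "b = a + (1, 0) \<or> b = a + (0, 1)" using ab by (auto simp: in_parcs_attached_graph_iff)
    then show ?thesis using up[OF ab] low1[of a] low2[of a] ab by blast
  qed
  have arcs: "(a, b) \<in> parcs ?B \<longleftrightarrow> (a, b) \<in> parcs ?G \<and> a \<in> pverts ?B \<and> b \<in> pverts ?B" for a b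
  proof
    assume "(a, b) \<in> parcs ?B"
    then have ab: "a \<in> pverts ?B" "b \<in> pverts ?B" "b = a + (1, 0) \<or> b = a + (0, 1)"
      by (auto simp: parcs_box)
    obtain i j where ij: "i \<le> m" "j \<le> n" "a = g i j" using ab(1) node by blast
    obtain i' j' where ij': "i' \<le> m" "j' \<le> n" "b = g i' j'" using ab(2) node by blast
    from ab(3) have "(a, b) \<in> parcs ?G"
    proof
      assume b: "b = a + (1, 0)"
      then have "g i j = g (Suc i') j'" using ij ij' g_Suc(1)[of i' j'] by (metis add_right_cancel)
      then show ?thesis using arc1[OF ij(1,2)] b ij(3) by (simp add: g_inj)
    next
      assume b: "b = a + (0, 1)"
      then have "g i j = g i' (Suc j')" using ij ij' g_Suc(2)[of i' j'] by (metis add_right_cancel)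
      then show ?thesis using arc2[OF ij(1,2)] b ij(3) by (simp add: g_inj)
    qed
    then show "(a, b) \<in> parcs ?G \<and> a \<in> pverts ?B \<and> b \<in> pverts ?B" using ab by blast
  next
    assume "(a, b) \<in> parcs ?G \<and> a \<in> pverts ?B \<and> b \<in> pverts ?B"
    then show "(a, b) \<in> parcs ?B" unfolding parcs_box in_parcs_attached_graph_iff by blast
  qed
  have "component_at ?G u = ?B"
  proof (rule component_at_eqI)
    show "u \<in> pverts ?B" unfolding node pq g_def by (intro exI[of _ 0]) simp
    show "parcs ?B = parcs ?G \<inter> pverts ?B \<times> pverts ?B" using arcs by auto
    show "pverts ?B \<subseteq> pverts ?G" using sub by blast
    show "pair_wf_digraph ?G" using wfG by (simp add: pair_fin_digraph_def)
    show "pair_wf_digraph ?B" using pair_fin_digraph_box by (simp add: pair_fin_digraph_def)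
  qed (use closed digraph_connected_box in blast)+
  then show ?thesis by blast
qed

text \<open>Arrows raise p + q by one, so a node of the component where p + q is maximal is a
  sink.\<close>

lemma component_is_box:
  assumes W: "vec.subspace W" "stable {e1, e2, f1, f2} W"
    and mf: "\<And>u v w. v \<in> W \<inter> E u \<Longrightarrow> v \<noteq> 0 \<Longrightarrow> w \<in> W \<inter> E u \<Longrightarrow> \<exists>c. w = c *s v"
    and C: "C \<in> components_of (graph_on W)"
  shows "\<exists>m n. C = box_graph m n"
proof -
  let ?G = "graph_on W"
  interpret G: pair_fin_digraph ?G using wf_graph_on W by (auto simp: stable_def)
  obtain u where u: "u \<in> pverts ?G" "C = component_at ?G u"
    using C unfolding components_of_conv_component_at[OF G.pair_wf_digraph_axioms] by blast
  note closed = closed_component_at[OF G.pair_wf_digraph_axioms u(1)]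
  have arcs: "parcs C = parcs ?G \<inter> pverts C \<times> pverts C"
    unfolding u(2) by (simp add: component_at_def Let_def)
  have sub: "pverts C \<subseteq> pverts ?G"
    using subgraph_component_at[OF G.pair_wf_digraph_axioms u(1)] unfolding u(2) by (auto simp: subgraph_def)
  have "finite (pverts C)" using sub G.pair_finite_verts by (rule finite_subset)
  moreover have "u \<in> pverts C" unfolding u(2) by (simp add: component_at_def Let_def)
  ultimately have "Max ((\<lambda>a. fst a + snd a) ` pverts C) \<in> (\<lambda>a. fst a + snd a) ` pverts C"
    by (intro Max_in) auto
  then obtain w where w: "w \<in> pverts C" "Max ((\<lambda>a. fst a + snd a) ` pverts C) = fst w + snd w"
    by blast
  have wmax: "fst a + snd a \<le> fst w + snd w" if "a \<in> pverts C" for a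
    unfolding w(2)[symmetric] using that \<open>finite (pverts C)\<close> by (intro Max_ge) auto
  have sink: "(w, w') \<notin> parcs ?G" for w'
  proof
    assume ww: "(w, w') \<in> parcs ?G"
    then have "w' \<in> pverts C" using closed w(1) unfolding u(2) by blast
    moreover have "w' = w + (1, 0) \<or> w' = w + (0, 1)" using ww by (auto simp: in_parcs_attached_graph_iff)
    ultimately show False using wmax[of w'] by auto
  qed
  have "component_at ?G w = C"
    using closed connected_component_at[OF G.pair_wf_digraph_axioms u(1)]
      wf_component_at[OF G.pair_wf_digraph_axioms u(1)] arcs sub w(1)
    unfolding u(2) by (intro component_at_eqI[OF G.pair_wf_digraph_axioms])
  moreover have "w \<in> pverts ?G" using w(1) sub by blast
  then have "\<exists>m n. component_at ?G w = box_graph m n"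
    using W mf sink by (intro component_at_sink_is_box) blast+
  ultimately show ?thesis by simp
qed

end

section \<open>Lowering operators from box components\<close>

context bigraded
begin

lemma diagonal_mult: "v \<in> E u \<Longrightarrow> (\<Sum>u\<in>S. mscale (c u) (P u)) *v v = c u *s v"
proof -
  assume v: "v \<in> E u"
  have "(\<Sum>w\<in>S. mscale (c w) (P w)) *v v = (\<Sum>w\<in>S. if w = u then c u *s v else 0)"
    unfolding sum_mult_vec using P_same[OF v] P_other[OF v]
    by (intro sum.cong) (auto simp: mult_vec_simps)
  also have "\<dots> = c u *s v"
    using finite_S E_zero[OF _ v] by (cases "u \<in> S") auto
  finally show ?thesis .
qed

text \<open>\<open>c\<close> prescribes the eigenvalues of \<open>e f\<close>.  A linear pseudo-inverse of \<open>e\<close>, made homogeneous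
  and composed with the diagonal matrix of \<open>c\<close>, is the required \<open>f\<close>.\<close>

lemma lowering_operator_exists:
  assumes e: "has_degree (1, 0) e" and \<pi>: "has_degree (0, 0) \<pi>" "\<pi> ** \<pi> = \<pi>" "bracket e \<pi> = 0"
    and mf: "\<And>u v w. v \<in> E u \<Longrightarrow> \<pi> *v v = v \<Longrightarrow> v \<noteq> 0 \<Longrightarrow> w \<in> E u \<Longrightarrow> \<pi> *v w = w \<Longrightarrow> \<exists>k. w = k *s v"
    and c: "\<And>p q v. v \<in> E (p, q) \<Longrightarrow> \<pi> *v v = v \<Longrightarrow> v \<noteq> 0 \<Longrightarrow>
      c (p, q) = 0 \<or> (\<exists>w\<in>E (p - 1, q). \<pi> *v w = w \<and> e *v w \<noteq> 0)"
    "\<And>p q v. v \<in> E (p, q) \<Longrightarrow> \<pi> *v v = v \<Longrightarrow> v \<noteq> 0 \<Longrightarrow>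
      if e *v v = 0 then c (p, q) = 2 * p else c (p + 1, q) = c (p, q) - 2 * p"
  shows "\<exists>f. has_degree (- 1, 0) f \<and> bracket e f = mscale 2 (h1 ** \<pi>)"
proof -
  have \<pi>e: "\<pi> ** e = e ** \<pi>" using \<pi>(3) by (simp add: bracket_def)
  have \<pi>ev: "\<pi> *v (e *v v) = e *v (\<pi> *v v)" for v by (metis \<pi>e matrix_vector_mul_assoc)
  have \<pi>\<pi>: "\<pi> *v (\<pi> *v v) = \<pi> *v v" for v by (metis \<pi>(2) matrix_vector_mul_assoc)
  obtain g0 where g0: "Vector_Spaces.linear (*s) (*s) g0" "\<And>v. e *v g0 (e *v v) = e *v v"
    using vec.linear_exists_right_inverse_on[OF matrix_vector_mul_linear_gen[of e] vec.subspace_UNIV] by auto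
  \<comment> \<open>Composing with \<open>\<pi>\<close> on both sides confines the pseudo-inverse to
    the fixed space of \<open>\<pi>\<close>.\<close>
  define X where "X = \<pi> ** matrix g0 ** \<pi>"
  define g where "g = hom_part (- 1, 0) X"
  have "e ** matrix g0 ** e = e"
    by (simp add: matrix_eq matrix_vector_mul_assoc[symmetric] matrix_works g0)
  then have "e ** X ** e = \<pi> ** e"
    unfolding X_def by (metis \<pi>(2) \<pi>e matrix_mul_assoc)
  moreover have "hom_part (1, 0) (e ** X ** e) = e ** g ** e"
    using hom_part_mult_right[OF e, of "(0, 0)" "e ** X"] hom_part_mult_left[OF e, of "(- 1, 0)" X]
    by (simp add: g_def zero_prod_def[symmetric])
  moreover have "hom_part (1, 0) (\<pi> ** e) = \<pi> ** e"
    using has_degree_mult[OF \<pi>(1) e] by (intro hom_part_same) simp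
  ultimately have "e ** g ** e = \<pi> ** e" by simp
  then have ege: "e *v (g *v (e *v v)) = \<pi> *v (e *v v)" for v by (metis matrix_vector_mul_assoc)
  have "\<pi> ** X = X" unfolding X_def by (metis \<pi>(2) matrix_mul_assoc)
  then have "\<pi> ** g = g"
    using hom_part_mult_left[OF \<pi>(1), of "(- 1, 0)" X] by (simp add: g_def)
  then have \<pi>g: "\<pi> *v (g *v v) = g *v v" for v by (metis matrix_vector_mul_assoc)
  have g: "has_degree (- 1, 0) g" unfolding g_def by (rule has_degree_hom_part)
  define D where "D = (\<Sum>u\<in>S. mscale (of_rat (c u)) (P u))"
  have D: "D *v v = of_rat (c u) *s v" if "v \<in> E u" for u v
    unfolding D_def using that by (rule diagonal_mult)
  have degD: "has_degree (0, 0) D"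
    by (rule has_degreeI) (simp add: D zero_prod_def[symmetric] vec.subspace_scale subspace_eigenspace)
  \<comment> \<open>\<open>D\<close> acts before \<open>g\<close>, so \<open>c\<close> is evaluated
    at the weight of the argument, and on fixed vectors of weight \<open>u\<close> the product
    \<open>e f\<close> is \<open>c u\<close> times \<open>e g\<close>.\<close>
  define f where "f = g ** D ** \<pi>"
  have "has_degree (- 1, 0) f"
    unfolding f_def using has_degree_mult[OF has_degree_mult[OF g degD] \<pi>(1)] by simp
  moreover have "bracket e f = mscale 2 (h1 ** \<pi>)"
  proof (rule matrix_eqI)
    fix u v assume v: "v \<in> E u"
    obtain p q where u: "u = (p, q)" by fastforce
    define w where "w = \<pi> *v v"
    have w: "w \<in> E (p, q)" "\<pi> *v w = w" using has_degreeD[OF \<pi>(1) v] by (simp_all add: w_def u \<pi>\<pi>)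
    have ew: "e *v w \<in> E (p + 1, q)" "\<pi> *v (e *v w) = e *v w"
      using has_degreeD[OF e w(1)] by (simp_all add: \<pi>ev w(2))
    have fv: "f *v v = of_rat (c (p, q)) *s (g *v w)"
      using D[OF w(1)] by (simp add: f_def matrix_vector_mul_assoc[symmetric] w_def[symmetric] vector_scalar_commute)
    have fe: "f *v (e *v v) = of_rat (c (p + 1, q)) *s (g *v (e *v w))"
      using D[OF ew(1)] by (simp add: f_def matrix_vector_mul_assoc[symmetric] w_def[symmetric] \<pi>ev vector_scalar_commute)
    have rhs: "mscale 2 (h1 ** \<pi>) *v v = of_rat (2 * p) *s w"
      using w(1) by (simp add: mult_vec_simps w_def[symmetric] eigenspace_iff of_rat_mult)
    have "of_rat (c (p, q)) *s (e *v (g *v w)) - of_rat (c (p + 1, q)) *s (g *v (e *v w)) = of_rat (2 * p) *s w"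
    proof (cases "w = 0")
      case False
      \<comment> \<open>Where \<open>c\<close> does not vanish an arrow comes in; by multiplicity
        one \<open>w\<close> then lies in the image under \<open>e\<close> of the fixed space, where
        \<open>e g\<close> is the identity.\<close>
      have 1: "of_rat (c (p, q)) *s (e *v (g *v w)) = of_rat (c (p, q)) *s w"
      proof (cases "c (p, q) = 0")
        case nz: False
        then obtain w' where w': "w' \<in> E (p - 1, q)" "\<pi> *v w' = w'" "e *v w' \<noteq> 0"
          using c(1)[OF w False] by blast
        have "e *v w' \<in> E (p, q)" using has_degreeD[OF e w'(1)] by simp
        then obtain k where k: "w = k *s (e *v w')"
          using mf[of "e *v w'" "(p, q)" w] w w' by (auto simp: \<pi>ev)
        have "e *v (g *v w) = w" by (simp add: k vector_scalar_commute ege \<pi>ev w'(2))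
        then show ?thesis by simp
      qed simp
      show ?thesis
      proof (cases "e *v w = 0")
        case True
        then show ?thesis using c(2)[OF w False] 1 by simp
      next
        case ne: False
        \<comment> \<open>Multiplicity one makes \<open>g e\<close> a scalar on \<open>w\<close>,
          and \<open>e g e = e\<close> on fixed vectors forces that scalar to be 1. The bracket is
          then c(p, q) - c(p + 1, q) = 2p.\<close>
        have "g *v (e *v w) \<in> E (p, q)" using has_degreeD[OF g ew(1)] by simp
        then obtain k where k: "g *v (e *v w) = k *s w"
          using mf[OF w False] \<pi>g by blast
        have "e *v w = k *s (e *v w)"
          using ege[of w] unfolding k ew(2) by (simp add: vector_scalar_commute)
        then have "k = 1" using ne scaled_eq_imp_zero[of 1 "e *v w" k] by auto
        moreover have "c (p + 1, q) = c (p, q) - 2 * p" using c(2)[OF w False] ne by (simp only: if_False)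
        ultimately show ?thesis unfolding 1 k
          by (simp only: of_rat_diff vec.scale_left_diff_distrib vec.scale_one) simp
      qed
    qed simp
    then show "bracket e f *v v = mscale 2 (h1 ** \<pi>) *v v"
      unfolding rhs bracket_mult_vec fe fv by (simp add: vector_scalar_commute)
  qed
  ultimately show ?thesis by blast
qed

end

context bigraded_pair
begin

text \<open>Each node lies in one box, whose sides tell which irreducible module to imitate; the
  eigenvalues of \<open>e1 f1\<close> and \<open>e2 f2\<close> are copied from it. The projection
  \<open>\<pi>\<close> lets the whole space and its pieces be treated alike.\<close>

lemma lowering_operators_from_boxes:
  assumes \<pi>: "has_degree (0, 0) \<pi>" "\<pi> ** \<pi> = \<pi>" "bracket e1 \<pi> = 0" "bracket e2 \<pi> = 0"
    and W: "W = {v. \<pi> *v v = v}"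
    and mf: "\<And>u v w. v \<in> W \<inter> E u \<Longrightarrow> v \<noteq> 0 \<Longrightarrow> w \<in> W \<inter> E u \<Longrightarrow> \<exists>c. w = c *s v"
    and boxes: "\<And>C. C \<in> components_of (graph_on W) \<Longrightarrow> \<exists>m n. C = box_graph m n"
  shows "\<exists>f. has_degree (- 1, 0) f \<and> bracket e1 f = mscale 2 (h1 ** \<pi>)"
    and "\<exists>f. has_degree (0, - 1) f \<and> bracket e2 f = mscale 2 (h2 ** \<pi>)"
proof -
  let ?G = "graph_on W"
  have subW: "vec.subspace W" unfolding W by (auto simp: vec.subspace_def mult_vec_simps)
  have "\<pi> *v (e *v v) = e *v (\<pi> *v v)" if "e \<in> {e1, e2}" for e v
    using that \<pi>(3,4) bracket_mult_vec[of e1 \<pi> v] bracket_mult_vec[of e2 \<pi> v] by auto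
  then have stW: "stable {e1, e2} W" unfolding W stable_def by simp
  interpret G: pair_fin_digraph ?G by (rule wf_graph_on[OF subW stW])
  note wf = G.pair_wf_digraph_axioms
  \<comment> \<open>\<open>M\<close> and \<open>N\<close> see \<open>u\<close> only through its
    component, hence are constant along arrows.\<close>
  define M where "M u = (SOME m. \<exists>n. component_at ?G u = box_graph m n)" for u
  define N where "N u = (SOME n. \<exists>m. component_at ?G u = box_graph m n)" for u
  have node: "u \<in> pverts ?G \<longleftrightarrow> (\<exists>v\<in>E u. \<pi> *v v = v \<and> v \<noteq> 0)" for u
  proof -
    have "x \<in> W \<longleftrightarrow> \<pi> *v x = x" for x by (simp add: W)
    then show ?thesis unfolding in_pverts_iff[OF subW] by auto
  qed
  have MN: "\<exists>n. component_at ?G u = box_graph (M u) n" "\<exists>m. component_at ?G u = box_graph m (N u)"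
    if u: "u \<in> pverts ?G" for u
  proof -
    have "\<exists>m n. component_at ?G u = box_graph m n"
      by (rule boxes) (use u in \<open>simp add: components_of_conv_component_at[OF wf]\<close>)
    then show "\<exists>n. component_at ?G u = box_graph (M u) n" "\<exists>m. component_at ?G u = box_graph m (N u)"
      unfolding M_def N_def by (metis (mono_tags, lifting) someI_ex)+
  qed
  have self: "u \<in> pverts (component_at ?G u)" for u by (simp add: component_at_def Let_def)
  have arcs_sub: "parcs (component_at ?G u) \<subseteq> parcs ?G" for u by (auto simp: component_at_def Let_def)
  have same: "component_at ?G u' = component_at ?G u" if uu: "(u, u') \<in> parcs ?G" for u u'
  proof (rule component_at_eqI[OF wf])
    have u: "u \<in> pverts ?G" using uu by (rule G.in_arcsD1)
    show "pverts (component_at ?G u) \<subseteq> pverts ?G"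
      using subgraph_component_at[OF wf u] by (auto simp: subgraph_def)
    show "pair_wf_digraph (component_at ?G u)" "digraph_connected (component_at ?G u)"
      by (rule wf_component_at[OF wf u], rule connected_component_at[OF wf u])
    show "parcs (component_at ?G u) = parcs ?G \<inter> pverts (component_at ?G u) \<times> pverts (component_at ?G u)"
      by (simp add: component_at_def Let_def)
    show "(a, b) \<in> parcs ?G \<Longrightarrow> (a \<in> pverts (component_at ?G u)) = (b \<in> pverts (component_at ?G u))" for a b
      by (rule closed_component_at[OF wf u])
    show "u' \<in> pverts (component_at ?G u)" using closed_component_at[OF wf u uu] self by blast
  qed
  have nodeI: "(p, q) \<in> pverts ?G" if "v \<in> E (p, q)" "\<pi> *v v = v" "v \<noteq> 0" for p q v
    using that node by blast
  have mult: "\<exists>k. w = k *s v" if "v \<in> E u" "\<pi> *v v = v" "v \<noteq> 0" "w \<in> E u" "\<pi> *v w = w" for u v w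
    using mf[of v u w] that unfolding W by blast
  have arc1: "(u, u + (1, 0)) \<in> parcs ?G \<longleftrightarrow> (\<exists>w\<in>E u. \<pi> *v w = w \<and> e1 *v w \<noteq> 0)"
    and arc2: "(u, u + (0, 1)) \<in> parcs ?G \<longleftrightarrow> (\<exists>w\<in>E u. \<pi> *v w = w \<and> e2 *v w \<noteq> 0)" for u
    by (auto simp: in_parcs_attached_graph_iff W)
  have arc1': "(u, u + (1, 0)) \<in> parcs ?G \<longleftrightarrow> e1 *v v \<noteq> 0"
    and arc2': "(u, u + (0, 1)) \<in> parcs ?G \<longleftrightarrow> e2 *v v \<noteq> 0"
    if v: "v \<in> E u" "\<pi> *v v = v" "v \<noteq> 0" for u v
    unfolding arc1 arc2 using mult[OF v] v by (metis vector_scalar_commute vec.scale_zero_right)+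
  have box1: "p = - of_nat m / 2 \<or> ((p - 1, q), (p, q)) \<in> parcs (box_graph m n)"
     "p = of_nat m / 2 \<or> ((p, q), (p + 1, q)) \<in> parcs (box_graph m n)"
    if pq: "(p, q) \<in> pverts (box_graph m n)" for p q m n
  proof -
    obtain i j where i: "i \<le> m" "p = of_nat i - of_nat m / 2" and j: "j \<le> n" "q = of_nat j - of_nat n / 2"
      using pq unfolding in_pverts_box_iff by blast
    show "p = - of_nat m / 2 \<or> ((p - 1, q), (p, q)) \<in> parcs (box_graph m n)"
    proof (cases i)
      case (Suc k)
      then have "(p - 1, q) \<in> pverts (box_graph m n)"
        using i j unfolding in_pverts_box_iff by (auto intro!: exI[of _ k])
      then show ?thesis using pq by (simp add: parcs_box)
    qed (use i in simp)
    show "p = of_nat m / 2 \<or> ((p, q), (p + 1, q)) \<in> parcs (box_graph m n)"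
    proof (cases "i = m")
      case False
      then have "(p + 1, q) \<in> pverts (box_graph m n)"
        using i j unfolding in_pverts_box_iff by (auto intro!: exI[of _ "Suc i"])
      then show ?thesis using pq by (simp add: parcs_box)
    qed (use i in simp)
  qed
  have box2: "q = - of_nat n / 2 \<or> ((p, q - 1), (p, q)) \<in> parcs (box_graph m n)"
     "q = of_nat n / 2 \<or> ((p, q), (p, q + 1)) \<in> parcs (box_graph m n)"
    if pq: "(p, q) \<in> pverts (box_graph m n)" for p q m n
  proof -
    obtain i j where i: "i \<le> m" "p = of_nat i - of_nat m / 2" and j: "j \<le> n" "q = of_nat j - of_nat n / 2"
      using pq unfolding in_pverts_box_iff by blast
    show "q = - of_nat n / 2 \<or> ((p, q - 1), (p, q)) \<in> parcs (box_graph m n)"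
    proof (cases j)
      case (Suc k)
      then have "(p, q - 1) \<in> pverts (box_graph m n)"
        using i j unfolding in_pverts_box_iff by (auto intro!: exI[of _ k])
      then show ?thesis using pq by (simp add: parcs_box)
    qed (use j in simp)
    show "q = of_nat n / 2 \<or> ((p, q), (p, q + 1)) \<in> parcs (box_graph m n)"
    proof (cases "j = n")
      case False
      then have "(p, q + 1) \<in> pverts (box_graph m n)"
        using i j unfolding in_pverts_box_iff by (auto intro!: exI[of _ "Suc j"])
      then show ?thesis using pq by (simp add: parcs_box)
    qed (use j in simp)
  qed
  \<comment> \<open>With r = m/2 this is the eigenvalue of \<open>e f\<close> on the line of weight
    p, measured by half of the neutral element, in the irreducible sl2-module of dimension m + 1. It
    vanishes at the lowest weight p = - r and equals 2p at the highest weight p = r.\<close>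
  define c :: "rat \<Rightarrow> rat \<Rightarrow> rat" where "c r p = (r + p) * (r + 1 - p)" for r p
  have c0: "c (of_nat k / 2) p = 0" if "p = - of_nat k / 2" for k p
    by (simp add: c_def that)
  have c_top: "c (of_nat k / 2) p = 2 * p" if "p = of_nat k / 2" for k p
    unfolding that by (simp add: c_def)
  have c_step: "c r (p + 1) = c r p - 2 * p" for r p
    by (simp add: c_def algebra_simps)
  show "\<exists>f. has_degree (- 1, 0) f \<and> bracket e1 f = mscale 2 (h1 ** \<pi>)"
  proof (rule lowering_operator_exists[OF degree_e1 \<pi>(1,2,3) mult, where c = "\<lambda>u. c (of_nat (M u) / 2) (fst u)"])
    fix p q v assume v: "v \<in> E (p, q)" "\<pi> *v v = v" "v \<noteq> 0"
    obtain n where n: "component_at ?G (p, q) = box_graph (M (p, q)) n" using MN(1)[OF nodeI[OF v]] by blast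
    have inb: "(p, q) \<in> pverts (box_graph (M (p, q)) n)" using self[of "(p, q)"] unfolding n .
    have sub: "parcs (box_graph (M (p, q)) n) \<subseteq> parcs ?G" using arcs_sub[of "(p, q)"] unfolding n .
    show "c (of_nat (M (p, q)) / 2) (fst (p, q)) = 0 \<or> (\<exists>w\<in>E (p - 1, q). \<pi> *v w = w \<and> e1 *v w \<noteq> 0)"
      using box1(1)[OF inb] sub arc1[of "(p - 1, q)"] c0[of p "M (p, q)"] by auto
    show "if e1 *v v = 0 then c (of_nat (M (p, q)) / 2) (fst (p, q)) = 2 * p
      else c (of_nat (M (p + 1, q)) / 2) (fst (p + 1, q)) = c (of_nat (M (p, q)) / 2) (fst (p, q)) - 2 * p"
    proof (cases "e1 *v v = 0")
      case True
      then have "((p, q), (p + 1, q)) \<notin> parcs ?G" using arc1'[OF v] by simp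
      then have "p = of_nat (M (p, q)) / 2" using box1(2)[OF inb] sub by blast
      then show ?thesis using True c_top[of p "M (p, q)"] by simp
    next
      case False
      then have "((p, q), (p + 1, q)) \<in> parcs ?G" using arc1'[OF v] by simp
      then have "M (p + 1, q) = M (p, q)" unfolding M_def using same by presburger
      then show ?thesis using False c_step by simp
    qed
  qed
  \<comment> \<open>The second operator comes from the same construction with the coordinates
    exchanged, which is why \<open>prod.swap\<close> enters the eigenvalue function.\<close>
  interpret swap: bigraded h2 h1 "P \<circ> prod.swap" "prod.swap ` S" by (rule bigraded_swap)
  have "\<exists>f. swap.has_degree (- 1, 0) f \<and> bracket e2 f = mscale 2 (h2 ** \<pi>)"
  proof (rule swap.lowering_operator_exists[where c = "\<lambda>u. c (of_nat (N (prod.swap u)) / 2) (fst u)"])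
    show "swap.has_degree (1, 0) e2" "swap.has_degree (0, 0) \<pi>"
      using degree_e2 \<pi>(1) by (simp_all add: has_degree_swap)
    show "\<exists>k. w = k *s v" if "v \<in> swap.E u" "\<pi> *v v = v" "v \<noteq> 0" "w \<in> swap.E u" "\<pi> *v w = w" for u v w
      using mult[of v "prod.swap u" w] that by (cases u) (simp add: eigenspace_swap)
    fix p q v assume "v \<in> swap.E (p, q)" "\<pi> *v v = v" "v \<noteq> 0"
    then have v: "v \<in> E (q, p)" "\<pi> *v v = v" "v \<noteq> 0" by (simp_all add: eigenspace_swap)
    obtain m where m: "component_at ?G (q, p) = box_graph m (N (q, p))" using MN(2)[OF nodeI[OF v]] by blast
    have inb: "(q, p) \<in> pverts (box_graph m (N (q, p)))" using self[of "(q, p)"] unfolding m .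
    have sub: "parcs (box_graph m (N (q, p))) \<subseteq> parcs ?G" using arcs_sub[of "(q, p)"] unfolding m .
    show "c (of_nat (N (prod.swap (p, q))) / 2) (fst (p, q)) = 0 \<or>
        (\<exists>w\<in>swap.E (p - 1, q). \<pi> *v w = w \<and> e2 *v w \<noteq> 0)"
      using box2(1)[OF inb] sub arc2[of "(q, p - 1)"] c0[of p "N (q, p)"] by (auto simp: eigenspace_swap)
    show "if e2 *v v = 0 then c (of_nat (N (prod.swap (p, q))) / 2) (fst (p, q)) = 2 * p
      else c (of_nat (N (prod.swap (p + 1, q))) / 2) (fst (p + 1, q)) =
        c (of_nat (N (prod.swap (p, q))) / 2) (fst (p, q)) - 2 * p"
    proof (cases "e2 *v v = 0")
      case True
      then have "((q, p), (q, p + 1)) \<notin> parcs ?G" using arc2'[OF v] by simp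
      then have "p = of_nat (N (q, p)) / 2" using box2(2)[OF inb] sub by blast
      then show ?thesis using True c_top[of p "N (q, p)"] by simp
    next
      case False
      then have "((q, p), (q, p + 1)) \<in> parcs ?G" using arc2'[OF v] by simp
      then have "N (q, p + 1) = N (q, p)" unfolding N_def using same by presburger
      then show ?thesis using False c_step by simp
    qed
  qed (use \<pi> in simp_all)
  then show "\<exists>f. has_degree (0, - 1) f \<and> bracket e2 f = mscale 2 (h2 ** \<pi>)"
    by (simp add: has_degree_swap)
qed

end

section \<open>Invariant bilinear forms\<close>

lemma trace_bracket: "trace (bracket X Y) = 0"
  by (simp add: bracket_def trace_sub trace_mul_sym[of X Y])

lemma trace_mscale: "trace (mscale c X) = c * trace X"
  by (simp add: trace_def mscale_def sum_distrib_left)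

locale nondegenerate =
  fixes B :: "('k::field_char_0, 'n::finite) form"
  assumes nondegenerate: "nondegenerate_form B"
begin

lemma linear_left: "Vector_Spaces.linear (*s) (*) (\<lambda>v. B v w)"
  and linear_right: "Vector_Spaces.linear (*s) (*) (B v)"
  using nondegenerate by (simp_all add: nondegenerate_form_def)

lemma form_simps:
  "B (v + v') w = B v w + B v' w" "B v (w + w') = B v w + B v w'"
  "B (v - v') w = B v w - B v' w" "B v (w - w') = B v w - B v w'"
  "B (- v) w = - B v w" "B v (- w) = - B v w"
  "B (c *s v) w = c * B v w" "B v (c *s w) = c * B v w"
  "B 0 w = 0" "B v 0 = 0"
proof -
  interpret l: Vector_Spaces.linear "(*s)" "(*)" "\<lambda>v. B v w" for w by (rule linear_left)
  interpret r: Vector_Spaces.linear "(*s)" "(*)" "B v" for v by (rule linear_right)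
  show "B (v + v') w = B v w + B v' w" "B v (w + w') = B v w + B v w'"
    "B (v - v') w = B v w - B v' w" "B v (w - w') = B v w - B v w'"
    "B (- v) w = - B v w" "B v (- w) = - B v w"
    "B (c *s v) w = c * B v w" "B v (c *s w) = c * B v w"
    "B 0 w = 0" "B v 0 = 0"
    by (simp_all add: l.add r.add l.diff r.diff l.neg r.neg l.scale r.scale l.zero r.zero)
qed

lemma form_sum_right: "B v (\<Sum>i\<in>I. w i) = (\<Sum>i\<in>I. B v (w i))"
  by (induct I rule: infinite_finite_induct) (simp_all add: form_simps)

lemma form_eqI: "(\<And>w. B v w = B v' w) \<Longrightarrow> v = v'"
proof -
  assume "\<And>w. B v w = B v' w"
  then have "\<forall>w. B (v - v') w = 0" by (simp add: form_simps)
  then have "v - v' = 0" using nondegenerate unfolding nondegenerate_form_def by blast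
  then show "v = v'" by simp
qed

text \<open>\<open>T\<close> sends \<open>v\<close> to the coordinates of the functional
  \<open>B v\<close>. Nondegeneracy makes it injective, hence surjective by dimension, and the
  adjoint is found by solving for the vector that represents the functional taking w to
  \<open>B v (X *v w)\<close>.\<close>

lemma adjoint_exists: "\<exists>Y. \<forall>v w. B (Y *v v) w = B v (X *v w)"
proof -
  define T where "T v = (\<chi> i. B v (axis i 1))" for v
  have expand: "B v w = (\<Sum>i\<in>UNIV. w $ i * T v $ i)" for v w
  proof -
    have "B v w = B v (\<Sum>i\<in>UNIV. (w $ i) *s axis i 1)" by (simp add: basis_expansion)
    then show ?thesis by (simp add: form_sum_right form_simps T_def)
  qed
  have T: "Vector_Spaces.linear (*s) (*s) T"
    by unfold_locales (simp_all add: T_def vec_eq_iff form_simps)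
  have "inj T"
  proof (rule injI)
    fix v v' assume "T v = T v'"
    then show "v = v'" by (intro form_eqI) (simp add: expand)
  qed
  then have "surj T" by (rule vec.linear_inj_imp_surj[OF T])
  then obtain T' where T': "Vector_Spaces.linear (*s) (*s) T'" "\<And>y. T (T' y) = y"
    using vec.linear_surj_right_inverse[OF T, of UNIV UNIV] by auto
  define g where "g v = T' (\<chi> i. B v (X *v axis i 1))" for v
  interpret T': Vector_Spaces.linear "(*s)" "(*s)" T' by (rule T'(1))
  have "Vector_Spaces.linear (*s) (*s) g"
  proof unfold_locales
    fix v v' c
    have "(\<chi> i. B (v + v') (X *v axis i 1)) = (\<chi> i. B v (X *v axis i 1)) + (\<chi> i. B v' (X *v axis i 1))"
      "(\<chi> i. B (c *s v) (X *v axis i 1)) = c *s (\<chi> i. B v (X *v axis i 1))"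
      by (simp_all add: vec_eq_iff form_simps)
    then show "g (v + v') = g v + g v'" "g (c *s v) = c *s g v"
      by (simp_all add: g_def T'.add T'.scale)
  qed
  then have g: "matrix g *v v = g v" for v by (rule matrix_works)
  have "B (g v) w = B v (X *v w)" for v w
  proof -
    have "B (g v) w = (\<Sum>i\<in>UNIV. w $ i * B v (X *v axis i 1))"
      using expand[of "g v" w] by (simp add: g_def T'(2))
    also have "\<dots> = B v (X *v (\<Sum>i\<in>UNIV. (w $ i) *s axis i 1))"
      by (simp only: mult_vec_sum form_sum_right vector_scalar_commute form_simps)
    finally show ?thesis by (simp add: basis_expansion)
  qed
  then show ?thesis using g by metis
qed

lemma skewD: "X \<in> skew_adjoint B \<Longrightarrow> B (X *v v) w = - B v (X *v w)"
  unfolding skew_adjoint_def by (simp add: eq_neg_iff_add_eq_0)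

text \<open>Reversing the product and moving the skew matrix \<open>X\<close> across the form each
  contribute a sign, and the two cancel: taking adjoints commutes with \<open>ad X\<close>.\<close>

lemma adjoint_bracket:
  assumes "X \<in> skew_adjoint B" "\<And>v w. B (Y' *v v) w = B v (Y *v w)"
  shows "B (bracket X Y' *v v) w = B v (bracket X Y *v w)"
  by (simp add: bracket_mult_vec form_simps skewD[OF assms(1)] assms(2))

end

locale bigraded_form = bigraded h1 h2 P S + nondegenerate B
  for h1 h2 :: "'k::field_char_0^'n^'n" and P S B +
  assumes h_skew: "h1 \<in> skew_adjoint B" "h2 \<in> skew_adjoint B"
begin

text \<open>Moving \<open>h1\<close> or \<open>h2\<close> across the form shows that
  \<open>B v w\<close> is annihilated by the sum of the corresponding coordinates of the two
  weights.\<close>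

lemma form_orthogonal:
  assumes v: "v \<in> E u" and w: "w \<in> E u'" and ne: "u' \<noteq> - u"
  shows "B v w = 0"
proof -
  obtain p q p' q' where u: "u = (p, q)" "u' = (p', q')" by fastforce
  have "(of_rat p + of_rat p') * B v w = 0" "(of_rat q + of_rat q') * B v w = 0"
    using skewD[OF h_skew(1), of v w] skewD[OF h_skew(2), of v w] v w
    unfolding u eigenspace_iff by (auto simp: form_simps distrib_right eq_neg_iff_add_eq_0)
  moreover have "p + p' \<noteq> 0 \<or> q + q' \<noteq> 0" using ne by (auto simp: u eq_neg_iff_add_eq_0 add.commute)
  ultimately show ?thesis by (auto simp flip: of_rat_add)
qed

lemma form_component: "v \<in> E u \<Longrightarrow> B v (P (- u) *v w) = B v w"
  and form_component': "v \<in> E u \<Longrightarrow> B (P (- u) *v w) v = B w v"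
proof -
  assume v: "v \<in> E u"
  have l: "B (\<Sum>i\<in>I. g i) v = (\<Sum>i\<in>I. B (g i) v)" for I and g :: "_ \<Rightarrow> 'k^'n"
    by (induct I rule: infinite_finite_induct) (simp_all add: form_simps)
  have nz: "P (- u) *v w = 0" if "- u \<notin> S" using E_zero[OF that P_in] .
  have "B v w = (\<Sum>u'\<in>S. B v (P u' *v w))" by (simp only: form_sum_right[symmetric] sum_P)
  also have "\<dots> = (\<Sum>u'\<in>S. if u' = - u then B v (P u' *v w) else 0)"
    using form_orthogonal[OF v P_in] by (intro sum.cong) auto
  finally show "B v (P (- u) *v w) = B v w" using finite_S nz by (auto simp: form_simps split: if_splits)
  have "B w v = (\<Sum>u'\<in>S. B (P u' *v w) v)" by (simp only: l[symmetric] sum_P)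
  also have "\<dots> = (\<Sum>u'\<in>S. if u' = - u then B (P u' *v w) v else 0)"
    by (intro sum.cong) (auto intro!: form_orthogonal[OF P_in v])
  finally show "B (P (- u) *v w) v = B w v" using finite_S nz by (auto simp: form_simps split: if_splits)
qed

lemma form_nonzero: "v \<in> E u \<Longrightarrow> v \<noteq> 0 \<Longrightarrow> \<exists>w\<in>E (- u). B v w \<noteq> 0"
  using form_eqI[of v 0] form_component P_in by (metis form_simps(9))

text \<open>For weight vectors, both terms vanish unless \<open>d\<close> and the weights of
  \<open>v\<close> and \<open>w\<close> add up to zero. In that case the projections inside the
  component do not change the pairings, and the identity for \<open>X\<close> carries over.\<close>

lemma hom_part_skew: "X \<in> skew_adjoint B \<Longrightarrow> hom_part d X \<in> skew_adjoint B"
proof -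
  assume X: "X \<in> skew_adjoint B"
  let ?Y = "hom_part d X"
  have hom: "B (?Y *v v) w + B v (?Y *v w) = 0" if v: "v \<in> E u" and w: "w \<in> E u'" for u u' v w
  proof (cases "u' = - (u + d)")
    case True
    then have neg: "u + d = - u'" "u' + d = - u" by simp_all
    have "B (?Y *v v) w = B (X *v v) w"
      unfolding hom_part_mult[OF v] neg by (rule form_component'[OF w])
    moreover have "B v (?Y *v w) = B v (X *v w)"
      unfolding hom_part_mult[OF w] neg by (rule form_component[OF v])
    ultimately show ?thesis by (simp add: skewD[OF X])
  next
    case False
    have "u' + d \<noteq> - u"
    proof
      assume "u' + d = - u"
      then have "u' = - u - d" by (simp only: eq_diff_eq)
      also have "- u - d = - (u + d)" by simp
      finally show False using False by simp
    qed
    with False have "u' \<noteq> - (u + d)" "u' + d \<noteq> - u" by blast+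
    then show ?thesis
      using form_orthogonal[OF has_degreeD[OF has_degree_hom_part v] w]
        form_orthogonal[OF v has_degreeD[OF has_degree_hom_part w]] by simp
  qed
  have sub: "vec.subspace {w. B (?Y *v v) w + B v (?Y *v w) = 0}"
    "vec.subspace {v. B (?Y *v v) w + B v (?Y *v w) = 0}" for v w
    by (auto simp: vec.subspace_def mult_vec_simps form_simps distrib_left[symmetric]
        add.assoc add.left_commute add_eq_0_iff)
  have left: "w \<in> {w. B (?Y *v v) w + B v (?Y *v w) = 0}" if "v \<in> E u" for u v w
    by (rule E_decomp[OF _ sub(1)]) (use hom[OF that P_in] in simp)
  have "v \<in> {v. B (?Y *v v) w + B v (?Y *v w) = 0}" for v w
    by (rule E_decomp[OF _ sub(2)]) (use left[OF P_in] in simp)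
  then show ?thesis unfolding skew_adjoint_def by blast
qed

text \<open>The negative adjoint of \<open>f\<close> completes \<open>e\<close> and \<open>h\<close> to the same triple, so it equals \<open>f\<close>.\<close>

lemma lowering_skew:
  assumes e: "e \<in> skew_adjoint B" and h: "h \<in> skew_adjoint B"
    and ef: "bracket e f = mscale 2 h" and hf: "bracket h f = mscale (- 1) f"
    and f: "has_degree d f" "d \<noteq> (0, 0)"
  shows "f \<in> skew_adjoint B"
proof -
  obtain f' where f': "\<And>v w. B (f' *v v) w = B v (f *v w)" using adjoint_exists by blast
  note adj = adjoint_bracket[OF _ f']
  have scaled: "bracket x f' = mscale c f'" if "x \<in> skew_adjoint B" "bracket x f = mscale c f" for x c
    unfolding matrix_eq
    by (intro allI form_eqI) (simp add: adj[OF that(1)] that(2) mscale_mult_vec form_simps f')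
  have ef': "bracket e f' = - mscale 2 h"
    unfolding matrix_eq
    by (intro allI form_eqI) (simp add: adj[OF e] ef mscale_mult_vec minus_mult_vec form_simps skewD[OF h])
  have "has_degree d f'" using f(1) scaled h_skew unfolding has_degree_iff by blast
  then have "has_degree d (f + f')"
    using f(1) by (auto simp: has_degree_def mult_vec_simps vec.subspace_add subspace_eigenspace)
  moreover have add: "bracket x (f + f') = bracket x f + bracket x f'" for x
    by (simp add: matrix_eq mult_vec_simps)
  have "bracket e (f + f') = 0" unfolding add ef ef' by simp
  moreover have "bracket h (f + f') = mscale (- 1) (f + f')"
    unfolding add hf scaled[OF h hf] by (simp add: matrix_eq mult_vec_simps)
  ultimately have "f + f' = 0" by (rule sl2_negative_highest_weight[OF ef hf f])
  then have "f *v v + f' *v v = 0" for v by (metis matrix_vector_mult_0 matrix_vector_mult_add_rdistrib)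
  then have "B (f *v v) w + B (f' *v v) w = 0" for v w by (simp only: form_simps(1)[symmetric] form_simps(9))
  then show ?thesis by (simp add: skew_adjoint_def f')
qed

end

section \<open>Rectangular pairs and lowering operators of a fixed bidegree\<close>

lemma classical_subalgebra:
  assumes "classical_simple \<gg>"
  shows "mat_space.subspace \<gg>" "x \<in> \<gg> \<Longrightarrow> y \<in> \<gg> \<Longrightarrow> bracket x y \<in> \<gg>"
  using assms by (auto simp: classical_simple_def lie_simple_def lie_subalgebra_def)

lemma classical_cases:
  assumes "classical_simple \<gg>"
  obtains "\<gg> = {X. trace X = 0}" | B where "nondegenerate_form B" "\<gg> = skew_adjoint B"
  using assms by (auto simp: classical_simple_def is_sl_def is_so_def is_sp_def)

text \<open>\<open>degree_0_semisimple\<close> isolates what depends on the multiplicities of the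
  weights; it is established separately for the two kinds of skew-graphs.\<close>

locale distinguished_setting = bigraded_pair h1 h2 P S e1 e2
  for h1 h2 :: "'k::field_char_0^'n^'n" and P S e1 e2 +
  fixes \<gg> :: "('k^'n^'n) set"
  assumes classical: "classical_simple \<gg>"
    and in_alg: "h1 \<in> \<gg>" "h2 \<in> \<gg>" "e1 \<in> \<gg>" "e2 \<in> \<gg>"
    and pre: "pre_distinguished \<gg> e1 e2"
    and degree_0_semisimple: "\<And>X. X \<in> \<gg> \<Longrightarrow> has_degree (0, 0) X \<Longrightarrow> semisimple_elt X"
begin

lemma degree_0_centralizer:
  assumes "X \<in> \<gg>" "has_degree (0, 0) X" "bracket e1 X = 0" "bracket e2 X = 0"
  shows "X = 0"
proof -
  have "X \<in> centralizer \<gg> {e1, e2}"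
    using assms by (simp add: centralizer_def bracket_antisym[of X])
  then show ?thesis using pre degree_0_semisimple assms by (auto simp: pre_distinguished_def)
qed

text \<open>A matrix of nonzero degree is a nonzero multiple of its bracket with \<open>h1\<close>
  or \<open>h2\<close>.\<close>

lemma trace_degree: "has_degree d X \<Longrightarrow> d \<noteq> (0, 0) \<Longrightarrow> trace X = 0"
proof -
  assume X: "has_degree d X" "d \<noteq> (0, 0)"
  have "of_rat (fst d) * trace X = 0" "of_rat (snd d) * trace X = 0"
    using X(1) unfolding has_degree_iff by (metis trace_bracket trace_mscale)+
  then show ?thesis using X(2) by (auto simp: prod_eq_iff)
qed

lemma hom_part_in: "X \<in> \<gg> \<Longrightarrow> d \<noteq> (0, 0) \<Longrightarrow> hom_part d X \<in> \<gg>"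
proof (rule classical_cases[OF classical])
  assume "\<gg> = {X. trace X = 0}" "d \<noteq> (0, 0)"
  then show ?thesis using trace_degree[OF has_degree_hom_part] by simp
next
  fix B assume B: "nondegenerate_form B" "\<gg> = skew_adjoint B" and X: "X \<in> \<gg>"
  interpret bigraded_form h1 h2 P S B by unfold_locales (use B in_alg in auto)
  show ?thesis using hom_part_skew X B by simp
qed

lemma lowering_in:
  assumes "e \<in> \<gg>" "h \<in> \<gg>" "bracket e f = mscale 2 h" "bracket h f = mscale (- 1) f"
    and "has_degree d f" "d \<noteq> (0, 0)"
  shows "f \<in> \<gg>"
proof (rule classical_cases[OF classical])
  assume "\<gg> = {X. trace X = 0}"
  then show ?thesis using trace_degree assms by simp
next
  fix B assume B: "nondegenerate_form B" "\<gg> = skew_adjoint B"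
  interpret bigraded_form h1 h2 P S B by unfold_locales (use B in_alg in auto)
  show ?thesis using lowering_skew assms B by blast
qed

lemma h_commute: "bracket h1 h2 = 0"
  by (rule matrix_eqI) (auto simp: mult_vec_simps eigenspace_iff vec.scale_left_commute)

text \<open>The tuple in \<open>ee\<close> covers both triples at once; \<open>e'\<close> is the
  raising operator of the other one. The relation \<open>[e', f] = 0\<close> makes \<open>h\<close>,
  and with it its component of degree (0, 0), commute with \<open>e'\<close>, so that the difference
  from \<open>2 k\<close> centralizes the whole pair and not just \<open>e\<close>.\<close>

lemma lowering_of_triple:
  fixes d d' :: "rat \<times> rat"
  assumes f: "f \<in> \<gg>" and triple: "sl2_triple e h f" and "bracket e' f = 0"
    and ee: "(e, e', k, d, d') \<in> {(e1, e2, h1, (1, 0), (0, 1)), (e2, e1, h2, (0, 1), (1, 0))}"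
  shows "bracket e (hom_part (- d) f) = mscale 2 k"
proof -
  have mem: "e \<in> \<gg>" "k \<in> \<gg>" and deg: "has_degree d e" "has_degree d' e'" and d: "d \<noteq> (0, 0)"
    and k: "bracket k e = mscale 1 e" "bracket k e' = 0" and k0: "has_degree (0, 0) k"
    using ee in_alg degree_e1 degree_e2 h_commute
    by (auto simp: has_degree_iff bracket_antisym[of h2 h1]) (simp_all add: bracket_def)
  have e'h: "bracket e' h = 0"
  proof -
    have "bracket e' e = 0" using ee e1_e2 by (auto simp: bracket_antisym[of e2 e1])
    moreover have "h = bracket e f" using triple by (simp add: sl2_triple_def)
    ultimately show ?thesis using assms(3) by (simp add: bracket_jacobi[of e'])
  qed
  have eh: "bracket e h = mscale (- 2) e"
    using triple by (simp add: sl2_triple_def bracket_antisym[of e h] matrix_eq mult_vec_simps vec.scale_minus_left)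
  define h0 where "h0 = hom_part (0, 0) h"
  have h0: "bracket e (hom_part (- d) f) = h0"
    using hom_part_bracket[OF deg(1), of "- d" f] triple by (simp add: h0_def sl2_triple_def zero_prod_def)
  let ?X = "h0 - mscale 2 k"
  have "hom_part (- d) f \<in> \<gg>" by (rule hom_part_in[OF f]) (use d in \<open>auto simp: prod_eq_iff\<close>)
  \<comment> \<open>Components of nonzero degree stay in the algebra; the component of degree (0, 0)
    gets there as the bracket of \<open>e\<close> with one of them.\<close>
  then have "h0 \<in> \<gg>" using h0 mem(1) classical_subalgebra(2)[OF classical] by metis
  then have X: "?X \<in> \<gg>"
    using classical_subalgebra(1)[OF classical] mem(2) by (intro mat_space.subspace_diff mat_space.subspace_scale)
  have deg_e: "has_degree d (mscale (- 2) e)"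
    by (rule has_degreeI) (simp only: mscale_mult_vec vec.subspace_scale[OF subspace_eigenspace] has_degreeD[OF deg(1)])
  have "bracket e h0 = hom_part d (bracket e h)"
    using hom_part_bracket[OF deg(1), of "(0, 0)" h] by (simp add: h0_def zero_prod_def[symmetric])
  then have eh0: "bracket e h0 = mscale (- 2) e" using hom_part_same[OF deg_e] eh by simp
  have hp0: "hom_part d 0 = 0" for d by (rule matrix_eqI) (simp add: hom_part_mult)
  have "bracket e' h0 = hom_part d' (bracket e' h)"
    using hom_part_bracket[OF deg(2), of "(0, 0)" h] by (simp add: h0_def zero_prod_def[symmetric])
  then have e'h0: "bracket e' h0 = 0" unfolding e'h hp0 .
  have sub: "bracket x (y - mscale 2 z) = bracket x y - mscale 2 (bracket x z)" for x y z
    by (simp add: matrix_eq mult_vec_simps)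
  have z1: "bracket e ?X = 0"
    unfolding sub eh0 bracket_antisym[of e k] k by (simp add: matrix_eq mult_vec_simps)
  have z2: "bracket e' ?X = 0"
    unfolding sub e'h0 bracket_antisym[of e' k] k by simp
  have "has_degree (0, 0) (mscale 2 k)"
    by (rule has_degreeI) (simp add: mscale_mult_vec vec.subspace_scale[OF subspace_eigenspace] has_degreeD[OF k0])
  then have "has_degree (0, 0) ?X" unfolding h0_def by (intro has_degree_diff has_degree_hom_part)
  then have "?X = 0" using degree_0_centralizer[OF X] z1 z2 ee by blast
  then show ?thesis using h0 by simp
qed

lemma rectangular_pair_iff_lowering:
  "rectangular_pair \<gg> e1 e2 \<longleftrightarrow> (\<exists>f1 f2. sl2_pair h1 h2 P S e1 e2 f1 f2)"
proof
  assume "rectangular_pair \<gg> e1 e2"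
  then obtain k1 f1 k2 f2 where f: "f1 \<in> \<gg>" "f2 \<in> \<gg>" "sl2_triple e1 k1 f1" "sl2_triple e2 k2 f2"
    and c: "bracket f1 e2 = 0" "bracket e1 f2 = 0"
    by (auto simp: rectangular_pair_def)
  have c': "bracket e2 f1 = 0" using c(1) by (simp add: bracket_antisym[of e2])
  have "sl2_pair h1 h2 P S e1 e2 (hom_part (- (1, 0)) f1) (hom_part (- (0, 1)) f2)"
  proof
    show "has_degree (- 1, 0) (hom_part (- (1, 0)) f1)" "has_degree (0, - 1) (hom_part (- (0, 1)) f2)"
      using has_degree_hom_part[of "(- 1, 0)" f1] has_degree_hom_part[of "(0, - 1)" f2] by simp_all
    show "bracket e1 (hom_part (- (1, 0)) f1) = mscale 2 h1"
      by (rule lowering_of_triple[OF f(1,3) c', where d' = "(0, 1)"]) simp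
    show "bracket e2 (hom_part (- (0, 1)) f2) = mscale 2 h2"
      by (rule lowering_of_triple[OF f(2,4) c(2), where d' = "(1, 0)"]) simp
  qed
  then show "\<exists>f1 f2. sl2_pair h1 h2 P S e1 e2 f1 f2" by blast
next
  assume "\<exists>f1 f2. sl2_pair h1 h2 P S e1 e2 f1 f2"
  then obtain f1 f2 where "sl2_pair h1 h2 P S e1 e2 f1 f2" by blast
  then interpret sl2_pair h1 h2 P S e1 e2 f1 f2 .
  have f: "f1 \<in> \<gg>" "f2 \<in> \<gg>"
    using lowering_in[OF in_alg(3,1) e1_f1 h_brackets(5) degree_f1]
      lowering_in[OF in_alg(4,2) e2_f2 h_brackets(8) degree_f2] by simp_all
  have h: "mscale 2 h1 \<in> \<gg>" "mscale 2 h2 \<in> \<gg>"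
    using classical_subalgebra(1)[OF classical] in_alg by (auto intro: mat_space.subspace_scale)
  have t: "sl2_triple e1 (mscale 2 h1) f1" "sl2_triple e2 (mscale 2 h2) f2"
    by (simp_all add: sl2_triple_def e1_f1 e2_f2 bracket_mscale_left h_brackets)
  have "bracket x y = 0" if "x \<in> {e1, mscale 2 h1, f1}" "y \<in> {e2, mscale 2 h2, f2}" for x y
    using that h_brackets h_commute e1_e2 e1_f2 e2_f1 f2_f1
    by (auto simp: bracket_mscale_left bracket_mscale_right bracket_antisym[of f1] bracket_antisym[of e1 h2])
  then show "rectangular_pair \<gg> e1 e2"
    using pre f h t unfolding rectangular_pair_def pre_distinguished_def by blast
qed

end

section \<open>The two kinds of skew-graphs\<close>

lemma (in bigraded) semisimple_eltI:
  assumes "\<And>u v. v \<in> E u \<Longrightarrow> v \<in> vec.span {v. \<exists>c. X *v v = c *s v}"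
  shows "semisimple_elt X"
proof -
  have "v \<in> vec.span {v. \<exists>c. X *v v = c *s v}" for v
    by (rule E_decomp[OF _ vec.subspace_span]) (use assms P_in in blast)
  then show ?thesis by (auto simp: semisimple_elt_def)
qed

lemma (in bigraded) eigenvector_of_line:
  assumes "has_degree (0, 0) X" "vec.dim (E u) \<le> 1" "v \<in> E u"
  shows "v \<in> vec.span {v. \<exists>c. X *v v = c *s v}"
proof (cases "v = 0")
  case False
  have "X *v v \<in> E u" using has_degreeD[OF assms(1,3)] by (simp add: zero_prod_def[symmetric])
  then have "\<exists>c. X *v v = c *s v" using dim_le_1_multiple assms(2,3) False by blast
  then show ?thesis by (intro vec.span_base) simp
qed (simp add: vec.span_zero)

lemma (in bigraded_pair) multiplicity_free_case:
  assumes "classical_simple \<gg>" "h1 \<in> \<gg>" "h2 \<in> \<gg>" "e1 \<in> \<gg>" "e2 \<in> \<gg>" "pre_distinguished \<gg> e1 e2"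
    and dim: "\<And>u. vec.dim (E u) \<le> 1"
  shows "rectangular_pair \<gg> e1 e2 \<longleftrightarrow> (\<forall>C\<in>components_of (graph_on UNIV). rectangular C)"
proof -
  interpret distinguished_setting h1 h2 P S e1 e2 \<gg>
    by unfold_locales (use assms semisimple_eltI eigenvector_of_line in blast)+
  have mf: "\<exists>c. w = c *s v" if "v \<in> UNIV \<inter> E u" "v \<noteq> 0" "w \<in> UNIV \<inter> E u" for u v w
    using dim_le_1_multiple[OF dim[of u]] that by blast
  show ?thesis unfolding rectangular_pair_iff_lowering
  proof
    assume "\<exists>f1 f2. sl2_pair h1 h2 P S e1 e2 f1 f2"
    then obtain f1 f2 where "sl2_pair h1 h2 P S e1 e2 f1 f2" by blast
    then interpret sl2_pair h1 h2 P S e1 e2 f1 f2 .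
    show "\<forall>C\<in>components_of (graph_on UNIV). rectangular C"
      unfolding rectangular_iff_box
      by (intro ballI component_is_box[OF vec.subspace_UNIV _ mf]) (auto simp: stable_def)
  next
    assume "\<forall>C\<in>components_of (graph_on UNIV). rectangular C"
    then have boxes: "\<And>C. C \<in> components_of (graph_on UNIV) \<Longrightarrow> \<exists>m n. C = box_graph m n"
      by (simp add: rectangular_iff_box)
    \<comment> \<open>The whole space is a single piece here, so the projection is the
      identity.\<close>
    have one: "has_degree (0, 0) (mat 1)" "mat 1 ** mat 1 = (mat 1 :: 'k^'n^'n)"
      "bracket e1 (mat 1) = 0" "bracket e2 (mat 1) = 0" "UNIV = {v. mat 1 *v v = (v :: 'k^'n)}"
      by (rule has_degreeI) (simp_all add: zero_prod_def[symmetric] bracket_def)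
    have "\<exists>f. has_degree (- 1, 0) f \<and> bracket e1 f = mscale 2 (h1 ** mat 1)"
      by (rule lowering_operators_from_boxes(1)[OF one]) (use mf boxes in blast)+
    then obtain f1 where f1: "has_degree (- 1, 0) f1" "bracket e1 f1 = mscale 2 (h1 ** mat 1)"
      by blast
    have "\<exists>f. has_degree (0, - 1) f \<and> bracket e2 f = mscale 2 (h2 ** mat 1)"
      by (rule lowering_operators_from_boxes(2)[OF one]) (use mf boxes in blast)+
    then obtain f2 where f2: "has_degree (0, - 1) f2" "bracket e2 f2 = mscale 2 (h2 ** mat 1)"
      by blast
    have "sl2_pair h1 h2 P S e1 e2 f1 f2"
      by unfold_locales (use f1 f2 in simp_all)
    then show "\<exists>f1 f2. sl2_pair h1 h2 P S e1 e2 f1 f2" by blast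
  qed
qed

section \<open>The even orthogonal case: splitting into multiplicity-free pieces\<close>

lemma complement_projection:
  fixes A C :: "('k::field^'n) set"
  assumes A: "vec.subspace A" and C: "vec.subspace C" and int: "A \<inter> C = {0}"
    and sum: "\<And>v. \<exists>a\<in>A. \<exists>c\<in>C. v = a + c"
  shows "\<exists>\<pi> :: 'k^'n^'n. (\<forall>a\<in>A. \<pi> *v a = a) \<and> (\<forall>c\<in>C. \<pi> *v c = 0)"
proof -
  have uniq: "a = a'" if "a \<in> A" "a' \<in> A" "v - a \<in> C" "v - a' \<in> C" for a a' v
  proof -
    have "(v - a') - (v - a) \<in> C" using vec.subspace_diff[OF C that(4,3)] .
    then have "a - a' \<in> A \<inter> C" using A that by (simp add: vec.subspace_diff)
    then show ?thesis using int by simp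
  qed
  have "\<exists>a. a \<in> A \<and> v - a \<in> C" for v using sum[of v] by auto
  then obtain g where g: "\<And>v. g v \<in> A" "\<And>v. v - g v \<in> C" by metis
  have "Vector_Spaces.linear (*s) (*s) g"
  proof unfold_locales
    fix v w c
    show "g (v + w) = g v + g w"
    proof (rule uniq[of _ _ "v + w"])
      have "(v - g v) + (w - g w) \<in> C" by (rule vec.subspace_add[OF C g(2) g(2)])
      then show "v + w - (g v + g w) \<in> C" by (simp add: algebra_simps)
    qed (use g A in \<open>auto intro: vec.subspace_add\<close>)
    show "g (c *s v) = c *s g v"
    proof (rule uniq[of _ _ "c *s v"])
      have "c *s (v - g v) \<in> C" by (rule vec.subspace_scale[OF C g(2)])
      then show "c *s v - c *s g v \<in> C" by (simp add: vec.scale_right_diff_distrib)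
    qed (use g A in \<open>auto intro: vec.subspace_scale\<close>)
  qed
  then have m: "matrix g *v v = g v" for v by (rule matrix_works)
  have "g a = a" if "a \<in> A" for a by (rule uniq[of _ _ a]) (use g that C in \<open>auto simp: vec.subspace_0\<close>)
  moreover have "g c = 0" if "c \<in> C" for c
    by (rule uniq[of _ _ c]) (use g that A in \<open>auto simp: vec.subspace_0\<close>)
  ultimately show ?thesis using m by metis
qed

lemma components_of_connected:
  assumes "pair_wf_digraph G" "digraph_connected G"
  shows "components_of G = {G}"
proof -
  interpret pair_wf_digraph G by fact
  have "pverts G \<noteq> {}" using assms digraph_connected_iff_no_cut by blast
  moreover have "component_at G u = G" if "u \<in> pverts G" for u
    using that assms wellformed' by (intro component_at_eqI) auto
  ultimately show ?thesis
    unfolding components_of_conv_component_at[OF assms(1)] by (simp add: image_constant_conv cong: image_cong_simp)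
qed

lemma (in nondegenerate) form_power:
  "f \<in> skew_adjoint B \<Longrightarrow> B (((*v) f ^^ k) v) w = (- 1) ^ k * B v (((*v) f ^^ k) w)"
proof (induct k arbitrary: w)
  case (Suc k)
  then show ?case by (simp add: skewD funpow_swap1[of "(*v) f" k w])
qed simp

text \<open>The form pairs the highest with the lowest weight vector nontrivially, and moving the \<open>m + n\<close>
  lowering operators to the other argument produces the sign \<open>(- 1) ^ (m + n)\<close>.\<close>

lemma highest_weight_parity:
  assumes "sl2_pair h1 h2 P S e1 e2 f1 f2" and "bigraded_form h1 h2 P S B"
    and sym: "symmetric_form B" and f: "f1 \<in> skew_adjoint B" "f2 \<in> skew_adjoint B"
    and v: "v \<in> eigenspace h1 h2 (of_nat m / 2, of_nat n / 2)" "v \<noteq> 0" "e1 *v v = 0" "e2 *v v = 0"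
    and line: "vec.dim (eigenspace h1 h2 (- (of_nat m / 2, of_nat n / 2))) \<le> 1"
  shows "even (m + n)"
proof (rule ccontr)
  assume odd: "odd (m + n)"
  interpret sl2_pair h1 h2 P S e1 e2 f1 f2 by fact
  interpret bigraded_form h1 h2 P S B by fact
  define x where "x = ((*v) f2 ^^ n) (((*v) f1 ^^ m) v)"
  obtain m' n' where "of_nat m / 2 = (of_nat m' / 2 :: rat)" "of_nat n / 2 = (of_nat n' / 2 :: rat)"
    "\<And>i j. i \<le> m' \<Longrightarrow> j \<le> n' \<Longrightarrow> ((*v) f2 ^^ j) (((*v) f1 ^^ i) v) \<noteq> 0"
    by (rule highest_weight_vector[OF v]) (rule that)
  then have x0: "x \<noteq> 0" by (simp add: x_def)
  have "x \<in> E (- (of_nat m / 2, of_nat n / 2))"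
    using has_degree_power[OF degree_f2 has_degree_power[OF degree_f1 v(1), of m], of n]
    by (simp add: x_def)
  moreover obtain w where "w \<in> E (- (of_nat m / 2, of_nat n / 2))" "B v w \<noteq> 0"
    using form_nonzero[OF v(1,2)] by blast
  \<comment> \<open>The opposite weight space is a line, so it is spanned by the lowest weight
    vector \<open>x\<close>.\<close>
  moreover from calculation obtain c where "w = c *s x" using dim_le_1_multiple[OF line _ x0] by blast
  ultimately have Bx: "B v x \<noteq> 0" by (auto simp: form_simps)
  have s: "B y z = B z y" for y z using sym by (simp add: symmetric_form_def)
  have x': "x = ((*v) f1 ^^ m) (((*v) f2 ^^ n) v)"
  proof -
    have "f2 *v ((*v) f1 ^^ m) y = ((*v) f1 ^^ m) (f2 *v y)" for y by (rule comm_power[OF f2_f1])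
    then show ?thesis unfolding x_def by (induct n) simp_all
  qed
  have "B x v = (- 1) ^ n * ((- 1) ^ m * B v x)"
    unfolding x_def form_power[OF f(2)] form_power[OF f(1)] x'[unfolded x_def, symmetric] by simp
  also have "\<dots> = (- 1) ^ (m + n) * B v x" by (simp add: power_add)
  also have "\<dots> = - B v x" using odd by simp
  finally show False using s[of x v] Bx by (simp add: eq_neg_iff_add_eq_0 mult_2[symmetric])
qed

text \<open>Algebraic closedness is imposed on the field for the square root that diagonalizes
  elements of degree (0, 0) on the plane \<open>E (0, 0)\<close>.\<close>

locale so_even_setting = bigraded_pair h1 h2 P S e1 e2 + bigraded_form h1 h2 P S B
  for h1 h2 :: "'k::{alg_closed_field, field_char_0}^'n^'n" and P S e1 e2 B +
  fixes \<gg> :: "('k^'n^'n) set" and U1 U2 :: "('k^'n) set"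
  assumes classical: "classical_simple \<gg>" and in_alg: "h1 \<in> \<gg>" "h2 \<in> \<gg>" "e1 \<in> \<gg>" "e2 \<in> \<gg>"
    and pre: "pre_distinguished \<gg> e1 e2"
    and symmetric: "symmetric_form B" and alg: "\<gg> = skew_adjoint B"
    and dim_zero: "vec.dim (eigenspace h1 h2 (0, 0)) = 2"
    and dim_nonzero: "\<And>u. u \<noteq> (0, 0) \<Longrightarrow> vec.dim (eigenspace h1 h2 u) \<le> 1"
    and decomposition: "orthogonal_decomposition B (integral_part h1 h2) U1 U2"
    and stable_U: "stable {e1, e2, h1, h2} U1" "stable {e1, e2, h1, h2} U2"
    and dim_U: "\<And>u. vec.dim (U1 \<inter> eigenspace h1 h2 u) \<le> 1" "\<And>u. vec.dim (U2 \<inter> eigenspace h1 h2 u) \<le> 1"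
begin

abbreviation "Vi \<equiv> integral_part h1 h2"
abbreviation "Vf \<equiv> fractional_part h1 h2"

text \<open>The projection onto the integral part along the fractional part.\<close>

definition Q where "Q = (\<Sum>u\<in>S. mscale (if u \<in> \<int> \<times> \<int> then 1 else 0) (P u))"

lemma Q_E: "v \<in> E u \<Longrightarrow> Q *v v = (if u \<in> \<int> \<times> \<int> then v else 0)"
  unfolding Q_def by (subst diagonal_mult) auto

lemma E_int: "v \<in> E u \<Longrightarrow> u \<in> \<int> \<times> \<int> \<Longrightarrow> v \<in> Vi"
  unfolding integral_part_def by (rule vec.span_base) blast

lemma E_frac: "v \<in> E u \<Longrightarrow> u \<notin> \<int> \<times> \<int> \<Longrightarrow> v \<in> Vf"
  unfolding fractional_part_def by (rule vec.span_base) blast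

lemma Vi_iff: "v \<in> Vi \<longleftrightarrow> Q *v v = v"
proof
  assume "v \<in> Vi"
  have "Vi \<subseteq> {v. Q *v v = mat 1 *v v}"
    unfolding integral_part_def by (rule vec.span_minimal[OF _ subspace_agree]) (auto simp: Q_E split: if_splits)
  then show "Q *v v = v" using \<open>v \<in> Vi\<close> by auto
next
  have sub: "vec.subspace Vi" by (simp add: integral_part_def)
  have "v \<in> {v. Q *v v \<in> Vi}"
    by (rule E_decomp[OF _ subspace_preimage[OF sub]])
      (simp add: Q_E[OF P_in] E_int[OF P_in] vec.subspace_0[OF sub])
  then show "Q *v v = v \<Longrightarrow> v \<in> Vi" by simp
qed

lemma Vf_iff: "v \<in> Vf \<longleftrightarrow> Q *v v = 0"
proof
  assume "v \<in> Vf"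
  have "Vf \<subseteq> {v. Q *v v = 0 *v v}"
    unfolding fractional_part_def by (rule vec.span_minimal[OF _ subspace_agree]) (auto simp: Q_E split: if_splits)
  then show "Q *v v = 0" using \<open>v \<in> Vf\<close> by auto
next
  have sub: "vec.subspace Vf" by (simp add: fractional_part_def)
  have "v \<in> {v. (mat 1 - Q) *v v \<in> Vf}"
    by (rule E_decomp[OF _ subspace_preimage[OF sub]])
      (simp add: matrix_vector_mult_diff_rdistrib Q_E[OF P_in] E_frac[OF P_in] vec.subspace_0[OF sub])
  then show "Q *v v = 0 \<Longrightarrow> v \<in> Vf" by (simp add: matrix_vector_mult_diff_rdistrib)
qed

lemma Q_idem: "Q *v (Q *v v) = Q *v v"
proof -
  have "Q ** Q = Q" by (rule matrix_eqI) (simp add: matrix_vector_mul_assoc[symmetric] Q_E)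
  then show ?thesis by (metis matrix_vector_mul_assoc)
qed

lemma Q_commute: "has_degree d X \<Longrightarrow> d \<in> \<int> \<times> \<int> \<Longrightarrow> Q *v (X *v v) = X *v (Q *v v)"
proof -
  assume X: "has_degree d X" and d: "d \<in> \<int> \<times> \<int>"
  have "u + d \<in> \<int> \<times> \<int> \<longleftrightarrow> u \<in> \<int> \<times> \<int>" for u :: "rat \<times> rat"
  proof -
    have "x + y \<in> \<int> \<longleftrightarrow> x \<in> \<int>" if "y \<in> \<int>" for x y :: rat
      using Ints_add[of x y] Ints_diff[of "x + y" y] that by auto
    then show ?thesis using d by (simp add: mem_Times_iff)
  qed
  then have "Q ** X = X ** Q"
    by (intro matrix_eqI) (simp add: matrix_vector_mul_assoc[symmetric] Q_E Q_E[OF has_degreeD[OF X]])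
  then show ?thesis by (metis matrix_vector_mul_assoc)
qed

lemma subspaces: "vec.subspace U1" "vec.subspace U2" "vec.subspace Vf"
  using decomposition by (simp_all add: orthogonal_decomposition_def fractional_part_def)

lemma U_in: "v \<in> U1 \<Longrightarrow> Q *v v = v" "v \<in> U2 \<Longrightarrow> Q *v v = v"
proof -
  have Vi: "Vi = {v + w | v w. v \<in> U1 \<and> w \<in> U2}"
    using decomposition by (simp add: orthogonal_decomposition_def)
  have "0 \<in> U1" "0 \<in> U2" using subspaces by (simp_all add: vec.subspace_0)
  then have "U1 \<subseteq> Vi" "U2 \<subseteq> Vi" unfolding Vi by (force, force)
  then show "v \<in> U1 \<Longrightarrow> Q *v v = v" "v \<in> U2 \<Longrightarrow> Q *v v = v" using Vi_iff by blast+
qed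

lemma decomp: "\<exists>a\<in>U1. \<exists>b\<in>U2. \<exists>c\<in>Vf. v = a + b + c"
proof -
  have "Q *v v \<in> Vi" by (simp add: Vi_iff Q_idem)
  then obtain a b where "a \<in> U1" "b \<in> U2" "Q *v v = a + b"
    using decomposition by (auto simp: orthogonal_decomposition_def)
  moreover have "v - Q *v v \<in> Vf" by (simp add: Vf_iff mult_vec_simps Q_idem)
  ultimately show ?thesis by (metis add_diff_cancel_left' add_diff_inverse diff_add_cancel add.commute)
qed

text \<open>Describing the pieces as fixed spaces of idempotents of degree (0, 0) makes two tools
  applicable: commutation with \<open>f1\<close> and \<open>f2\<close> by weights, and the
  construction of lowering operators inside a fixed space. The idempotents commute with
  \<open>e1\<close>, \<open>e2\<close> and the grading because the pieces are stable.\<close>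

lemma piece_projections:
  obtains \<pi>1 \<pi>2 \<pi>0 :: "'k^'n^'n" where "\<pi>1 + \<pi>2 + \<pi>0 = mat 1"
    "U1 = {v. \<pi>1 *v v = v}" "U2 = {v. \<pi>2 *v v = v}" "Vf = {v. \<pi>0 *v v = v}"
    "\<And>\<pi>. \<pi> \<in> {\<pi>1, \<pi>2, \<pi>0} \<Longrightarrow>
       has_degree (0, 0) \<pi> \<and> \<pi> ** \<pi> = \<pi> \<and> bracket e1 \<pi> = 0 \<and> bracket e2 \<pi> = 0"
proof -
  have U12: "U1 \<inter> U2 = {0}" using decomposition by (simp add: orthogonal_decomposition_def)
  have sums: "vec.subspace {b + c | b c. b \<in> U2 \<and> c \<in> Vf}" "vec.subspace {a + c | a c. a \<in> U1 \<and> c \<in> Vf}"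
    by (rule vec.subspace_sums; rule subspaces)+
  have "\<exists>\<pi>1 :: 'k^'n^'n. (\<forall>a\<in>U1. \<pi>1 *v a = a) \<and> (\<forall>c\<in>{b + c | b c. b \<in> U2 \<and> c \<in> Vf}. \<pi>1 *v c = 0)"
  proof (rule complement_projection[OF subspaces(1) sums(1)])
    show "U1 \<inter> {b + c | b c. b \<in> U2 \<and> c \<in> Vf} = {0}"
    proof (intro equalityI subsetI)
      fix v assume "v \<in> U1 \<inter> {b + c | b c. b \<in> U2 \<and> c \<in> Vf}"
      then obtain b c where v: "v \<in> U1" "v = b + c" "b \<in> U2" "c \<in> Vf" by blast
      have "v = b" using U_in(1)[OF v(1)] U_in(2)[OF v(3)] v(4) by (simp add: v(2) Vf_iff mult_vec_simps)
      then show "v \<in> {0}" using v U12 by blast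
    qed (use vec.subspace_0[OF subspaces(1)] vec.subspace_0[OF sums(1)] in blast)
    show "\<exists>a\<in>U1. \<exists>c\<in>{b + c | b c. b \<in> U2 \<and> c \<in> Vf}. v = a + c" for v
      using decomp[of v] by (auto simp: add.assoc)
  qed
  then obtain \<pi>1 :: "'k^'n^'n" where 1: "\<And>a. a \<in> U1 \<Longrightarrow> \<pi>1 *v a = a"
    "\<And>b c. b \<in> U2 \<Longrightarrow> c \<in> Vf \<Longrightarrow> \<pi>1 *v (b + c) = 0" by blast
  have "\<exists>\<pi>2 :: 'k^'n^'n. (\<forall>b\<in>U2. \<pi>2 *v b = b) \<and> (\<forall>c\<in>{a + c | a c. a \<in> U1 \<and> c \<in> Vf}. \<pi>2 *v c = 0)"
  proof (rule complement_projection[OF subspaces(2) sums(2)])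
    show "U2 \<inter> {b + c | b c. b \<in> U1 \<and> c \<in> Vf} = {0}"
    proof (intro equalityI subsetI)
      fix v assume "v \<in> U2 \<inter> {b + c | b c. b \<in> U1 \<and> c \<in> Vf}"
      then obtain b c where v: "v \<in> U2" "v = b + c" "b \<in> U1" "c \<in> Vf" by blast
      have "v = b" using U_in(2)[OF v(1)] U_in(1)[OF v(3)] v(4) by (simp add: v(2) Vf_iff mult_vec_simps)
      then show "v \<in> {0}" using v U12 by blast
    qed (use vec.subspace_0[OF subspaces(2)] vec.subspace_0[OF sums(2)] in blast)
    show "\<exists>a\<in>U2. \<exists>c\<in>{b + c | b c. b \<in> U1 \<and> c \<in> Vf}. v = a + c" for v
    proof -
      obtain a b c where abc: "a \<in> U1" "b \<in> U2" "c \<in> Vf" "v = a + b + c" using decomp by blast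
      have "v = b + (a + c)" unfolding abc(4) by (simp only: add.assoc add.left_commute)
      then show ?thesis using abc(1-3) by blast
    qed
  qed
  then obtain \<pi>2 :: "'k^'n^'n" where 2: "\<And>b. b \<in> U2 \<Longrightarrow> \<pi>2 *v b = b"
    "\<And>a c. a \<in> U1 \<Longrightarrow> c \<in> Vf \<Longrightarrow> \<pi>2 *v (a + c) = 0" by blast
  define \<pi>0 where "\<pi>0 = mat 1 - Q"
  have zero: "0 \<in> U1" "0 \<in> U2" "0 \<in> Vf" using subspaces by (simp_all add: vec.subspace_0)
  have val: "\<pi>1 *v (a + b + c) = a" "\<pi>2 *v (a + b + c) = b" "\<pi>0 *v (a + b + c) = c"
    if "a \<in> U1" "b \<in> U2" "c \<in> Vf" for a b c
  proof -
    show "\<pi>1 *v (a + b + c) = a"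
      using 1(1)[OF that(1)] 1(2)[OF that(2,3)] by (simp add: add.assoc matrix_vector_right_distrib)
    show "\<pi>2 *v (a + b + c) = b"
      using 2(1)[OF that(2)] 2(2)[OF that(1,3)]
      by (simp add: add.assoc add.left_commute[of a] matrix_vector_right_distrib)
    show "\<pi>0 *v (a + b + c) = c"
      using U_in that by (simp add: \<pi>0_def mult_vec_simps Vf_iff)
  qed
  have comm: "bracket X \<pi> = 0" if X: "X \<in> {e1, e2, h1, h2}" and \<pi>: "\<pi> \<in> {\<pi>1, \<pi>2, \<pi>0}" for X \<pi>
  proof -
    have degX: "\<exists>d. has_degree d X \<and> d \<in> \<int> \<times> \<int>"
    proof -
      have "has_degree (0, 0) h1" "has_degree (0, 0) h2"
        by (rule has_degreeI; auto simp: zero_prod_def[symmetric] eigenspace_iff mult_vec_simps vec.scale_left_commute)+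
      moreover have "{(0, 0), (1, 0), (0, 1)} \<subseteq> (\<int> \<times> \<int> :: (rat \<times> rat) set)" by simp
      ultimately show ?thesis using X degree_e1 degree_e2 by blast
    qed
    have "X *v (\<pi> *v v) = \<pi> *v (X *v v)" for v
    proof -
      obtain a b c where v: "a \<in> U1" "b \<in> U2" "c \<in> Vf" "v = a + b + c" using decomp by blast
      have "X *v a \<in> U1" "X *v b \<in> U2" using stable_U X v by (auto simp: stable_def)
      moreover have "X *v c \<in> Vf" using degX v(3) by (auto simp: Vf_iff Q_commute)
      moreover have Xv: "X *v v = X *v a + X *v b + X *v c" by (simp add: v(4) matrix_vector_right_distrib)
      ultimately show ?thesis
        using val[of "X *v a" "X *v b" "X *v c"] val[OF v(1-3)] \<pi> unfolding Xv unfolding v(4) by auto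
    qed
    then show ?thesis by (simp add: matrix_eq mult_vec_simps)
  qed
  have idem: "\<pi> ** \<pi> = \<pi>" if "\<pi> \<in> {\<pi>1, \<pi>2, \<pi>0}" for \<pi>
  proof -
    have "\<pi> *v (\<pi> *v v) = \<pi> *v v" for v
    proof -
      obtain a b c where v: "a \<in> U1" "b \<in> U2" "c \<in> Vf" "v = a + b + c" using decomp by blast
      have "\<pi>1 *v a = a" "\<pi>2 *v b = b" "\<pi>0 *v c = c"
        using val(1)[OF v(1) zero(2,3)] val(2)[OF zero(1) v(2) zero(3)] val(3)[OF zero(1,2) v(3)] by simp_all
      then show ?thesis using that val[OF v(1-3)] unfolding v(4) by auto
    qed
    then show ?thesis by (simp add: matrix_eq mult_vec_simps)
  qed
  have deg0: "has_degree (0, 0) \<pi>" if "\<pi> \<in> {\<pi>1, \<pi>2, \<pi>0}" for \<pi>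
    unfolding has_degree_iff using comm that by (simp add: matrix_eq mult_vec_simps)
  have fix1: "U1 = {v. \<pi>1 *v v = v}" "U2 = {v. \<pi>2 *v v = v}" "Vf = {v. \<pi>0 *v v = v}"
  proof -
    have "\<pi>1 *v v \<in> U1" "\<pi>2 *v v \<in> U2" for v
    proof -
      obtain a b c where "a \<in> U1" "b \<in> U2" "c \<in> Vf" "v = a + b + c" using decomp by blast
      then show "\<pi>1 *v v \<in> U1" "\<pi>2 *v v \<in> U2" using val by simp_all
    qed
    then have "v \<in> U1 \<longleftrightarrow> \<pi>1 *v v = v" "v \<in> U2 \<longleftrightarrow> \<pi>2 *v v = v" for v
      using 1(1) 2(1) by (metis, metis)
    moreover have "v \<in> Vf \<longleftrightarrow> \<pi>0 *v v = v" for v by (auto simp: \<pi>0_def Vf_iff mult_vec_simps)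
    ultimately show "U1 = {v. \<pi>1 *v v = v}" "U2 = {v. \<pi>2 *v v = v}" "Vf = {v. \<pi>0 *v v = v}" by blast+
  qed
  have one: "\<pi>1 + \<pi>2 + \<pi>0 = mat 1"
    unfolding matrix_eq
  proof
    fix v
    obtain a b c where v: "a \<in> U1" "b \<in> U2" "c \<in> Vf" "v = a + b + c" using decomp by blast
    show "(\<pi>1 + \<pi>2 + \<pi>0) *v v = mat 1 *v v"
      using val[OF v(1-3)] by (simp add: matrix_vector_mult_add_rdistrib v(4))
  qed
  show thesis by (rule that[OF one fix1]) (use comm idem deg0 in blast)
qed

text \<open>The weight space that fails to be a line is \<open>E (0, 0)\<close>. It is integral, so
  it meets the fractional part trivially, while \<open>U1\<close> and \<open>U2\<close> meet every
  weight space in at most a line.\<close>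

lemma piece_multiplicity_free:
  assumes W: "W \<in> {U1, U2, Vf}" and v: "v \<in> W \<inter> E u" "v \<noteq> 0" "w \<in> W \<inter> E u"
  shows "\<exists>c. w = c *s v"
proof (cases "W = Vf")
  case True
  have "u \<noteq> (0, 0)"
  proof
    assume "u = (0, 0)"
    then have "Q *v v = v" using v(1) Q_E[of v u] by simp
    then show False using v True by (simp add: Vf_iff)
  qed
  then show ?thesis using dim_le_1_multiple[OF dim_nonzero] v by blast
next
  case False
  then have "vec.dim (W \<inter> E u) \<le> 1" using W dim_U by blast
  then show ?thesis using dim_le_1_multiple v by blast
qed

text \<open>\<open>U1\<close> and \<open>U2\<close> each meet the plane \<open>E (0, 0)\<close> in
  at most a line and together fill it, so each contributes a line. The two lines are orthogonal and
  the form pairs the plane with itself nondegenerately, hence neither is isotropic.\<close>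

lemma zero_space_basis:
  obtains v1 v2 where "v1 \<in> E (0, 0)" "v2 \<in> E (0, 0)" "B v1 v1 \<noteq> 0" "B v2 v2 \<noteq> 0" "B v1 v2 = 0"
    "\<And>v. v \<in> E (0, 0) \<Longrightarrow> \<exists>a b. v = a *s v1 + b *s v2"
proof -
  obtain \<pi>1 \<pi>2 \<pi>0 :: "'k^'n^'n" where one: "\<pi>1 + \<pi>2 + \<pi>0 = mat 1"
    and U: "U1 = {v. \<pi>1 *v v = v}" "U2 = {v. \<pi>2 *v v = v}" "Vf = {v. \<pi>0 *v v = v}"
    and \<pi>: "\<And>\<pi>. \<pi> \<in> {\<pi>1, \<pi>2, \<pi>0} \<Longrightarrow>
       has_degree (0, 0) \<pi> \<and> \<pi> ** \<pi> = \<pi> \<and> bracket e1 \<pi> = 0 \<and> bracket e2 \<pi> = 0"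
    by (rule piece_projections) (rule that)
  have split: "\<exists>a\<in>U1 \<inter> E (0, 0). \<exists>b\<in>U2 \<inter> E (0, 0). v = a + b" if v: "v \<in> E (0, 0)" for v
  proof -
    have in0: "\<pi> *v v \<in> E (0, 0)" if "\<pi> \<in> {\<pi>1, \<pi>2, \<pi>0}" for \<pi>
      using has_degreeD[of "(0, 0)" \<pi> v "(0, 0)"] \<pi>[OF that] v by simp
    have idem: "\<pi> *v (\<pi> *v v) = \<pi> *v v" if "\<pi> \<in> {\<pi>1, \<pi>2, \<pi>0}" for \<pi>
      using \<pi>[OF that] by (metis matrix_vector_mul_assoc)
    have "\<pi>0 *v v \<in> Vf" using idem U(3) by blast
    then have "\<pi>0 *v v = 0" using Q_E[OF in0[of \<pi>0]] by (simp add: Vf_iff)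
    moreover have "(\<pi>1 + \<pi>2 + \<pi>0) *v v = v" by (simp add: one)
    ultimately have "v = \<pi>1 *v v + \<pi>2 *v v" by (simp add: matrix_vector_mult_add_rdistrib)
    moreover have "\<pi>1 *v v \<in> U1" "\<pi>2 *v v \<in> U2" using idem U by blast+
    ultimately show ?thesis using in0 by blast
  qed
  have ne: "\<exists>v\<in>W \<inter> E (0, 0). v \<noteq> 0"
    if W: "(W, W') \<in> {(U1, U2), (U2, U1)}" and dim: "vec.dim (W' \<inter> E (0, 0)) \<le> 1" for W W'
  proof (rule ccontr)
    assume "\<not> ?thesis"
    then have zero: "x = 0" if "x \<in> W \<inter> E (0, 0)" for x using that by blast
    have "v \<in> W'" if v: "v \<in> E (0, 0)" for v
    proof -
      obtain a b where ab: "a \<in> U1 \<inter> E (0, 0)" "b \<in> U2 \<inter> E (0, 0)" "v = a + b" using split[OF v] by blast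
      then have "W = U1 \<and> W' = U2 \<and> a = 0 \<or> W = U2 \<and> W' = U1 \<and> b = 0" using W zero by blast
      then show ?thesis using ab by auto
    qed
    then have "W' \<inter> E (0, 0) = E (0, 0)" by blast
    then show False using dim dim_zero by simp
  qed
  obtain v1 where v1: "v1 \<in> U1" "v1 \<in> E (0, 0)" "v1 \<noteq> 0" using ne[of U1 U2] dim_U(2) by auto
  obtain v2 where v2: "v2 \<in> U2" "v2 \<in> E (0, 0)" "v2 \<noteq> 0" using ne[of U2 U1] dim_U(1) by auto
  have span: "\<exists>a b. v = a *s v1 + b *s v2" if "v \<in> E (0, 0)" for v
  proof -
    obtain x y where xy: "x \<in> U1 \<inter> E (0, 0)" "y \<in> U2 \<inter> E (0, 0)" "v = x + y" using split[OF \<open>v \<in> E (0, 0)\<close>] by blast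
    obtain a where "x = a *s v1" using piece_multiplicity_free[of U1 v1 "(0, 0)" x] v1 xy by auto
    moreover obtain b where "y = b *s v2" using piece_multiplicity_free[of U2 v2 "(0, 0)" y] v2 xy by auto
    ultimately show ?thesis using xy(3) by blast
  qed
  have o: "B v1 v2 = 0" "B v2 v1 = 0"
    using decomposition v1(1) v2(1) symmetric by (auto simp: orthogonal_decomposition_def symmetric_form_def)
  obtain w1 where w1: "w1 \<in> E (0, 0)" "B v1 w1 \<noteq> 0" using form_nonzero[OF v1(2,3)] by auto
  obtain w2 where w2: "w2 \<in> E (0, 0)" "B v2 w2 \<noteq> 0" using form_nonzero[OF v2(2,3)] by auto
  have "B v1 v1 \<noteq> 0" using span[OF w1(1)] w1(2) o by (auto simp: form_simps)
  moreover have "B v2 v2 \<noteq> 0" using span[OF w2(1)] w2(2) o by (auto simp: form_simps)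
  ultimately show thesis using that v1 v2 o span by blast
qed

text \<open>On the two-dimensional space \<open>E (0, 0)\<close> a skew matrix interchanges two orthogonal lines, so it
  is zero or has two distinct eigenvalues.\<close>

lemma degree_0_semisimple:
  assumes X: "X \<in> \<gg>" "has_degree (0, 0) X"
  shows "semisimple_elt X"
proof (rule semisimple_eltI)
  fix u v assume v: "v \<in> E u"
  let ?N = "{v. \<exists>c. X *v v = c *s v}"
  show "v \<in> vec.span ?N"
  proof (cases "u = (0, 0)")
    case False
    then show ?thesis using eigenvector_of_line[OF X(2) dim_nonzero v] by blast
  next
    case True
    obtain v1 v2 where v12: "v1 \<in> E (0, 0)" "v2 \<in> E (0, 0)" and nz: "B v1 v1 \<noteq> 0" "B v2 v2 \<noteq> 0"
      and o: "B v1 v2 = 0" and span: "\<And>v. v \<in> E (0, 0) \<Longrightarrow> \<exists>a b. v = a *s v1 + b *s v2"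
      by (rule zero_space_basis) (rule that)
    have s: "B y z = B z y" for y z using symmetric by (simp add: symmetric_form_def)
    have skew: "B (X *v y) z = - B y (X *v z)" for y z using X(1) alg skewD by blast
    have self: "B (X *v y) y = 0" for y
    proof -
      have "B (X *v y) y = - B (X *v y) y" using skew[of y y] s[of y "X *v y"] by simp
      then show ?thesis by (simp add: eq_neg_iff_add_eq_0 mult_2[symmetric])
    qed
    have in0: "X *v y \<in> E (0, 0)" if "y \<in> E (0, 0)" for y using has_degreeD[OF X(2) that] by simp
    obtain a c where c: "X *v v1 = a *s v1 + c *s v2" using span[OF in0[OF v12(1)]] by blast
    obtain d b where d: "X *v v2 = d *s v1 + b *s v2" using span[OF in0[OF v12(2)]] by blast
    have "a = 0" using self[of v1] nz o s[of v2 v1] unfolding c by (simp add: form_simps)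
    have "b = 0" using self[of v2] nz o unfolding d by (simp add: form_simps)
    have X1: "X *v v1 = c *s v2" and X2: "X *v v2 = d *s v1" using c d \<open>a = 0\<close> \<open>b = 0\<close> by simp_all
    have cd: "c * B v2 v2 = - d * B v1 v1"
      using skew[of v1 v2] unfolding X1 X2 by (simp add: form_simps)
    have "v1 \<in> vec.span ?N \<and> v2 \<in> vec.span ?N"
    proof (cases "c = 0")
      case True
      then have "d = 0" using cd nz by simp
      then have "v1 \<in> ?N" "v2 \<in> ?N" using X1 X2 True by (auto intro: exI[of _ 0])
      then show ?thesis by (blast intro: vec.span_base)
    next
      case False
      then have "d \<noteq> 0" using cd nz by auto
      \<comment> \<open>On the span of \<open>v1\<close> and \<open>v2\<close> the square of
        \<open>X\<close> is the scalar \<open>c * d\<close>; its square root \<open>s\<close> yields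
        eigenvectors \<open>s v1 + c v2\<close> and \<open>s v1 - c v2\<close> with eigenvalues
        \<open>s\<close> and \<open>- s\<close>.\<close>
      obtain s where s: "s ^ 2 = c * d" using nth_root_exists[of 2 "c * d"] by auto
      then have "s \<noteq> 0" using False \<open>d \<noteq> 0\<close> by auto
      have "X *v (s *s v1 + c *s v2) = s *s (s *s v1 + c *s v2)"
        "X *v (s *s v1 - c *s v2) = (- s) *s (s *s v1 - c *s v2)"
        using s by (simp_all add: mult_vec_simps X1 X2 power2_eq_square vec.scale_left_commute mult.commute)
      then have N: "s *s v1 + c *s v2 \<in> vec.span ?N" "s *s v1 - c *s v2 \<in> vec.span ?N"
        by (blast intro: vec.span_base)+
      have eqs: "(1 / (2 * s)) *s ((s *s v1 + c *s v2) + (s *s v1 - c *s v2)) = v1"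
        "(1 / (2 * c)) *s ((s *s v1 + c *s v2) - (s *s v1 - c *s v2)) = v2"
        using False \<open>s \<noteq> 0\<close> by (simp_all add: vec_eq_iff field_simps)
      show ?thesis
        using vec.span_scale[OF vec.span_add[OF N], of "1 / (2 * s)"]
          vec.span_scale[OF vec.span_diff[OF N], of "1 / (2 * c)"] unfolding eqs by blast
    qed
    moreover obtain r t where "v = r *s v1 + t *s v2" using span v True by blast
    ultimately show ?thesis by (auto intro: vec.span_add vec.span_scale)
  qed
qed

sublocale distinguished_setting h1 h2 P S e1 e2 \<gg>
  by unfold_locales (use classical in_alg pre degree_0_semisimple in blast)+


text \<open>A box with m by n steps has its top corner at (m/2, n/2). In the fractional part m and n
  are not both even, while the symmetric form forces m + n to be even; so both are odd and the box
  contains (1/2, 1/2). Components sharing a node coincide.\<close>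

lemma fractional_components_connected:
  assumes sl2: "sl2_pair h1 h2 P S e1 e2 f1 f2" and f: "f1 \<in> skew_adjoint B" "f2 \<in> skew_adjoint B"
    and boxes: "\<And>C. C \<in> components_of (graph_on Vf) \<Longrightarrow> \<exists>m n. C = box_graph m n"
    and ne: "Vf \<noteq> {0}"
  shows "digraph_connected (graph_on Vf)"
proof -
  let ?G = "graph_on Vf"
  have st: "stable {e1, e2} Vf"
    unfolding stable_def using Q_commute[OF degree_e1] Q_commute[OF degree_e2] by (simp add: Vf_iff)
  interpret G: pair_fin_digraph ?G by (rule wf_graph_on[OF subspaces(3) st])
  note wf = G.pair_wf_digraph_axioms
  have half: "(1 / 2, 1 / 2) \<in> pverts (component_at ?G u)" if u: "u \<in> pverts ?G" for u
  proof -
    have "component_at ?G u \<in> components_of ?G"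
      using u by (simp add: components_of_conv_component_at[OF wf])
    then obtain m n where C: "component_at ?G u = box_graph m n" using boxes by blast
    let ?t = "(of_nat m / 2 :: rat, of_nat n / 2 :: rat)"
    have t: "?t \<in> pverts (box_graph m n)"
      unfolding in_pverts_box_iff by (auto intro: exI[of _ m] exI[of _ n])
    have "pverts (component_at ?G u) \<subseteq> pverts ?G"
      using subgraph_component_at[OF wf u] by (auto simp: subgraph_def)
    then have "?t \<in> pverts ?G" using t unfolding C by blast
    then obtain v where v: "v \<in> Vf" "v \<in> E ?t" "v \<noteq> 0" unfolding in_pverts_iff[OF subspaces(3)] by blast
    have sink: "(?t, u') \<notin> parcs ?G" for u'
    proof
      assume a: "(?t, u') \<in> parcs ?G"
      then have "u' \<in> pverts (box_graph m n)" using closed_component_at[OF wf u a] t unfolding C by blast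
      moreover have "u' = ?t + (1, 0) \<or> u' = ?t + (0, 1)" using a unfolding in_parcs_attached_graph_iff by blast
      moreover have "of_nat k / 2 + 1 \<noteq> of_nat i - (of_nat k / 2 :: rat)" if "i \<le> k" for i k :: nat
      proof
        assume "of_nat k / 2 + 1 = of_nat i - (of_nat k / 2 :: rat)"
        then have "of_nat (k + 1) = (of_nat i :: rat)" by (simp add: field_simps)
        then show False using that by (simp only: of_nat_eq_iff)
      qed
      ultimately show False by (auto simp: in_pverts_box_iff)
    qed
    then have ev: "e1 *v v = 0" "e2 *v v = 0" using v unfolding in_parcs_attached_graph_iff by blast+
    have "?t \<notin> \<int> \<times> \<int>"
    proof
      assume "?t \<in> \<int> \<times> \<int>"
      then have "Q *v v = v" using Q_E[OF v(2)] by simp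
      then show False using v(1,3) by (simp add: Vf_iff)
    qed
    then have "odd m \<or> odd n" by (auto elim!: evenE)
    moreover have "even (m + n)"
    proof (rule highest_weight_parity[OF sl2 bigraded_form_axioms symmetric f v(2,3) ev])
      have "- ?t \<noteq> (0, 0)"
      proof
        assume "- ?t = (0, 0)"
        then have "?t \<in> \<int> \<times> \<int>" by simp
        then show False using \<open>?t \<notin> \<int> \<times> \<int>\<close> by blast
      qed
      then show "vec.dim (E (- ?t)) \<le> 1" by (rule dim_nonzero)
    qed
    ultimately obtain k l where "m = 2 * k + 1" "n = 2 * l + 1" by (auto elim!: oddE)
    \<comment> \<open>Starting from the lowest corner, k + 1 out of 2k + 1 steps lead to the
      coordinate 1/2.\<close>
    then show ?thesis
      unfolding C in_pverts_box_iff by (intro conjI exI[of _ "Suc k"] exI[of _ "Suc l"]) (simp_all add: field_simps)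
  qed
  obtain v where "v \<in> Vf" "v \<noteq> 0" using ne vec.subspace_0[OF subspaces(3)] by blast
  \<comment> \<open>If the graph had no nodes, all components of \<open>v\<close> would be integral,
    so \<open>v\<close> would lie in both parts and vanish.\<close>
  have "\<exists>u. u \<in> pverts ?G"
  proof (rule ccontr)
    assume none: "\<nexists>u. u \<in> pverts ?G"
    have "P u *v x \<in> Vi" for u x
    proof (cases "u \<in> \<int> \<times> \<int>")
      case False
      then have "P u *v x \<in> Vf" by (rule E_frac[OF P_in])
      then have "P u *v x = 0" using none P_in[of u x] unfolding in_pverts_iff[OF subspaces(3)] by blast
      then show ?thesis by (simp add: Vi_iff)
    qed (rule E_int[OF P_in])
    then have "v \<in> Vi" by (intro E_decomp[of v]) (simp_all add: integral_part_def)
    then show False using \<open>v \<in> Vf\<close> \<open>v \<noteq> 0\<close> by (simp add: Vi_iff Vf_iff)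
  qed
  then obtain u where u: "u \<in> pverts ?G" by blast
  let ?C = "component_at ?G u"
  have arcs: "parcs ?C = parcs ?G \<inter> pverts ?C \<times> pverts ?C" by (simp add: component_at_def Let_def)
  have sub: "pverts ?C \<subseteq> pverts ?G"
    using subgraph_component_at[OF wf u] by (auto simp: subgraph_def)
  have "pverts ?G \<subseteq> pverts ?C"
  proof
    fix w assume w: "w \<in> pverts ?G"
    have self: "w \<in> pverts (component_at ?G w)" by (simp add: component_at_def Let_def)
    show "w \<in> pverts ?C"
    proof (rule digraph_connectedD[OF wf_component_at[OF wf w] connected_component_at[OF wf w] _ half[OF u] half[OF w] self])
      fix a b assume "(a, b) \<in> parcs (component_at ?G w)"
      then have "(a, b) \<in> parcs ?G" by (simp add: component_at_def Let_def)
      then show "a \<in> pverts ?C \<longleftrightarrow> b \<in> pverts ?C" by (rule closed_component_at[OF wf u])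
    qed
  qed
  then have "pverts ?C = pverts ?G" using sub by blast
  moreover have "parcs ?C = parcs ?G" unfolding arcs calculation using G.wellformed' by auto
  ultimately have "?C = ?G" by simp
  then show ?thesis using connected_component_at[OF wf u] by simp
qed

text \<open>The projections onto the pieces commute with \<open>f1\<close> and \<open>f2\<close>, so
  each piece is a module over both copies of sl2 with weight lines, and the box argument applies to
  it. Conversely, lowering operators of the pieces are added up: their brackets sum to
  \<open>2 h1\<close> and \<open>2 h2\<close> because the projections sum to the identity.\<close>

lemma two_component_case:
  assumes connected: "digraph_connected (graph_on U1)" "digraph_connected (graph_on U2)"
  shows "rectangular_pair \<gg> e1 e2 \<longleftrightarrow>
    rectangular (graph_on U1) \<and> rectangular (graph_on U2) \<and> (Vf = {0} \<or> rectangular (graph_on Vf))"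
proof -
  obtain \<pi>1 \<pi>2 \<pi>0 :: "'k^'n^'n" where one: "\<pi>1 + \<pi>2 + \<pi>0 = mat 1"
    and U: "U1 = {v. \<pi>1 *v v = v}" "U2 = {v. \<pi>2 *v v = v}" "Vf = {v. \<pi>0 *v v = v}"
    and \<pi>: "\<And>\<pi>. \<pi> \<in> {\<pi>1, \<pi>2, \<pi>0} \<Longrightarrow>
       has_degree (0, 0) \<pi> \<and> \<pi> ** \<pi> = \<pi> \<and> bracket e1 \<pi> = 0 \<and> bracket e2 \<pi> = 0"
    by (rule piece_projections) (rule that)
  let ?pieces = "{(\<pi>1, U1), (\<pi>2, U2), (\<pi>0, Vf)}"
  have stable_e: "stable {e1, e2} W" if W: "(\<pi>, W) \<in> ?pieces" for \<pi> W
  proof -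
    have "bracket e1 \<pi> = 0" "bracket e2 \<pi> = 0" using W \<pi> by blast+
    then have "e1 *v (\<pi> *v v) = \<pi> *v (e1 *v v)" "e2 *v (\<pi> *v v) = \<pi> *v (e2 *v v)" for v
      by (metis bracket_mult_vec matrix_vector_mult_0 right_minus_eq)+
    moreover have "W = {v. \<pi> *v v = v}" using W U by blast
    ultimately show ?thesis unfolding stable_def by (metis (mono_tags, lifting) empty_iff insert_iff mem_Collect_eq)
  qed
  have wf: "pair_wf_digraph (graph_on W)" if "(\<pi>, W) \<in> ?pieces" for \<pi> W
    using wf_graph_on[OF _ stable_e[OF that]] subspaces that by (auto simp: pair_fin_digraph_def)
  have mf: "\<exists>c. w = c *s v" if "(\<pi>, W) \<in> ?pieces" "v \<in> W \<inter> E u" "v \<noteq> 0" "w \<in> W \<inter> E u" for \<pi> W u v w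
    using piece_multiplicity_free[of W v u w] that by blast
  have comps: "components_of (graph_on U1) = {graph_on U1}" "components_of (graph_on U2) = {graph_on U2}"
    using connected wf by (auto intro!: components_of_connected)
  show ?thesis unfolding rectangular_pair_iff_lowering
  proof
    assume "\<exists>f1 f2. sl2_pair h1 h2 P S e1 e2 f1 f2"
    then obtain f1 f2 where sl2: "sl2_pair h1 h2 P S e1 e2 f1 f2" by blast
    interpret sl2: sl2_pair h1 h2 P S e1 e2 f1 f2 by fact
    have f: "f1 \<in> skew_adjoint B" "f2 \<in> skew_adjoint B"
      using lowering_in[OF in_alg(3,1) sl2.e1_f1 sl2.h_brackets(5) sl2.degree_f1]
        lowering_in[OF in_alg(4,2) sl2.e2_f2 sl2.h_brackets(8) sl2.degree_f2] alg by simp_all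
    have boxes: "\<exists>m n. C = box_graph m n"
      if W: "(\<pi>, W) \<in> ?pieces" and C: "C \<in> components_of (graph_on W)" for \<pi> W C
    proof (rule sl2.component_is_box[OF _ _ _ C])
      show "vec.subspace W" using W subspaces by blast
      have p: "has_degree (0, 0) \<pi>" "bracket e1 \<pi> = 0" "bracket e2 \<pi> = 0" using W \<pi> by blast+
      then have "bracket h1 \<pi> = 0" "bracket h2 \<pi> = 0" by (simp_all add: has_degree_iff)
      then have "bracket \<pi> f1 = 0" "bracket \<pi> f2 = 0"
        using sl2.commute_f1[OF p(1,2)] sl2.commute_f2[OF p(1,3)] by blast+
      then have "\<pi> *v (f1 *v v) = f1 *v (\<pi> *v v)" "\<pi> *v (f2 *v v) = f2 *v (\<pi> *v v)" for v
        using sl2.bracket_comm by blast+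
      moreover have "W = {v. \<pi> *v v = v}" using W U by blast
      ultimately have "stable {f1, f2} W" by (simp add: stable_def)
      then show "stable {e1, e2, f1, f2} W" using stable_e[OF W] by (simp add: stable_def)
      show "\<exists>c. w = c *s v" if "v \<in> W \<inter> E u" "v \<noteq> 0" "w \<in> W \<inter> E u" for u v w
        using mf[OF W that] .
    qed
    have "rectangular (graph_on U1)" "rectangular (graph_on U2)"
      using boxes comps unfolding rectangular_iff_box by blast+
    \<comment> \<open>For \<open>U1\<close> and \<open>U2\<close> connectivity is given, whereas for
      the fractional part it is deduced from the form; after that its graph is its own unique
      component.\<close>
    moreover have "rectangular (graph_on Vf)" if "Vf \<noteq> {0}"
    proof -
      have "digraph_connected (graph_on Vf)"
        by (rule fractional_components_connected[OF sl2 f _ that]) (use boxes in blast)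
      then have "components_of (graph_on Vf) = {graph_on Vf}"
        using wf by (intro components_of_connected) blast+
      then show ?thesis using boxes unfolding rectangular_iff_box by blast
    qed
    ultimately show "rectangular (graph_on U1) \<and> rectangular (graph_on U2) \<and> (Vf = {0} \<or> rectangular (graph_on Vf))"
      by blast
  next
    assume rect: "rectangular (graph_on U1) \<and> rectangular (graph_on U2) \<and> (Vf = {0} \<or> rectangular (graph_on Vf))"
    have boxes: "\<exists>m n. C = box_graph m n"
      if W: "(\<pi>, W) \<in> ?pieces" and C: "C \<in> components_of (graph_on W)" for \<pi> W C
    proof (cases "W = {0}")
      \<comment> \<open>A zero piece has an empty graph and no components; this covers a vanishing
        fractional part.\<close>
      case True
      then have "pverts (graph_on W) = {}" by (auto simp: pverts_attached_graph eigenspace_def)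
      then show ?thesis using C by (simp add: components_of_conv_component_at[OF wf[OF W]])
    next
      case False
      then have r: "rectangular (graph_on W)" using rect W by auto
      then have "digraph_connected (graph_on W)" by (simp add: rectangular_def connected_skew_graph_def)
      then have "components_of (graph_on W) = {graph_on W}" by (rule components_of_connected[OF wf[OF W]])
      then show ?thesis using C r by (simp add: rectangular_iff_box)
    qed
    have lower: "\<exists>f. has_degree (- 1, 0) f \<and> bracket e1 f = mscale 2 (h1 ** \<pi>)"
      "\<exists>f. has_degree (0, - 1) f \<and> bracket e2 f = mscale 2 (h2 ** \<pi>)" if W: "(\<pi>, W) \<in> ?pieces" for \<pi> W
    proof -
      have p: "has_degree (0, 0) \<pi>" "\<pi> ** \<pi> = \<pi>" "bracket e1 \<pi> = 0" "bracket e2 \<pi> = 0" using W \<pi> by blast+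
      have WW: "W = {v. \<pi> *v v = v}" using W U by blast
      show "\<exists>f. has_degree (- 1, 0) f \<and> bracket e1 f = mscale 2 (h1 ** \<pi>)"
        by (rule lowering_operators_from_boxes(1)[OF p WW]) (rule mf[OF W] boxes[OF W], assumption+)+
      show "\<exists>f. has_degree (0, - 1) f \<and> bracket e2 f = mscale 2 (h2 ** \<pi>)"
        by (rule lowering_operators_from_boxes(2)[OF p WW]) (rule mf[OF W] boxes[OF W], assumption+)+
    qed
    have add: "bracket e (x + y + z) = mscale 2 h"
      if "bracket e x = mscale 2 (h ** \<pi>1)" "bracket e y = mscale 2 (h ** \<pi>2)" "bracket e z = mscale 2 (h ** \<pi>0)"
      for e h x y z :: "'k^'n^'n"
    proof -
      have "bracket e (x + y + z) = bracket e x + bracket e y + bracket e z"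
        by (simp add: matrix_eq mult_vec_simps)
      also have "\<dots> = mscale 2 (h ** (\<pi>1 + \<pi>2 + \<pi>0))"
        unfolding that by (simp add: matrix_eq mult_vec_simps)
      finally show ?thesis by (simp add: one)
    qed
    have degree_add: "has_degree d (x + y + z)" if "has_degree d x" "has_degree d y" "has_degree d z" for d x y z
      by (rule has_degreeI) (use that in \<open>simp add: matrix_vector_mult_add_rdistrib has_degreeD
          vec.subspace_add subspace_eigenspace\<close>)
    obtain x1 x2 x0 where x: "has_degree (- 1, 0) x1" "has_degree (- 1, 0) x2" "has_degree (- 1, 0) x0"
      "bracket e1 x1 = mscale 2 (h1 ** \<pi>1)" "bracket e1 x2 = mscale 2 (h1 ** \<pi>2)" "bracket e1 x0 = mscale 2 (h1 ** \<pi>0)"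
      using lower(1)[of \<pi>1 U1] lower(1)[of \<pi>2 U2] lower(1)[of \<pi>0 Vf] by blast
    obtain y1 y2 y0 where y: "has_degree (0, - 1) y1" "has_degree (0, - 1) y2" "has_degree (0, - 1) y0"
      "bracket e2 y1 = mscale 2 (h2 ** \<pi>1)" "bracket e2 y2 = mscale 2 (h2 ** \<pi>2)" "bracket e2 y0 = mscale 2 (h2 ** \<pi>0)"
      using lower(2)[of \<pi>1 U1] lower(2)[of \<pi>2 U2] lower(2)[of \<pi>0 Vf] by blast
    have "sl2_pair h1 h2 P S e1 e2 (x1 + x2 + x0) (y1 + y2 + y0)"
      using degree_add[OF x(1-3)] degree_add[OF y(1-3)] add[OF x(4-6)] add[OF y(4-6)] by unfold_locales
    then show "\<exists>f1 f2. sl2_pair h1 h2 P S e1 e2 f1 f2" by blast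
  qed
qed

end

theorem theorem4p3:
  fixes \<gg> :: "('k::{alg_closed_field, field_char_0}^'n^'n) set"
    and e1 e2 :: "'k^'n^'n"
    and \<Gamma> :: skew_graph
  assumes "classical_simple \<gg>"
    and "distinguished \<gg> e1 e2"
    and "skew_graph_of_pair \<gg> e1 e2 \<Gamma>"
  shows "rectangular_pair \<gg> e1 e2 \<longleftrightarrow> (\<forall>C\<in>\<Gamma>. rectangular C)"
proof -
  obtain h1 h2 where assoc: "associated_semisimple_pair \<gg> e1 e2 h1 h2"
    and graph: "multiplicity_free_graph e1 e2 h1 h2 \<Gamma> \<or> so_even_graph \<gg> e1 e2 h1 h2 \<Gamma>"
    using assms(3) by (auto simp: skew_graph_of_pair_def)
  note h = assoc[unfolded associated_semisimple_pair_def]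
  have pre: "pre_distinguished \<gg> e1 e2" using assms(2) by (simp add: distinguished_def)
  then have e: "e1 \<in> \<gg>" "e2 \<in> \<gg>" "bracket e1 e2 = 0"
    by (simp_all add: pre_distinguished_def nilpotent_pair_def)
  obtain P S where "bigraded h1 h2 P S" using bigraded_exists[of h1 h2] h by blast
  then interpret bigraded h1 h2 P S .
  interpret bigraded_pair h1 h2 P S e1 e2
    by unfold_locales (use h e in \<open>simp_all add: has_degree_iff\<close>)
  from graph show ?thesis
  proof
    assume "multiplicity_free_graph e1 e2 h1 h2 \<Gamma>"
    then have dim: "\<And>u. vec.dim (E u) \<le> 1" and \<Gamma>: "\<Gamma> = components_of (graph_on UNIV)"
      unfolding multiplicity_free_graph_def by blast+
    show ?thesis
      unfolding \<Gamma> using multiplicity_free_case[OF assms(1) _ _ e(1,2) pre dim] h by blast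
  next
    assume "so_even_graph \<gg> e1 e2 h1 h2 \<Gamma>"
    then obtain B U1 U2 where so: "is_so B \<gg>"
      and dims: "vec.dim (E (0, 0)) = 2" "\<And>u. u \<noteq> (0, 0) \<Longrightarrow> vec.dim (E u) \<le> 1"
      and decomposition: "orthogonal_decomposition B (integral_part h1 h2) U1 U2"
      and stable_U: "stable {e1, e2, h1, h2} U1" "stable {e1, e2, h1, h2} U2"
      and dim_U: "\<And>u. vec.dim (U1 \<inter> E u) \<le> 1" "\<And>u. vec.dim (U2 \<inter> E u) \<le> 1"
      and cs: "cs_integral (graph_on U1)" "cs_integral (graph_on U2)"
      and \<Gamma>: "\<Gamma> = {graph_on U1, graph_on U2} \<union>
        (if fractional_part h1 h2 = {0} then {} else {graph_on (fractional_part h1 h2)})"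
      unfolding so_even_graph_def by blast
    have "so_even_setting h1 h2 P S e1 e2 B \<gg> U1 U2"
      by unfold_locales
        (use so h e dims decomposition stable_U dim_U assms(1) pre in \<open>auto simp: is_so_def\<close>)
    then interpret so_even_setting h1 h2 P S e1 e2 B \<gg> U1 U2 .
    have "digraph_connected (graph_on U1)" "digraph_connected (graph_on U2)"
      using cs by (simp_all add: cs_integral_def centrally_symmetric_def connected_skew_graph_def)
    from two_component_case[OF this] show ?thesis unfolding \<Gamma> by auto
  qed
qed

end
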